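(* Let $b=\{b_I\}_{I\in\mathcal D}$ and $d=\{d_I\}_{I\in\mathcal D}$ be sequences of complex numbers indexed by the dyadic intervals. The composition $\mathsf P_b^{(0,1)}\circ\mathsf P_d^{(0,0)}$ is bounded on $L^2(\mathbb R)$ if and only if both $$|d_I|\left\|\mathsf P_b^{(0,1)}h_I\right\|_{L^2(\mathbb R)}\le C_1,\qquad \left\|\mathsf Q_I\mathsf P_d^{(0,0)}\mathsf P_b^{(1,0)}\mathsf Q_I\overline b\right\|_{L^2(\mathbb R)}\le C_2\left\|\mathsf Q_Ib\right\|_{L^2(\mathbb R)}$$ for all $I\in\mathcal D$; i.e. for all $I\in\mathcal D$ the following inequalities are true: $$|d_I|\Big(\frac1{|I|}\sum_{L\subsetneq I}|b_L|^2\Big)^{1/2}\le C_1,$$ $$\left(\sum_{J\subset I}\frac{|d_J|^2}{|J|}\Big(\sum_{K\subset J_+}|b_K|^2-\sum_{K\subset J_-}|b_K|^2\Big)^2\right)^{1/2}\le C_2\Big(\sum_{L\subset I}|b_L|^2\Big)^{1/2}.$$ Moreover, the norm of $\mathsf P_b^{(0,1)}\circ\mathsf P_d^{(0,0)}$ on $L^2(\mathbb R)$ satisfies $$\left\|\mathsf P_b^{(0,1)}\circ\mathsf P_d^{(0,0)}\right\|_{L^2(\mathbb R)\to L^2(\mathbb R)}\approx C_1+C_2,$$ where $C_1$ and $C_2$ are the best constants appearing above.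
   Context: $\mathcal D$ is the usual grid of dyadic intervals on $\mathbb R$; $I_-$ and $I_+$ are the left and right halves of $I$; $J\subset I$ allows $J=I$. For $I\in\mathcal D$, $h_I=h_I^0=|I|^{-1/2}(-\mathbf 1_{I_-}+\mathbf 1_{I_+})$ and $h_I^1=|I|^{-1}\mathbf 1_I$. For a complex sequence $b=\{b_I\}_{I\in\mathcal D}$ and $(\alpha,\beta)\in\{0,1\}\times\{0,1\}$, the dyadic paraproduct acting on a function $f$ is $$\mathsf P_b^{(\alpha,\beta)}f=\sum_{I\in\mathcal D}b_I\langle f,h_I^\beta\rangle_{L^2(\mathbb R)}h_I^\alpha .$$ $\overline b=\{\overline{b_I}\}_{I\in\mathcal D}$. For $f\in L^2(\mathbb R)$ and $I\in\mathcal D$, $\mathsf Q_If=\sum_{J\subset I}\langle f,h_J\rangle_{L^2(\mathbb R)}h_J$ is the projection onto the span of the Haar functions supported within $I$; for a sequence $a=\{a_J\}_{J\in\mathcal D}$, $\mathsf Q_Ia=\sum_{J\subset I}a_Jh_J$. In the conditions, $C_1$ and $C_2$ are finite constants independent of $I$. $A\approx B$ means $cB\le A\le CB$ with absolute constants $0<c\le C<\infty$. *)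

theory Defs
  imports "HOL-Analysis.Analysis" "HOL-Library.Z2"
begin

section \<open>Dyadic intervals and Haar functions\<close>

definition dyadic :: "real set set" where
  "dyadic = {{of_int m * 2 powi k ..< (of_int m + 1) * 2 powi k} | (m::int) (k::int). True}"

definition left_half :: "real set \<Rightarrow> real set" where
  "left_half I = {x \<in> I. x < (Inf I + Sup I) / 2}"

definition right_half :: "real set \<Rightarrow> real set" where
  "right_half I = {x \<in> I. (Inf I + Sup I) / 2 \<le> x}"

definition len :: "real set \<Rightarrow> real" where
  "len I = measure lborel I"

text \<open>The superscripts \<open>\<alpha>, \<beta> \<in> {0,1}\<close> are elements of the two-element type \<^typ>\<open>bit\<close>.\<close>

definition haar :: "bit \<Rightarrow> real set \<Rightarrow> real \<Rightarrow> complex" where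
  "haar \<alpha> I x =
     (if \<alpha> = 0
      then of_real ((indicator (right_half I) x - indicator (left_half I) x) / sqrt (len I))
      else of_real (indicator I x / len I))"


section \<open>Function spaces and convergence\<close>

definition L2 :: "(real \<Rightarrow> complex) set" where
  "L2 = {f. f \<in> borel_measurable lborel \<and> integrable lborel (\<lambda>x. (cmod (f x))\<^sup>2)}"

definition L2norm :: "(real \<Rightarrow> complex) \<Rightarrow> real" where
  "L2norm f = sqrt (LINT x|lborel. (cmod (f x))\<^sup>2)"

definition pairing :: "(real \<Rightarrow> complex) \<Rightarrow> (real \<Rightarrow> complex) \<Rightarrow> complex" where
  "pairing f g = (LINT x|lborel. f x * cnj (g x))"

definition L1loc :: "(real \<Rightarrow> complex) set" where
  "L1loc = {f. f \<in> borel_measurable lborel \<and> (\<forall>a b. set_integrable lborel {a..b} f)}"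

text \<open>
  All series of functions are read as unconditionally convergent in \<open>L\<^sup>1\<close> on bounded
  intervals. This is implied by unconditional convergence in \<open>L\<^sup>2\<close>, and a Haar series
  whose sum in this sense lies in \<open>L\<^sup>2\<close> converges to it in \<open>L\<^sup>2\<close>. The weaker mode is
  needed because the series \<open>\<Sum> |b\<^sub>J|\<^sup>2 h\<^sub>J\<^sup>1\<close> need not converge in \<open>L\<^sup>2\<close> when
  \<open>\<Sum> |b\<^sub>J|\<^sup>2\<close> is finite. Sums are determined almost everywhere only, so operators given by
  series are represented as relations between a function and (a version of) its image;
  having no image means that the series diverges.
\<close>

definition series_sum ::
  "('i \<Rightarrow> real \<Rightarrow> complex) \<Rightarrow> 'i set \<Rightarrow> (real \<Rightarrow> complex) \<Rightarrow> bool" where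
  "series_sum u A g \<longleftrightarrow>
     (\<forall>i\<in>A. u i \<in> L1loc) \<and> g \<in> L1loc \<and>
     (\<forall>a b. ((\<lambda>F. LINT x:{a..b}|lborel. cmod ((\<Sum>i\<in>F. u i x) - g x)) \<longlongrightarrow> 0)
              (finite_subsets_at_top A))"


section \<open>Paraproducts and Haar projections\<close>

definition paraproduct ::
  "(real set \<Rightarrow> complex) \<Rightarrow> bit \<Rightarrow> bit \<Rightarrow> (real \<Rightarrow> complex) \<Rightarrow> (real \<Rightarrow> complex) \<Rightarrow> bool" where
  "paraproduct b \<alpha> \<beta> f g \<longleftrightarrow>
     f \<in> L1loc \<and>
     series_sum (\<lambda>I x. b I * pairing f (haar \<beta> I) * haar \<alpha> I x) dyadic g"

text \<open>\<open>Q\<^sub>I\<close> on functions and on sequences.\<close>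

definition Q_fun :: "real set \<Rightarrow> (real \<Rightarrow> complex) \<Rightarrow> (real \<Rightarrow> complex) \<Rightarrow> bool" where
  "Q_fun I f g \<longleftrightarrow>
     f \<in> L1loc \<and>
     series_sum (\<lambda>J x. pairing f (haar 0 J) * haar 0 J x) {J \<in> dyadic. J \<subseteq> I} g"

definition Q_seq :: "real set \<Rightarrow> (real set \<Rightarrow> complex) \<Rightarrow> (real \<Rightarrow> complex) \<Rightarrow> bool" where
  "Q_seq I a g \<longleftrightarrow> series_sum (\<lambda>J x. a J * haar 0 J x) {J \<in> dyadic. J \<subseteq> I} g"


section \<open>Boundedness on \<open>L\<^sup>2\<close>\<close>

definition haar_span :: "(real \<Rightarrow> complex) set" where
  "haar_span = {\<lambda>x. \<Sum>I\<in>F. c I * haar 0 I x | F c. finite F \<and> F \<subseteq> dyadic}"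

text \<open>
  For arbitrary coefficient sequences an operator given by series is only densely defined, on
  the finite linear combinations of Haar functions (even a composition that vanishes there
  may have an unbounded inner factor). It is bounded with norm at most \<open>C\<close> if it is defined on
  all these combinations and extends to a linear operator \<open>T\<close> on the whole of \<open>L\<^sup>2\<close> with
  \<open>\<parallel>T f\<parallel> \<le> C \<parallel>f\<parallel>\<close>.
\<close>

definition L2_bounded_by ::
  "((real \<Rightarrow> complex) \<Rightarrow> (real \<Rightarrow> complex) \<Rightarrow> bool) \<Rightarrow> real \<Rightarrow> bool" where
  "L2_bounded_by R C \<longleftrightarrow>
     0 \<le> C \<and>
     (\<exists>T :: (real \<Rightarrow> complex) \<Rightarrow> real \<Rightarrow> complex.
        (\<forall>f\<in>L2. T f \<in> L2 \<and> L2norm (T f) \<le> C * L2norm f) \<and>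
        (\<forall>f\<in>L2. \<forall>g\<in>L2. \<forall>z. AE x in lborel. T (\<lambda>y. f y + z * g y) x = T f x + z * T g x) \<and>
        (\<forall>f\<in>haar_span. R f (T f)))"

definition L2_bounded :: "((real \<Rightarrow> complex) \<Rightarrow> (real \<Rightarrow> complex) \<Rightarrow> bool) \<Rightarrow> bool" where
  "L2_bounded R \<longleftrightarrow> (\<exists>C. L2_bounded_by R C)"

definition L2_opnorm :: "((real \<Rightarrow> complex) \<Rightarrow> (real \<Rightarrow> complex) \<Rightarrow> bool) \<Rightarrow> real" where
  "L2_opnorm R = Inf {C. L2_bounded_by R C}"

text \<open>
  The relational composition \<open>OO\<close> applies its left operand first, so this is
  \<open>P\<^sub>b\<^sup>(\<^sup>0\<^sup>,\<^sup>1\<^sup>) \<circ> P\<^sub>d\<^sup>(\<^sup>0\<^sup>,\<^sup>0\<^sup>)\<close>.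
\<close>

definition para_comp ::
  "(real set \<Rightarrow> complex) \<Rightarrow> (real set \<Rightarrow> complex) \<Rightarrow>
   (real \<Rightarrow> complex) \<Rightarrow> (real \<Rightarrow> complex) \<Rightarrow> bool" where
  "para_comp b d = paraproduct d 0 0 OO paraproduct b 0 1"


section \<open>Testing conditions\<close>

text \<open>
  A norm or sum of squares that diverges counts as \<open>\<infinity>\<close>, with \<open>0 \<cdot> \<infinity> = 0\<close>. Hence the first
  condition is void when \<open>d\<^sub>I = 0\<close> and demands convergence otherwise, while the second
  is void when its right-hand side \<open>\<parallel>Q\<^sub>I b\<parallel>\<close> is infinite and demands convergence otherwise.
\<close>

definition test1 :: "(real set \<Rightarrow> complex) \<Rightarrow> (real set \<Rightarrow> complex) \<Rightarrow> real \<Rightarrow> bool" where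
  "test1 b d C \<longleftrightarrow>
     0 \<le> C \<and>
     (\<forall>I\<in>dyadic. d I \<noteq> 0 \<longrightarrow>
        (\<exists>g\<in>L2. paraproduct b 0 1 (haar 0 I) g \<and> cmod (d I) * L2norm g \<le> C))"

definition test2 :: "(real set \<Rightarrow> complex) \<Rightarrow> (real set \<Rightarrow> complex) \<Rightarrow> real \<Rightarrow> bool" where
  "test2 b d C \<longleftrightarrow>
     0 \<le> C \<and>
     (\<forall>I\<in>dyadic. \<forall>q\<in>L2. Q_seq I b q \<longrightarrow>
        (\<exists>p. \<exists>g\<in>L2. Q_seq I (\<lambda>J. cnj (b J)) p \<and>
           (paraproduct b 1 0 OO paraproduct d 0 0 OO Q_fun I) p g \<and>
           L2norm g \<le> C * L2norm q))"

definition coeff_test1 :: "(real set \<Rightarrow> complex) \<Rightarrow> (real set \<Rightarrow> complex) \<Rightarrow> real \<Rightarrow> bool" where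
  "coeff_test1 b d C \<longleftrightarrow>
     0 \<le> C \<and>
     (\<forall>I\<in>dyadic. d I \<noteq> 0 \<longrightarrow>
        (\<lambda>L. (cmod (b L))\<^sup>2) summable_on {L \<in> dyadic. L \<subset> I} \<and>
        cmod (d I) * sqrt (1 / len I * (\<Sum>\<^sub>\<infinity>L\<in>{L \<in> dyadic. L \<subset> I}. (cmod (b L))\<^sup>2)) \<le> C)"

definition child_diff :: "(real set \<Rightarrow> complex) \<Rightarrow> real set \<Rightarrow> real" where
  "child_diff b J =
     (\<Sum>\<^sub>\<infinity>K\<in>{K \<in> dyadic. K \<subseteq> right_half J}. (cmod (b K))\<^sup>2) -
     (\<Sum>\<^sub>\<infinity>K\<in>{K \<in> dyadic. K \<subseteq> left_half J}. (cmod (b K))\<^sup>2)"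

definition coeff_test2 :: "(real set \<Rightarrow> complex) \<Rightarrow> (real set \<Rightarrow> complex) \<Rightarrow> real \<Rightarrow> bool" where
  "coeff_test2 b d C \<longleftrightarrow>
     0 \<le> C \<and>
     (\<forall>I\<in>dyadic. (\<lambda>L. (cmod (b L))\<^sup>2) summable_on {L \<in> dyadic. L \<subseteq> I} \<longrightarrow>
        (\<lambda>J. (cmod (d J))\<^sup>2 / len J * (child_diff b J)\<^sup>2) summable_on {J \<in> dyadic. J \<subseteq> I} \<and>
        sqrt (\<Sum>\<^sub>\<infinity>J\<in>{J \<in> dyadic. J \<subseteq> I}. (cmod (d J))\<^sup>2 / len J * (child_diff b J)\<^sup>2)
          \<le> C * sqrt (\<Sum>\<^sub>\<infinity>L\<in>{L \<in> dyadic. L \<subseteq> I}. (cmod (b L))\<^sup>2))"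

end

theory Submission
  imports Defs
begin

text \<open>
  In the Haar basis the composition sends \<open>(f\<^sub>J)\<close> to \<open>b\<^sub>K \<Sum>\<^bsub>J \<supset> K\<^esub> \<plusminus> d\<^sub>J f\<^sub>J / \<surd>|J|\<close>, with sign
  \<open>+\<close> for \<open>K \<subseteq> J\<^sub>+\<close> and \<open>-\<close> for \<open>K \<subseteq> J\<^sub>-\<close>. With the weights \<open>\<mu>\<^sub>K = |b\<^sub>K|\<^sup>2\<close>, boundedness with norm
  at most \<open>C\<close> is, by transposition, the inequality
  \<open>\<Sum>\<^sub>J |d\<^sub>J|\<^sup>2 / |J| |\<Sum>\<^bsub>K \<subseteq> J\<^sub>+\<^esub> \<mu>\<^sub>K g\<^sub>K - \<Sum>\<^bsub>K \<subseteq> J\<^sub>-\<^esub> \<mu>\<^sub>K g\<^sub>K|\<^sup>2 \<le> C\<^sup>2 \<Sum>\<^sub>K \<mu>\<^sub>K |g\<^sub>K|\<^sup>2\<close>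
  for finitely supported \<open>g\<close>. The two conditions test the operator on a single \<open>h\<^sub>I\<close> and its transpose on
  the indicator of \<open>{K. K \<subseteq> I}\<close>. Conversely, let \<open>x\<close> be the \<open>\<mu>\<close>-average of \<open>g\<close> over \<open>{K. K \<subseteq> J}\<close> and replace
  \<open>g\<close> by \<open>x + (g - x)\<close> in the difference of the two half sums. The constant part carries the weight
  \<open>|d\<^sub>J|\<^sup>2 / |J| (\<mu>(J\<^sub>+) - \<mu>(J\<^sub>-))\<^sup>2\<close>, a Carleson sequence by the second condition, so that the Carleson
  embedding theorem applies. The rest is at most \<open>C\<^sub>1\<^sup>2\<close> times the square of a martingale difference, by the
  first condition. Both sums are estimated by induction on the depth of the tree below a maximal interval,
  with an explicit Bellman function.
\<close>

section \<open>Dyadic geometry\<close>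

text \<open>For arbitrary \<open>b\<close> and \<open>d\<close> none of the sums has to converge, so
  the operator and the testing conditions are compared only through finite sections of the matrix
  (\<open>finite_bound\<close>), and limits are taken at the two ends. Finite mass below
  \<open>J\<close> is known where \<open>d J\<close> is nonzero, by the first condition; intervals
  with \<open>d J = 0\<close> carry no weight and are removed before maximal intervals are chosen.

  The Bellman function is that of Nazarov, Treil and Volberg for the dyadic Carleson embedding,
  \<open>4 (F - f^2 / (1 + M))\<close>, made homogeneous in the mass: the weights sit on the nodes
  of the tree and may vanish, so averages give way to integrals and masses.

  On the analytic side the obstacle is that \<open>\<Sum> |b K|^2 h_K^1\<close> need not lie in
  \<open>L2\<close>. Series are therefore handled in local mean, where pairing with a bounded
  function of bounded support is continuous. This forces the Haar coefficients of every intermediate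
  function, and membership in \<open>L2\<close> and norms are recovered from them by Bessel and
  Riesz-Fischer.\<close>

definition dint :: "int \<Rightarrow> int \<Rightarrow> real set" where
  "dint m k = {of_int m * 2 powi k ..< (of_int m + 1) * 2 powi k}"

lemma dyadic_eq_dint: "dyadic = {dint m k | m k. True}"
  by (auto simp: dyadic_def dint_def)

lemma dint_dyadic [simp]: "dint m k \<in> dyadic"
  by (auto simp: dyadic_eq_dint)

lemma dyadicE:
  assumes "I \<in> dyadic"
  obtains m k where "I = dint m k"
  using assms by (auto simp: dyadic_eq_dint)

lemma dint_bounds_less: "of_int m * 2 powi k < (of_int m + 1) * (2::real) powi k"
  by (simp add: algebra_simps)

lemma dint_nonempty [simp]: "dint m k \<noteq> {}"
  using dint_bounds_less by (auto simp: dint_def)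

lemma len_dint: "len (dint m k) = 2 powi k"
  using dint_bounds_less[of m k] by (simp add: len_def dint_def algebra_simps)

lemma two_powi_pred: "(2::real) powi k = 2 * 2 powi (k - 1)"
proof -
  have "(2::real) powi k = 2 powi ((k - 1) + 1)" by simp
  also have "\<dots> = 2 * 2 powi (k - 1)" by (subst power_int_add) auto
  finally show ?thesis .
qed

lemma left_half_dint: "left_half (dint m k) = dint (2 * m) (k - 1)"
proof -
  have "Inf (dint m k) = of_int m * 2 powi k" "Sup (dint m k) = (of_int m + 1) * 2 powi k"
    using dint_bounds_less[of m k]
    unfolding dint_def by (auto intro: cInf_atLeastLessThan cSup_atLeastLessThan)
  moreover have "(2::real) powi (k - 1) > 0" by simp
  ultimately show ?thesis
    unfolding left_half_def by (auto simp: dint_def two_powi_pred[of k] algebra_simps)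
qed

lemma right_half_dint: "right_half (dint m k) = dint (2 * m + 1) (k - 1)"
proof -
  have "Inf (dint m k) = of_int m * 2 powi k" "Sup (dint m k) = (of_int m + 1) * 2 powi k"
    using dint_bounds_less[of m k]
    unfolding dint_def by (auto intro: cInf_atLeastLessThan cSup_atLeastLessThan)
  moreover have "(2::real) powi (k - 1) > 0" by simp
  ultimately show ?thesis
    unfolding right_half_def by (auto simp: dint_def two_powi_pred[of k] algebra_simps)
qed

text \<open>Measured in units of \<open>h = 2 powi j\<close>, both intervals have integer endpoints,
  and an interval of length one cannot straddle an integer endpoint of the longer one.\<close>

lemma dint_nested_or_disjoint:
  assumes "j \<le> k"
  shows "dint n j \<subseteq> dint m k \<or> dint n j \<inter> dint m k = {}"
proof -
  define e where "e = nat (k - j)"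
  have k: "k = j + int e" using assms by (simp add: e_def)
  define h :: real where "h = 2 powi j"
  have h: "h > 0" by (simp add: h_def)
  have pk: "(2::real) powi k = of_int (2 ^ e) * h"
    unfolding k h_def by (subst power_int_add) auto
  consider "m * 2 ^ e \<le> n \<and> n + 1 \<le> (m + 1) * 2 ^ e" | "n + 1 \<le> m * 2 ^ e" | "(m + 1) * 2 ^ e \<le> n"
    by (simp add: distrib_right) linarith
  then show ?thesis
  proof cases
    case 1
    then have "of_int (m * 2 ^ e) * h \<le> of_int n * h" "of_int (n + 1) * h \<le> of_int ((m + 1) * 2 ^ e) * h"
      using h by (auto simp del: of_int_mult of_int_add of_int_power)
    then have "dint n j \<subseteq> dint m k"
      unfolding dint_def pk h_def[symmetric] by (auto simp: algebra_simps)
    then show ?thesis ..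
  next
    case 2
    then have "of_int (n + 1) * h \<le> of_int (m * 2 ^ e) * h"
      using h by (auto simp del: of_int_mult of_int_add of_int_power)
    then have "dint n j \<inter> dint m k = {}"
      unfolding dint_def pk h_def[symmetric] by (auto simp: algebra_simps)
    then show ?thesis ..
  next
    case 3
    then have "of_int ((m + 1) * 2 ^ e) * h \<le> of_int n * h"
      using h by (auto simp del: of_int_mult of_int_add of_int_power)
    then have "dint n j \<inter> dint m k = {}"
      unfolding dint_def pk h_def[symmetric] by (auto simp: algebra_simps)
    then show ?thesis ..
  qed
qed

lemma dyadic_nested_or_disjoint:
  assumes "I \<in> dyadic" "J \<in> dyadic"
  shows "I \<subseteq> J \<or> J \<subseteq> I \<or> I \<inter> J = {}"
proof -
  obtain m k n j where "I = dint m k" "J = dint n j"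
    using assms by (meson dyadicE)
  then show ?thesis
    using dint_nested_or_disjoint[of j k n m] dint_nested_or_disjoint[of k j m n] by force
qed

lemma dint_subset_scale:
  assumes "dint n j \<subseteq> dint m k"
  shows "j \<le> k" and "j = k \<Longrightarrow> n = m"
proof -
  have "len (dint n j) \<le> len (dint m k)"
    unfolding len_def using assms dint_bounds_less[of m k]
    by (intro measure_mono_fmeasurable) (auto simp: dint_def fmeasurable_def)
  then show "j \<le> k"
    using power_int_strict_increasing[of k j "2::real"] by (auto simp: len_dint not_less[symmetric])
next
  assume jk: "j = k"
  have "{real_of_int n * 2 powi k..<(real_of_int n + 1) * 2 powi k} \<subseteq> {of_int m * 2 powi k..<(of_int m + 1) * 2 powi k}"
    using assms unfolding dint_def jk .
  from atLeastLessThan_subset_iff[OF this] have "real_of_int m * 2 powi k \<le> of_int n * 2 powi k" 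
      "(real_of_int n + 1) * 2 powi k \<le> (of_int m + 1) * 2 powi k"
    using dint_bounds_less[of n k] by auto
  then show "n = m" by simp
qed

lemma halves_dyadic [simp]:
  assumes "I \<in> dyadic"
  shows "left_half I \<in> dyadic" "right_half I \<in> dyadic"
  using assms by (auto elim!: dyadicE simp: left_half_dint right_half_dint)

lemma halves_Un: "left_half I \<union> right_half I = I"
  by (auto simp: left_half_def right_half_def)

lemma halves_Int: "left_half I \<inter> right_half I = {}"
  by (auto simp: left_half_def right_half_def)

lemma halves_subset: "left_half I \<subseteq> I" "right_half I \<subseteq> I"
  by (auto simp: left_half_def right_half_def)

lemma len_pos [simp]: "I \<in> dyadic \<Longrightarrow> 0 < len I"
  by (auto elim!: dyadicE simp: len_dint)

lemma len_nonneg [simp]: "0 \<le> len I"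
  by (simp add: len_def)

lemma dyadic_nonempty: "I \<in> dyadic \<Longrightarrow> I \<noteq> {}"
  by (auto elim!: dyadicE)

lemma len_halves:
  assumes "I \<in> dyadic"
  shows "len (left_half I) = len I / 2" "len (right_half I) = len I / 2"
proof -
  obtain m k where "I = dint m k" using assms by (rule dyadicE)
  then show "len (left_half I) = len I / 2" "len (right_half I) = len I / 2"
    using two_powi_pred[of k] by (simp_all add: left_half_dint right_half_dint len_dint)
qed

lemma halves_psubset:
  assumes "I \<in> dyadic"
  shows "left_half I \<subset> I" "right_half I \<subset> I"
  using halves_Un[of I] halves_Int[of I] dyadic_nonempty[OF halves_dyadic(1)[OF assms]]
    dyadic_nonempty[OF halves_dyadic(2)[OF assms]] by blast+

text \<open>The scale of \<open>J\<close> is strictly smaller, hence at most that of the halves. So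
  \<open>J\<close> lies inside or outside each half, and it cannot avoid both.\<close>

lemma dyadic_psubset_half:
  assumes "I \<in> dyadic" "J \<in> dyadic" "J \<subset> I"
  shows "J \<subseteq> left_half I \<or> J \<subseteq> right_half I"
proof -
  obtain m k n j where IJ: "I = dint m k" "J = dint n j"
    using assms by (meson dyadicE)
  have "j \<le> k - 1"
    using dint_subset_scale[of n j m k] assms(3) unfolding IJ by force
  from dint_nested_or_disjoint[OF this, of n "2 * m"] dint_nested_or_disjoint[OF this, of n "2 * m + 1"]
  show ?thesis
    using assms(3) halves_Un[of I] dyadic_nonempty[OF assms(2)]
    unfolding IJ left_half_dint right_half_dint by blast
qed

section \<open>The binary tree below a dyadic interval\<close>

definition below :: "real set \<Rightarrow> real set set" where
  "below I = {J \<in> dyadic. J \<subseteq> I}"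

lemma below_decomp:
  assumes "I \<in> dyadic"
  shows "below I = insert I (below (left_half I) \<union> below (right_half I))"
    "I \<notin> below (left_half I)" "I \<notin> below (right_half I)"
    "below (left_half I) \<inter> below (right_half I) = {}"
proof -
  show "below I = insert I (below (left_half I) \<union> below (right_half I))"
  proof (intro equalityI subsetI)
    fix J assume "J \<in> below I"
    then show "J \<in> insert I (below (left_half I) \<union> below (right_half I))"
      using dyadic_psubset_half[OF assms, of J] by (cases "J = I") (auto simp: below_def)
  next
    fix J assume "J \<in> insert I (below (left_half I) \<union> below (right_half I))"
    then show "J \<in> below I"
      using assms halves_subset[of I] by (auto simp: below_def)
  qed
  show "I \<notin> below (left_half I)" "I \<notin> below (right_half I)"
    using halves_psubset[OF assms] by (auto simp: below_def)
  show "below (left_half I) \<inter> below (right_half I) = {}"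
  proof (rule equals0I)
    fix J assume "J \<in> below (left_half I) \<inter> below (right_half I)"
    then have "J \<subseteq> left_half I \<inter> right_half I" "J \<noteq> {}"
      using dyadic_nonempty[of J] by (auto simp: below_def)
    then show False by (simp add: halves_Int)
  qed
qed

lemma strictly_below_decomp:
  assumes "I \<in> dyadic"
  shows "{L \<in> dyadic. L \<subset> I} = below (left_half I) \<union> below (right_half I)"
proof -
  have "{L \<in> dyadic. L \<subset> I} = below I - {I}" by (auto simp: below_def)
  then show ?thesis using below_decomp[OF assms] by simp
qed

text \<open>The first \<open>n\<close> generations below \<open>I\<close>, root included. Truncation
  makes the tree sums finite and gives the recursion on which the Bellman induction runs; every
  finite family below \<open>I\<close> lies in some \<open>subtree n I\<close>.\<close>

fun subtree :: "nat \<Rightarrow> real set \<Rightarrow> real set set" where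
  "subtree 0 I = {}"
| "subtree (Suc n) I = insert I (subtree n (left_half I) \<union> subtree n (right_half I))"

lemma finite_subtree [simp]: "finite (subtree n I)"
  by (induction n I rule: subtree.induct) auto

lemma subtree_subset: "I \<in> dyadic \<Longrightarrow> subtree n I \<subseteq> below I"
proof (induction n I rule: subtree.induct)
  case (2 n I)
  then show ?case
    using below_decomp(1)[of I] by auto
qed auto

lemma subtree_mono: "subtree n I \<subseteq> subtree (Suc n) I"
  by (induction n I rule: subtree.induct) auto

lemma subtree_mono': "n \<le> n' \<Longrightarrow> subtree n I \<subseteq> subtree n' I"
  by (rule lift_Suc_mono_le[of "\<lambda>n. subtree n I"]) (use subtree_mono in auto)

lemma in_subtree:
  assumes "I \<in> dyadic" "J \<in> below I"
  shows "\<exists>n. J \<in> subtree n I"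
proof -
  \<comment> \<open>The required depth is the number of generations between the intervals plus one,
    because \<open>subtree 0\<close> does not contain its root.\<close>
  have "J \<in> subtree (Suc (nat (k - j))) I" if "I = dint m k" "J = dint n j" "J \<subseteq> I" for m k n j I
    using that
  proof (induction "nat (k - j)" arbitrary: I m k)
    case 0
    then have "j \<le> k" using dint_subset_scale(1)[of n j m k] by simp
    then have "j = k" using 0 by simp
    then have "J = I" using dint_subset_scale(2)[of n j m k] 0 by simp
    then show ?case by simp
  next
    case (Suc r)
    have jk: "nat (k - 1 - j) = r" "j < k" using Suc.hyps(2) by auto
    then have "J \<noteq> I" using dint_subset_scale(1)[of m k n j] Suc.prems by auto
    then have "J \<subseteq> left_half I \<or> J \<subseteq> right_half I"
      using Suc.prems by (intro dyadic_psubset_half) auto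
    then have "J \<in> subtree (Suc r) (left_half I) \<or> J \<in> subtree (Suc r) (right_half I)"
      using Suc.hyps(1)[of "k - 1" "left_half I" "2 * m"] Suc.hyps(1)[of "k - 1" "right_half I" "2 * m + 1"] jk Suc.prems
      by (auto simp: left_half_dint right_half_dint simp del: subtree.simps)
    then show ?case
      by (subst subtree.simps) (auto simp: Suc.hyps(2)[symmetric] simp del: subtree.simps)
  qed
  moreover obtain m k n j where "I = dint m k" "J = dint n j"
    using assms by (auto simp: below_def elim!: dyadicE)
  ultimately show ?thesis
    using assms(2) unfolding below_def by blast
qed

lemma finite_subset_subtree:
  assumes "I \<in> dyadic" "finite F" "F \<subseteq> below I"
  shows "\<exists>n. F \<subseteq> subtree n I"
  using assms(2,3)
proof (induction F)
  case (insert J F)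
  obtain n n' where "F \<subseteq> subtree n I" "J \<in> subtree n' I"
    using insert.IH insert.prems in_subtree[OF assms(1), of J] by auto
  then have "insert J F \<subseteq> subtree (max n n') I"
    using subtree_mono'[of n "max n n'" I] subtree_mono'[of n' "max n n'" I] by auto
  then show ?case ..
qed auto

text \<open>At each scale at most one dyadic interval contains \<open>I\<close>, so the ancestors
  form a sequence with doubling lengths. This is what later bounds their contribution by a geometric
  series.\<close>

lemma ancestors_enum:
  assumes "I \<in> dyadic"
  obtains A :: "nat \<Rightarrow> real set" where "{J \<in> dyadic. I \<subseteq> J} \<subseteq> range A" 
    "\<And>n. len (A n) = 2 ^ n * len I"
proof -
  obtain m k where I: "I = dint m k" using assms by (rule dyadicE)
  \<comment> \<open>The default \<open>dint 0 (k + int n)\<close> has the prescribed length too, so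
    the length formula holds at every \<open>n\<close> without first exhibiting an ancestor
    there.\<close>
  define A where "A = (\<lambda>n. if \<exists>p. I \<subseteq> dint p (k + int n) then dint (SOME p. I \<subseteq> dint p (k + int n)) (k + int n) 
      else dint 0 (k + int n))"
  have "J \<in> range A" if J_above: "J \<in> dyadic" "I \<subseteq> J" for J
  proof -
    obtain p j where J: "J = dint p j" using J_above(1) by (rule dyadicE)
    define n where "n = nat (j - k)"
    have j: "j = k + int n"
      using dint_subset_scale(1)[of m k p j] J_above I J by (simp add: n_def)
    define q where "q = (SOME p. I \<subseteq> dint p (k + int n))"
    have ex: "\<exists>p. I \<subseteq> dint p (k + int n)" using J_above J j by blast
    then have q: "I \<subseteq> dint q (k + int n)" unfolding q_def by (rule someI_ex)
    have "dint q j = dint p j"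
      using dint_nested_or_disjoint[of j j q p] dint_subset_scale(2)[of q j p j] q J_above(2)
        dyadic_nonempty[OF assms] unfolding J j by auto
    then have "J = A n" using ex by (simp add: A_def q_def J j)
    then show ?thesis by simp
  qed
  moreover have "len (A n) = 2 ^ n * len I" for n
    by (simp add: A_def I len_dint power_int_add)
  ultimately show thesis using that by blast
qed

text \<open>The value of \<open>\<surd>|J| h\<^sub>J\<close> on \<open>K\<close> if \<open>K\<close> lies in a half of \<open>J\<close>, and \<open>0\<close> otherwise.\<close>

definition half_sign :: "real set \<Rightarrow> real set \<Rightarrow> real" where
  "half_sign J K = indicator (below (right_half J)) K - indicator (below (left_half J)) K"

section \<open>A Bellman function for the testing conditions on finite trees\<close>

text \<open>Subadditivity of \<open>x^2 / a\<close>, a form of Cauchy-Schwarz: for positive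
  \<open>a\<close> and \<open>b\<close> the right side exceeds the left by
  \<open>(x * b - y * a)^2 / (a * b * (a + b))\<close>. The implications at mass 0 make the
  convention \<open>0 / 0 = 0\<close> harmless.\<close>

lemma square_div_add_le:
  fixes a b x y :: real
  assumes "0 \<le> a" "0 \<le> b" "a = 0 \<Longrightarrow> x = 0" "b = 0 \<Longrightarrow> y = 0"
  shows "(x + y)\<^sup>2 / (a + b) \<le> x\<^sup>2 / a + y\<^sup>2 / b"
proof (cases "a = 0 \<or> b = 0")
  case True
  then show ?thesis using assms by auto
next
  case False
  then have ab: "a > 0" "b > 0" using assms by auto
  have "(x + y)\<^sup>2 * (a * b) \<le> (x\<^sup>2 * b + y\<^sup>2 * a) * (a + b)"
    using zero_le_power2[of "x * b - y * a"] by (simp add: power2_eq_square algebra_simps)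
  moreover have "x\<^sup>2 / a + y\<^sup>2 / b = (x\<^sup>2 * b + y\<^sup>2 * a) / (a * b)"
    using ab by (simp add: field_simps)
  ultimately show ?thesis
    using ab by (simp add: frac_le_eq divide_le_eq pos_divide_le_eq pos_le_divide_eq field_simps)
qed

lemma square_div_add3_le:
  fixes \<mu> g a b x y :: real
  assumes "0 \<le> \<mu>" "0 \<le> a" "0 \<le> b" "a = 0 \<Longrightarrow> x = 0" "b = 0 \<Longrightarrow> y = 0"
  shows "(\<mu> * g + x + y)\<^sup>2 / (\<mu> + a + b) \<le> \<mu> * g\<^sup>2 + x\<^sup>2 / a + y\<^sup>2 / b"
proof -
  have "(\<mu> * g + (x + y))\<^sup>2 / (\<mu> + (a + b)) \<le> (\<mu> * g)\<^sup>2 / \<mu> + (x + y)\<^sup>2 / (a + b)"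
    using assms by (intro square_div_add_le) auto
  moreover have "(\<mu> * g)\<^sup>2 / \<mu> = \<mu> * g\<^sup>2" by (simp add: power2_eq_square)
  moreover have "(x + y)\<^sup>2 / (a + b) \<le> x\<^sup>2 / a + y\<^sup>2 / b"
    using assms by (intro square_div_add_le) auto
  ultimately show ?thesis by (simp add: add.assoc)
qed

text \<open>
  The Bellman function is \<open>4 k (V - G\<^sup>2 / (m + A / k))\<close>, with \<open>m\<close> the mass, \<open>G\<close> the integral of \<open>g\<close>,
  \<open>V\<close> the integral of \<open>g\<^sup>2\<close> and \<open>A \<le> k m\<close> the Carleson sum over the tree below an interval. The
  convexity of \<open>G\<^sup>2 / m\<close> controls the passage to the halves; the increase of \<open>A\<close> by \<open>a\<close> pays for the
  new term. Where a mass vanishes so does \<open>G\<close>, and the quotient \<open>0 / 0 = 0\<close> is the right value.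
\<close>

lemma carleson_step:
  fixes k \<mu> mr ml a Ar Al g Gr Gl :: real
  defines "m \<equiv> \<mu> + mr + ml" and "A \<equiv> a + Ar + Al" and "G \<equiv> \<mu> * g + Gr + Gl"
  assumes "0 < k" "0 \<le> \<mu>" "0 \<le> mr" "0 \<le> ml" "0 \<le> a" "0 \<le> Ar" "0 \<le> Al"
    and "A \<le> k * m" "mr = 0 \<Longrightarrow> Gr = 0" "ml = 0 \<Longrightarrow> Gl = 0"
  shows "a * (G / m)\<^sup>2 \<le>
    4 * k * (\<mu> * g\<^sup>2 + Gr\<^sup>2 / (mr + Ar / k) + Gl\<^sup>2 / (ml + Al / k) - G\<^sup>2 / (m + A / k))"
proof (cases "m = 0")
  case True
  then have "\<mu> = 0" "mr = 0" "ml = 0" using assms by (auto simp: m_def)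
  then show ?thesis using assms by (simp add: G_def)
next
  case False
  then have m: "m > 0" using assms by (auto simp: m_def)
  \<comment> \<open>Both \<open>B\<close> and \<open>D\<close> are masses enlarged by Carleson sums,
    \<open>B\<close> without and \<open>D\<close> with the new term \<open>a\<close> of the node.
    Convexity compares the halves with \<open>B\<close>; the passage from \<open>B\<close> to
    \<open>D\<close> pays for the term on the left.\<close>
  define B where "B = m + (Ar + Al) / k"
  define D where "D = m + A / k"
  have D: "D = B + a / k" by (simp add: D_def B_def A_def add_divide_distrib)
  have B: "0 < B" "B \<le> D" using m assms by (auto simp: B_def D intro!: add_pos_nonneg)
  \<comment> \<open>The Carleson bound keeps \<open>B\<close> and \<open>D\<close> below
    \<open>2 * m\<close>; the constant 4 of the embedding is \<open>(2 * m)^2 / m^2\<close>.\<close>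
  have "D \<le> 2 * m" using assms m by (simp add: D_def field_simps)
  then have BD: "B * D \<le> 4 * m\<^sup>2"
    using mult_mono[of B "2 * m" D "2 * m"] B by (auto simp: power2_eq_square)
  have "G\<^sup>2 / B \<le> \<mu> * g\<^sup>2 + Gr\<^sup>2 / (mr + Ar / k) + Gl\<^sup>2 / (ml + Al / k)"
  proof -
    have "mr + Ar / k = 0 \<Longrightarrow> mr = 0" "ml + Al / k = 0 \<Longrightarrow> ml = 0"
      using assms by (auto simp: add_nonneg_eq_0_iff)
    then have "(\<mu> * g + Gr + Gl)\<^sup>2 / (\<mu> + (mr + Ar / k) + (ml + Al / k))
        \<le> \<mu> * g\<^sup>2 + Gr\<^sup>2 / (mr + Ar / k) + Gl\<^sup>2 / (ml + Al / k)"
      using assms by (intro square_div_add3_le) auto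
    moreover have "\<mu> + (mr + Ar / k) + (ml + Al / k) = B"
      by (simp add: B_def m_def add_divide_distrib)
    ultimately show ?thesis by (simp add: G_def)
  qed
  moreover have "a * (G / m)\<^sup>2 \<le> 4 * k * (G\<^sup>2 / B - G\<^sup>2 / D)"
  proof -
    have "G\<^sup>2 / B - G\<^sup>2 / D = G\<^sup>2 * (D - B) / (B * D)"
      using B by (simp add: field_simps)
    then have "4 * k * (G\<^sup>2 / B - G\<^sup>2 / D) = 4 * (a * G\<^sup>2) / (B * D)"
      using assms by (simp add: D)
    also have "\<dots> \<ge> 4 * (a * G\<^sup>2) / (4 * m\<^sup>2)"
      using B m BD assms by (intro divide_left_mono) auto
    finally show ?thesis by (simp add: power_divide)
  qed
  ultimately show ?thesis
    using mult_left_mono[of "G\<^sup>2 / B - G\<^sup>2 / D" 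
      "\<mu> * g\<^sup>2 + Gr\<^sup>2 / (mr + Ar / k) + Gl\<^sup>2 / (ml + Al / k) - G\<^sup>2 / D" "4 * k"] assms(4)
    unfolding D_def by linarith
qed

text \<open>The right-hand factor is the energy of the martingale difference of \<open>g\<close> at one node, so it telescopes.\<close>

lemma martingale_step:
  fixes \<mu> mr ml g Gr Gl :: real
  defines "m \<equiv> \<mu> + mr + ml" and "G \<equiv> \<mu> * g + Gr + Gl"
  assumes "0 \<le> \<mu>" "0 \<le> mr" "0 \<le> ml" "mr = 0 \<Longrightarrow> Gr = 0" "ml = 0 \<Longrightarrow> Gl = 0"
  shows "((Gr - mr * (G / m)) - (Gl - ml * (G / m)))\<^sup>2 \<le>
    (mr + ml) * (\<mu> * g\<^sup>2 + Gr\<^sup>2 / mr + Gl\<^sup>2 / ml - G\<^sup>2 / m)"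
proof (cases "mr + ml = 0")
  case True
  then have "mr = 0" "ml = 0" using assms by auto
  then show ?thesis using assms by simp
next
  case False
  then have m: "m > 0" "mr + ml > 0" using assms by (auto simp: m_def)
  define x where "x = G / m"
  \<comment> \<open>Integrals of \<open>g - x\<close> over the two halves. The energies
    \<open>p^2 / mr\<close> and \<open>q^2 / ml\<close>, together with the share
    \<open>\<mu> * (g - x)^2\<close> of the node itself, add up to the full bracket; that share is
    nonnegative and is discarded.\<close>
  define p q where "p = Gr - mr * x" and "q = Gl - ml * x"
  have "(p + - q)\<^sup>2 / (mr + ml) \<le> p\<^sup>2 / mr + (- q)\<^sup>2 / ml"
    using assms by (intro square_div_add_le) (auto simp: p_def q_def)
  moreover have "p\<^sup>2 / mr = Gr\<^sup>2 / mr - 2 * x * Gr + mr * x\<^sup>2"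
    using assms by (cases "mr = 0") (auto simp: p_def field_simps power2_eq_square)
  moreover have "q\<^sup>2 / ml = Gl\<^sup>2 / ml - 2 * x * Gl + ml * x\<^sup>2"
    using assms by (cases "ml = 0") (auto simp: q_def field_simps power2_eq_square)
  moreover have "0 \<le> \<mu> * (g - x)\<^sup>2" using assms by simp
  moreover have "\<mu> * (g - x)\<^sup>2 = \<mu> * g\<^sup>2 - 2 * x * (\<mu> * g) + \<mu> * x\<^sup>2"
    by (simp add: power2_eq_square algebra_simps)
  moreover have "- 2 * x * (\<mu> * g) - 2 * x * Gr - 2 * x * Gl + \<mu> * x\<^sup>2 + mr * x\<^sup>2 + ml * x\<^sup>2 = - (G\<^sup>2 / m)"
  proof -
    have "- 2 * x * (\<mu> * g) - 2 * x * Gr - 2 * x * Gl + \<mu> * x\<^sup>2 + mr * x\<^sup>2 + ml * x\<^sup>2 = - 2 * x * G + m * x\<^sup>2"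
      by (simp add: G_def m_def algebra_simps)
    also have "\<dots> = - (G\<^sup>2 / m)" using m by (simp add: x_def power2_eq_square)
    finally show ?thesis .
  qed
  ultimately have "(p - q)\<^sup>2 / (mr + ml) \<le> \<mu> * g\<^sup>2 + Gr\<^sup>2 / mr + Gl\<^sup>2 / ml - G\<^sup>2 / m"
    by simp
  then show ?thesis
    using m by (simp add: pos_divide_le_eq mult.commute p_def q_def x_def)
qed

text \<open>The Carleson and martingale estimates have constants \<open>4 * k\<close> and
  \<open>c\<close>; splitting the difference of the half sums by
  \<open>(u + v)^2 \<le> 2 * u^2 + 2 * v^2\<close> doubles both.\<close>

lemma bellman_step:
  fixes k c w \<mu> mr ml Ar Al g Gr Gl :: real
  defines "m \<equiv> \<mu> + mr + ml" and "A \<equiv> w * (mr - ml)\<^sup>2 + Ar + Al" and "G \<equiv> \<mu> * g + Gr + Gl"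
  assumes "0 < k" "0 \<le> \<mu>" "0 \<le> mr" "0 \<le> ml" "0 \<le> w" "0 \<le> Ar" "0 \<le> Al"
    and "A \<le> k * m" "mr = 0 \<Longrightarrow> Gr = 0" "ml = 0 \<Longrightarrow> Gl = 0" "w * (mr + ml) \<le> c"
  shows "w * (Gr - Gl)\<^sup>2 \<le>
    8 * k * (\<mu> * g\<^sup>2 + Gr\<^sup>2 / (mr + Ar / k) + Gl\<^sup>2 / (ml + Al / k) - G\<^sup>2 / (m + A / k)) +
    2 * c * (\<mu> * g\<^sup>2 + Gr\<^sup>2 / mr + Gl\<^sup>2 / ml - G\<^sup>2 / m)"
proof -
  define x where "x = G / m"
  define r where "r = (Gr - mr * x) - (Gl - ml * x)"
  define M where "M = \<mu> * g\<^sup>2 + Gr\<^sup>2 / mr + Gl\<^sup>2 / ml - G\<^sup>2 / m"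
  have "0 \<le> M"
    using square_div_add3_le[of \<mu> mr ml Gr Gl g] assms by (simp add: M_def)
  have "r\<^sup>2 \<le> (mr + ml) * M"
    unfolding r_def x_def M_def G_def m_def using assms by (intro martingale_step) auto
  then have "w * r\<^sup>2 \<le> w * (mr + ml) * M"
    using assms by (simp add: mult.assoc mult_left_mono)
  also have "\<dots> \<le> c * M"
    using assms \<open>0 \<le> M\<close> by (intro mult_right_mono)
  finally have "w * r\<^sup>2 \<le> c * M" .
  moreover have "w * (mr - ml)\<^sup>2 * x\<^sup>2 \<le> 4 * k * (\<mu> * g\<^sup>2 + Gr\<^sup>2 / (mr + Ar / k) + Gl\<^sup>2 / (ml + Al / k) - G\<^sup>2 / (m + A / k))"
    unfolding x_def G_def m_def A_def using assms by (intro carleson_step) auto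
  moreover have "w * (Gr - Gl)\<^sup>2 \<le> 2 * (w * (mr - ml)\<^sup>2 * x\<^sup>2) + 2 * (w * r\<^sup>2)"
  proof -
    have "Gr - Gl = (mr - ml) * x + r" by (simp add: r_def algebra_simps)
    moreover have "((mr - ml) * x + r)\<^sup>2 \<le> 2 * ((mr - ml) * x)\<^sup>2 + 2 * r\<^sup>2"
      using zero_le_power2[of "(mr - ml) * x - r"] by (simp add: power2_eq_square algebra_simps)
    ultimately have "w * (Gr - Gl)\<^sup>2 \<le> w * (2 * ((mr - ml) * x)\<^sup>2 + 2 * r\<^sup>2)"
      using assms by (intro mult_left_mono) auto
    then show ?thesis by (simp add: distrib_left power_mult_distrib mult_ac)
  qed
  ultimately show ?thesis unfolding M_def by linarith
qed

section \<open>Induction over finite trees\<close>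

lemma weighted_Cauchy_Schwarz:
  fixes \<mu> g :: "'i \<Rightarrow> real"
  assumes "\<And>i. 0 \<le> \<mu> i"
  shows "(\<Sum>i\<in>S. \<mu> i * g i)\<^sup>2 \<le> (\<Sum>i\<in>S. \<mu> i) * (\<Sum>i\<in>S. \<mu> i * (g i)\<^sup>2)"
proof -
  have "(\<Sum>i\<in>S. sqrt (\<mu> i) * (sqrt (\<mu> i) * g i))\<^sup>2 \<le> (\<Sum>i\<in>S. (sqrt (\<mu> i))\<^sup>2) * (\<Sum>i\<in>S. (sqrt (\<mu> i) * g i)\<^sup>2)"
    by (rule Cauchy_Schwarz_ineq_sum)
  then show ?thesis using assms by (simp add: power_mult_distrib mult.assoc[symmetric])
qed

lemma sum_below_decomp:
  fixes f :: "real set \<Rightarrow> 'a::comm_monoid_add"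
  assumes "I \<in> dyadic" "finite S"
  shows "sum f (S \<inter> below I) =
    (if I \<in> S then f I else 0) + sum f (S \<inter> below (right_half I)) + sum f (S \<inter> below (left_half I))"
proof -
  have eq: "S \<inter> below I = (if I \<in> S then {I} else {}) \<union> ((S \<inter> below (right_half I)) \<union> (S \<inter> below (left_half I)))"
    using below_decomp(1)[OF assms(1)] by auto
  have "sum f (S \<inter> below I) = sum f (if I \<in> S then {I} else {}) + sum f ((S \<inter> below (right_half I)) \<union> (S \<inter> below (left_half I)))"
    unfolding eq using below_decomp[OF assms(1)] assms(2) by (intro sum.union_disjoint) auto
  also have "sum f ((S \<inter> below (right_half I)) \<union> (S \<inter> below (left_half I))) =
      sum f (S \<inter> below (right_half I)) + sum f (S \<inter> below (left_half I))"
    using below_decomp[OF assms(1)] assms(2) by (intro sum.union_disjoint) auto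
  finally show ?thesis by (simp add: add.assoc)
qed

lemma infsum_below_decomp:
  fixes \<mu> :: "real set \<Rightarrow> real"
  assumes "I \<in> dyadic" "\<mu> summable_on below I"
  shows "infsum \<mu> (below I) = \<mu> I + infsum \<mu> (below (right_half I)) + infsum \<mu> (below (left_half I))"
proof -
  note D = below_decomp[OF assms(1)]
  have sub: "\<mu> summable_on below (right_half I)" "\<mu> summable_on below (left_half I)"
    using assms(2) D(1) by (auto intro: summable_on_subset_banach)
  then have Un: "\<mu> summable_on (below (left_half I) \<union> below (right_half I))"
    by (intro summable_on_Un_disjoint) (use D in auto)
  have "infsum \<mu> (below I) = \<mu> I + infsum \<mu> (below (left_half I) \<union> below (right_half I))"
    unfolding D(1) using D(2,3) Un by (subst infsum_insert) auto
  then show ?thesis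
    using sub D(4) by (subst (asm) infsum_Un_disjoint) auto
qed

lemma sum_subtree_Suc:
  fixes f :: "real set \<Rightarrow> 'a::comm_monoid_add"
  assumes "I \<in> dyadic"
  shows "sum f (subtree (Suc n) I) = f I + sum f (subtree n (right_half I)) + sum f (subtree n (left_half I))"
proof -
  note D = below_decomp[OF assms] and s = subtree_subset[of "left_half I" n] subtree_subset[of "right_half I" n]
  have "subtree n (left_half I) \<inter> subtree n (right_half I) = {}"
    "I \<notin> subtree n (left_half I) \<union> subtree n (right_half I)"
    using D s assms by auto
  then have "sum f (subtree (Suc n) I) = f I + (sum f (subtree n (left_half I)) + sum f (subtree n (right_half I)))"
    by (simp add: sum.union_disjoint)
  then show ?thesis by (simp add: add_ac)
qed

text \<open>Each bracket has the form \<open>V\<close> minus a quotient. As \<open>V\<close> is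
  additive over a node and its halves, adding the bounds for the halves to
  \<open>bellman_step\<close> cancels their quotients and leaves the bracket at \<open>I\<close>.
  The Carleson sum is cut at the same depth \<open>n\<close> as the sum to be estimated, so that one
  induction serves both.\<close>

lemma bellman_induction:
  fixes \<mu> w g :: "real set \<Rightarrow> real" and S :: "real set set"
  defines "m \<equiv> \<lambda>I. infsum \<mu> (below I)"
    and "A \<equiv> \<lambda>n I. \<Sum>J\<in>subtree n I. w J * (infsum \<mu> (below (right_half J)) - infsum \<mu> (below (left_half J)))\<^sup>2"
    and "G \<equiv> \<lambda>I. \<Sum>K\<in>S \<inter> below I. \<mu> K * g K"
    and "V \<equiv> \<lambda>I. \<Sum>K\<in>S \<inter> below I. \<mu> K * (g K)\<^sup>2"
  assumes pos: "\<And>K. 0 \<le> \<mu> K" "\<And>K. 0 \<le> w K" and fin: "finite S" and k: "0 < k"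
    and I: "I \<in> dyadic" "\<mu> summable_on below I"
    and c: "\<And>J. J \<in> below I \<Longrightarrow> w J * (m (right_half J) + m (left_half J)) \<le> c"
    and car: "\<And>J n. J \<in> below I \<Longrightarrow> A n J \<le> k * m J"
  shows "(\<Sum>J\<in>subtree n I. w J * (G (right_half J) - G (left_half J))\<^sup>2) \<le>
     8 * k * (V I - (G I)\<^sup>2 / (m I + A n I / k)) + 2 * c * (V I - (G I)\<^sup>2 / m I)"
proof -
  have A_nonneg: "0 \<le> A n I" for n I
    unfolding A_def by (intro sum_nonneg) (simp add: pos)
  have m_nonneg: "0 \<le> m I" for I
    unfolding m_def by (intro infsum_nonneg) (simp add: pos)
  have V_nonneg: "0 \<le> V I" for I
    unfolding V_def by (intro sum_nonneg) (simp add: pos)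
  have GmV: "(G I)\<^sup>2 \<le> m I * V I" if "\<mu> summable_on below I" for I
  proof -
    have "(G I)\<^sup>2 \<le> (\<Sum>K\<in>S \<inter> below I. \<mu> K) * V I"
      unfolding G_def V_def by (rule weighted_Cauchy_Schwarz) (rule pos)
    also have "\<dots> \<le> m I * V I"
      unfolding m_def using that fin V_nonneg pos
      by (intro mult_right_mono finite_sum_le_infsum) auto
    finally show ?thesis .
  qed
  show ?thesis
    using I c car
  proof (induction n arbitrary: I)
    case 0
    have "(G I)\<^sup>2 / m I \<le> V I"
      using GmV[OF 0(2)] m_nonneg[of I] V_nonneg[of I]
      by (cases "m I = 0") (auto simp: pos_divide_le_eq mult.commute less_le)
    \<comment> \<open>The brackets are nonnegative, so the base case also needs a nonnegative factor
      in front; the bound at the root supplies it.\<close>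
    moreover have "0 \<le> c" 
      using 0(3)[of I] 0(1) pos(2)[of I] m_nonneg[of "right_half I"] m_nonneg[of "left_half I"]
      by (auto simp: below_def intro: order_trans[rotated])
    ultimately show ?case using k by (simp add: A_def)
  next
    case (Suc n)
    note D = below_decomp[OF Suc.prems(1)]
    let ?r = "right_half I" and ?l = "left_half I"
    \<comment> \<open>Masses count the whole tree below \<open>I\<close>, while \<open>g\<close> is
      supported on the finite set \<open>S\<close>: a node outside \<open>S\<close> keeps its mass
      and gets the value 0.\<close>
    define g' where "g' = (if I \<in> S then g I else 0)"
    have sub: "\<mu> summable_on below ?r" "\<mu> summable_on below ?l"
      using Suc.prems(2) D(1) by (auto intro: summable_on_subset_banach)
    have m: "m I = \<mu> I + m ?r + m ?l"
      unfolding m_def by (rule infsum_below_decomp[OF Suc.prems(1,2)])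
    have A: "A (Suc n) I = w I * (m ?r - m ?l)\<^sup>2 + A n ?r + A n ?l"
      unfolding A_def m_def by (rule sum_subtree_Suc[OF Suc.prems(1)])
    have G: "G I = \<mu> I * g' + G ?r + G ?l"
      unfolding G_def by (subst sum_below_decomp[OF Suc.prems(1) fin]) (simp add: g'_def)
    have V: "V I = \<mu> I * g'\<^sup>2 + V ?r + V ?l"
      unfolding V_def by (subst sum_below_decomp[OF Suc.prems(1) fin]) (simp add: g'_def)
    \<comment> \<open>By Cauchy-Schwarz an integral vanishes together with its mass, which is the
      side condition of \<open>bellman_step\<close>.\<close>
    have zero: "m ?r = 0 \<Longrightarrow> G ?r = 0" "m ?l = 0 \<Longrightarrow> G ?l = 0"
      using GmV[OF sub(1)] GmV[OF sub(2)] by auto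
    have Ibel: "I \<in> below I" using Suc.prems(1) by (simp add: below_def)
    have step: "w I * (G ?r - G ?l)\<^sup>2 \<le>
      8 * k * (\<mu> I * g'\<^sup>2 + (G ?r)\<^sup>2 / (m ?r + A n ?r / k) + (G ?l)\<^sup>2 / (m ?l + A n ?l / k)
         - (G I)\<^sup>2 / (m I + A (Suc n) I / k)) +
      2 * c * (\<mu> I * g'\<^sup>2 + (G ?r)\<^sup>2 / m ?r + (G ?l)\<^sup>2 / m ?l - (G I)\<^sup>2 / m I)"
      unfolding m A G
      using Suc.prems(4)[OF Ibel, of "Suc n"] Suc.prems(3)[OF Ibel]
      by (intro bellman_step k pos m_nonneg A_nonneg zero) (auto simp: m A)
    have IHr: "(\<Sum>J\<in>subtree n ?r. w J * (G (right_half J) - G (left_half J))\<^sup>2) \<le>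
     8 * k * (V ?r - (G ?r)\<^sup>2 / (m ?r + A n ?r / k)) + 2 * c * (V ?r - (G ?r)\<^sup>2 / m ?r)"
      using Suc.prems D(1) sub by (intro Suc.IH) auto
    have IHl: "(\<Sum>J\<in>subtree n ?l. w J * (G (right_half J) - G (left_half J))\<^sup>2) \<le>
     8 * k * (V ?l - (G ?l)\<^sup>2 / (m ?l + A n ?l / k)) + 2 * c * (V ?l - (G ?l)\<^sup>2 / m ?l)"
      using Suc.prems D(1) sub by (intro Suc.IH) auto
    show ?case
      unfolding sum_subtree_Suc[OF Suc.prems(1)]
      using step IHr IHl unfolding V by (simp only: algebra_simps)
  qed
qed

text \<open>Only the energy \<open>V\<close> survives: the subtracted quotients carried the
  induction and are now dropped.\<close>

lemma subtree_bound:
  fixes \<mu> w g :: "real set \<Rightarrow> real" and S :: "real set set"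
  assumes pos: "\<And>K. 0 \<le> \<mu> K" "\<And>K. 0 \<le> w K" and fin: "finite S" and k: "0 < k"
    and I: "I \<in> dyadic" "\<mu> summable_on below I"
    and c: "\<And>J. J \<in> below I \<Longrightarrow> w J * (infsum \<mu> (below (right_half J)) + infsum \<mu> (below (left_half J))) \<le> c"
    and car: "\<And>J n. J \<in> below I \<Longrightarrow>
      (\<Sum>L\<in>subtree n J. w L * (infsum \<mu> (below (right_half L)) - infsum \<mu> (below (left_half L)))\<^sup>2) \<le> k * infsum \<mu> (below J)"
  shows "(\<Sum>J\<in>subtree n I. w J * ((\<Sum>K\<in>S \<inter> below (right_half J). \<mu> K * g K) - (\<Sum>K\<in>S \<inter> below (left_half J). \<mu> K * g K))\<^sup>2) \<le>
     (8 * k + 2 * c) * (\<Sum>K\<in>S \<inter> below I. \<mu> K * (g K)\<^sup>2)"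
proof -
  let ?A = "\<Sum>J\<in>subtree n I. w J * (infsum \<mu> (below (right_half J)) - infsum \<mu> (below (left_half J)))\<^sup>2"
  let ?G = "\<Sum>K\<in>S \<inter> below I. \<mu> K * g K" and ?V = "\<Sum>K\<in>S \<inter> below I. \<mu> K * (g K)\<^sup>2"
  let ?m = "infsum \<mu> (below I)"
  have "0 \<le> ?m" by (intro infsum_nonneg) (simp add: pos)
  moreover have "0 \<le> ?A" by (intro sum_nonneg) (simp add: pos)
  moreover have "0 \<le> c"
  proof -
    have "0 \<le> w I * (infsum \<mu> (below (right_half I)) + infsum \<mu> (below (left_half I)))"
      by (intro mult_nonneg_nonneg add_nonneg_nonneg infsum_nonneg pos)
    also have "\<dots> \<le> c" using I(1) by (intro c) (simp add: below_def)
    finally show ?thesis .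
  qed
  ultimately have "8 * k * (?V - ?G\<^sup>2 / (?m + ?A / k)) + 2 * c * (?V - ?G\<^sup>2 / ?m) \<le> 8 * k * ?V + 2 * c * ?V"
    using k by (intro add_mono mult_left_mono) auto
  then show ?thesis
    using bellman_induction[where \<mu> = \<mu> and w = w and g = g and S = S and k = k and c = c and I = I and n = n] assms
    by (simp add: distrib_right)
qed

section \<open>The matrix of the composition in the Haar basis\<close>

text \<open>The matrix entry \<open>\<langle>P\<^sub>b\<^sup>(\<^sup>0\<^sup>,\<^sup>1\<^sup>) P\<^sub>d\<^sup>(\<^sup>0\<^sup>,\<^sup>0\<^sup>) h\<^sub>J, h\<^sub>K\<rangle>\<close>, nonzero only for \<open>K \<subset> J\<close>.\<close>

definition kern :: "(real set \<Rightarrow> complex) \<Rightarrow> (real set \<Rightarrow> complex) \<Rightarrow> real set \<Rightarrow> real set \<Rightarrow> complex" where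
  "kern b d K J = b K * d J * of_real (half_sign J K / sqrt (len J))"

text \<open>Norm at most \<open>C\<close> for all finite sections of the matrix. No convergence
  enters, so the notion makes sense for arbitrary \<open>b\<close> and \<open>d\<close>, and both
  the tests and the operator norm can be compared with it.\<close>

definition finite_bound :: "(real set \<Rightarrow> complex) \<Rightarrow> (real set \<Rightarrow> complex) \<Rightarrow> real \<Rightarrow> bool" where
  "finite_bound b d C \<longleftrightarrow>
    (\<forall>F S c. finite F \<and> finite S \<and> F \<subseteq> dyadic \<and> S \<subseteq> dyadic \<longrightarrow>
      (\<Sum>K\<in>S. (cmod (\<Sum>J\<in>F. kern b d K J * c J))\<^sup>2) \<le> C\<^sup>2 * (\<Sum>J\<in>F. (cmod (c J))\<^sup>2))"

section \<open>Sufficiency of the tests for finite sections\<close>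

lemma cmod_sum_mult_square_le:
  fixes u g :: "'i \<Rightarrow> complex"
  shows "(cmod (\<Sum>i\<in>S. u i * g i))\<^sup>2 \<le> (\<Sum>i\<in>S. (cmod (u i))\<^sup>2) * (\<Sum>i\<in>S. (cmod (g i))\<^sup>2)"
proof -
  have "cmod (\<Sum>i\<in>S. u i * g i) \<le> (\<Sum>i\<in>S. cmod (u i) * cmod (g i))"
    by (rule order_trans[OF norm_sum]) (simp add: norm_mult)
  then have "(cmod (\<Sum>i\<in>S. u i * g i))\<^sup>2 \<le> (\<Sum>i\<in>S. cmod (u i) * cmod (g i))\<^sup>2"
    by (intro power_mono) auto
  also have "\<dots> \<le> (\<Sum>i\<in>S. (cmod (u i))\<^sup>2) * (\<Sum>i\<in>S. (cmod (g i))\<^sup>2)"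
    by (rule Cauchy_Schwarz_ineq_sum)
  finally show ?thesis .
qed

text \<open>Duality for a finite matrix: applied to the conjugate of the transposed output
  \<open>y\<close>, the assumption yields \<open>X^2 \<le> N * X * \<Sum> |g|^2\<close> with
  \<open>X = \<Sum> |y|^2\<close>, and one factor \<open>X\<close> cancels. The number
  \<open>N\<close> stands for a squared norm.\<close>

lemma transpose_bound:
  fixes M :: "'k \<Rightarrow> 'j \<Rightarrow> complex"
  assumes "\<And>c. (\<Sum>K\<in>S. (cmod (\<Sum>J\<in>F. M K J * c J))\<^sup>2) \<le> N * (\<Sum>J\<in>F. (cmod (c J))\<^sup>2)"
    and "0 \<le> N"
  shows "(\<Sum>J\<in>F. (cmod (\<Sum>K\<in>S. M K J * g K))\<^sup>2) \<le> N * (\<Sum>K\<in>S. (cmod (g K))\<^sup>2)"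
proof -
  define y where "y J = (\<Sum>K\<in>S. M K J * g K)" for J
  define X where "X = (\<Sum>J\<in>F. (cmod (y J))\<^sup>2)"
  define u where "u K = (\<Sum>J\<in>F. M K J * cnj (y J))" for K
  have X0: "0 \<le> X" unfolding X_def by (intro sum_nonneg) simp
  have "of_real X = (\<Sum>J\<in>F. y J * cnj (y J))"
    by (simp add: X_def complex_norm_square flip: of_real_power)
  also have "\<dots> = (\<Sum>J\<in>F. \<Sum>K\<in>S. M K J * g K * cnj (y J))"
    by (simp add: y_def sum_distrib_right)
  also have "\<dots> = (\<Sum>K\<in>S. \<Sum>J\<in>F. M K J * g K * cnj (y J))"
    by (rule sum.swap)
  also have "\<dots> = (\<Sum>K\<in>S. u K * g K)"
    by (simp add: u_def sum_distrib_right sum_distrib_left mult_ac)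
  finally have "X = cmod (\<Sum>K\<in>S. u K * g K)"
    using X0 by (metis abs_of_nonneg norm_of_real)
  then have "X\<^sup>2 \<le> (\<Sum>K\<in>S. (cmod (u K))\<^sup>2) * (\<Sum>K\<in>S. (cmod (g K))\<^sup>2)"
    using cmod_sum_mult_square_le[of u g S] by simp
  also have "\<dots> \<le> (N * (\<Sum>J\<in>F. (cmod (cnj (y J)))\<^sup>2)) * (\<Sum>K\<in>S. (cmod (g K))\<^sup>2)"
    unfolding u_def by (intro mult_right_mono assms(1) sum_nonneg) simp
  also have "\<dots> = X * (N * (\<Sum>K\<in>S. (cmod (g K))\<^sup>2))"
    by (simp add: X_def)
  finally have "X * X \<le> X * (N * (\<Sum>K\<in>S. (cmod (g K))\<^sup>2))" by (simp add: power2_eq_square)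
  moreover have "0 \<le> N * (\<Sum>K\<in>S. (cmod (g K))\<^sup>2)" using assms(2) by (simp add: sum_nonneg)
  ultimately have "X \<le> N * (\<Sum>K\<in>S. (cmod (g K))\<^sup>2)"
    using X0 by (cases "X = 0") (auto simp: mult_le_cancel_left)
  then show ?thesis by (simp add: X_def y_def)
qed

lemma summable_on_of_bounded_sums:
  fixes f :: "'i \<Rightarrow> real"
  assumes "\<And>i. i \<in> A \<Longrightarrow> 0 \<le> f i" "\<And>F. finite F \<Longrightarrow> F \<subseteq> A \<Longrightarrow> sum f F \<le> C"
  shows "f summable_on A"
  using assms by (intro nonneg_bounded_partial_sums_imp_summable_on[where C = C])
    (auto intro: eventually_finite_subsets_at_top_weakI)

lemma summable_on_below:
  fixes \<mu> :: "real set \<Rightarrow> real"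
  assumes "\<mu> summable_on below I" "J \<subseteq> I"
  shows "\<mu> summable_on below J"
proof -
  have "below J \<subseteq> below I" using assms(2) by (auto simp: below_def)
  then show ?thesis by (rule summable_on_subset_banach[OF assms(1)])
qed

lemma half_sign_sum:
  fixes \<mu> g :: "real set \<Rightarrow> real"
  assumes "finite S"
  shows "(\<Sum>K\<in>S. half_sign J K * \<mu> K * g K) =
    (\<Sum>K\<in>S \<inter> below (right_half J). \<mu> K * g K) - (\<Sum>K\<in>S \<inter> below (left_half J). \<mu> K * g K)"
proof -
  have "half_sign J K * \<mu> K * g K =
    (if K \<in> below (right_half J) then \<mu> K * g K else 0) - (if K \<in> below (left_half J) then \<mu> K * g K else 0)" for K
    by (simp add: half_sign_def left_diff_distrib)
  then show ?thesis
    using assms by (simp add: sum_subtractf sum.inter_restrict)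
qed

lemma coeff_test1_below:
  fixes b d :: "real set \<Rightarrow> complex"
  defines "\<mu> \<equiv> \<lambda>K. (cmod (b K))\<^sup>2"
  assumes "coeff_test1 b d C1" "J \<in> dyadic" "d J \<noteq> 0"
  shows "\<mu> summable_on below J"
    and "(cmod (d J))\<^sup>2 / len J * (infsum \<mu> (below (right_half J)) + infsum \<mu> (below (left_half J))) \<le> C1\<^sup>2"
proof -
  note D = below_decomp[OF assms(3)]
  have sm: "\<mu> summable_on (below (left_half J) \<union> below (right_half J))"
    and le: "cmod (d J) * sqrt (1 / len J * infsum \<mu> (below (left_half J) \<union> below (right_half J))) \<le> C1"
    using assms strictly_below_decomp[OF assms(3)] unfolding coeff_test1_def \<mu>_def by auto
  show "\<mu> summable_on below J"
    unfolding D(1) by (intro summable_on_insert_iff[THEN iffD2] sm)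
  have sub: "\<mu> summable_on below (right_half J)" "\<mu> summable_on below (left_half J)"
    using sm by (auto intro: summable_on_subset_banach)
  have "infsum \<mu> (below (left_half J) \<union> below (right_half J)) = infsum \<mu> (below (left_half J)) + infsum \<mu> (below (right_half J))"
    using sub D(4) by (intro infsum_Un_disjoint) auto
  moreover have "0 \<le> infsum \<mu> (below (left_half J) \<union> below (right_half J))"
    by (intro infsum_nonneg) (simp add: \<mu>_def)
  moreover have "(cmod (d J) * sqrt (1 / len J * infsum \<mu> (below (left_half J) \<union> below (right_half J))))\<^sup>2 \<le> C1\<^sup>2"
    using le calculation(2) by (intro power_mono) auto
  ultimately show "(cmod (d J))\<^sup>2 / len J * (infsum \<mu> (below (right_half J)) + infsum \<mu> (below (left_half J))) \<le> C1\<^sup>2"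
    by (simp add: power_mult_distrib add.commute)
qed

lemma coeff_test2_below:
  fixes b d :: "real set \<Rightarrow> complex"
  defines "\<mu> \<equiv> \<lambda>K. (cmod (b K))\<^sup>2"
  assumes "coeff_test2 b d C2" "I \<in> dyadic" "\<mu> summable_on below I" "finite F" "F \<subseteq> below I"
  shows "(\<Sum>J\<in>F. (cmod (d J))\<^sup>2 / len J * (infsum \<mu> (below (right_half J)) - infsum \<mu> (below (left_half J)))\<^sup>2)
    \<le> C2\<^sup>2 * infsum \<mu> (below I)"
proof -
  let ?a = "\<lambda>J. (cmod (d J))\<^sup>2 / len J * (child_diff b J)\<^sup>2"
  have C2: "0 \<le> C2" and sm: "?a summable_on below I" and le: "sqrt (infsum ?a (below I)) \<le> C2 * sqrt (infsum \<mu> (below I))"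
    using assms(2,3,4) unfolding coeff_test2_def \<mu>_def below_def by auto
  have nn: "0 \<le> infsum ?a (below I)" "0 \<le> infsum \<mu> (below I)"
    by (auto intro!: infsum_nonneg simp: \<mu>_def)
  have "sum ?a F \<le> infsum ?a (below I)"
    using sm assms(5,6) by (intro finite_sum_le_infsum) auto
  also have "\<dots> \<le> (C2 * sqrt (infsum \<mu> (below I)))\<^sup>2"
    using power_mono[OF le, of 2] nn by simp
  also have "\<dots> = C2\<^sup>2 * infsum \<mu> (below I)"
    using nn by (simp add: power_mult_distrib)
  finally show ?thesis by (simp add: child_diff_def below_def \<mu>_def)
qed

lemma tree_bound:
  fixes b d :: "real set \<Rightarrow> complex" and g :: "real set \<Rightarrow> real"
  defines "\<mu> \<equiv> \<lambda>K. (cmod (b K))\<^sup>2" and "w \<equiv> \<lambda>J. (cmod (d J))\<^sup>2 / len J"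
  assumes t1: "coeff_test1 b d C1" and t2: "coeff_test2 b d C2" and C2: "0 < C2"
    and F: "finite F" "F \<subseteq> dyadic" and S: "finite S" "S \<subseteq> dyadic"
  shows "(\<Sum>J\<in>F. w J * (\<Sum>K\<in>S. half_sign J K * \<mu> K * g K)\<^sup>2) \<le> (8 * C2\<^sup>2 + 2 * C1\<^sup>2) * (\<Sum>K\<in>S. \<mu> K * (g K)\<^sup>2)"
proof -
  let ?h = "\<lambda>J. w J * (\<Sum>K\<in>S. half_sign J K * \<mu> K * g K)\<^sup>2"
  let ?N = "8 * C2\<^sup>2 + 2 * C1\<^sup>2"
  have pos: "0 \<le> \<mu> K" "0 \<le> w K" for K by (auto simp: \<mu>_def w_def)
  have h0: "0 \<le> ?h J" for J by (simp add: pos)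
  \<comment> \<open>Weights vanish where \<open>d J = 0\<close>. Discarding these intervals first
    ensures that every maximal interval has finite mass below it, by the first condition.\<close>
  define F' where "F' = {J \<in> F. d J \<noteq> 0}"
  have F': "finite F'" "F' \<subseteq> dyadic" using F by (auto simp: F'_def)
  \<comment> \<open>Maximal intervals are pairwise disjoint, so the estimates on the trees below
    them involve disjoint parts of \<open>S\<close> and add up.\<close>
  define M where "M = {I \<in> F'. \<forall>J\<in>F'. I \<subseteq> J \<longrightarrow> I = J}"
  have M: "finite M" "M \<subseteq> F'" using F' by (auto simp: M_def)
  have disj: "below I \<inter> below I' = {}" if "I \<in> M" "I' \<in> M" "I \<noteq> I'" for I I'
  proof (rule equals0I)
    fix K assume "K \<in> below I \<inter> below I'"
    then have "K \<noteq> {}" "K \<subseteq> I \<inter> I'" using dyadic_nonempty by (auto simp: below_def)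
    moreover have "\<not> I \<subseteq> I'" "\<not> I' \<subseteq> I" using that by (auto simp: M_def)
    moreover have "I \<in> dyadic" "I' \<in> dyadic" using that M F' by auto
    ultimately show False using dyadic_nested_or_disjoint[of I I'] by auto
  qed
  have cover: "F' \<subseteq> (\<Union>I\<in>M. F' \<inter> below I)"
  proof
    fix J assume J: "J \<in> F'"
    obtain I where "I \<in> F'" "J \<subseteq> I" "\<forall>L\<in>F'. I \<subseteq> L \<longrightarrow> I = L"
      using finite_has_maximal2[OF F'(1) J] by auto
    then show "J \<in> (\<Union>I\<in>M. F' \<inter> below I)" using J F' by (auto simp: M_def below_def)
  qed
  have local_bound: "sum ?h (F' \<inter> below I) \<le> ?N * (\<Sum>K\<in>S \<inter> below I. \<mu> K * (g K)\<^sup>2)" if "I \<in> M" for I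
  proof -
    have I: "I \<in> dyadic" "d I \<noteq> 0" using that M F' by (auto simp: F'_def)
    have sm: "\<mu> summable_on below I"
      unfolding \<mu>_def by (rule coeff_test1_below(1)[OF t1 I])
    have sub: "\<mu> summable_on below J" if "J \<in> below I" for J
      using that by (intro summable_on_below[OF sm]) (simp add: below_def)
    obtain n where n: "F' \<inter> below I \<subseteq> subtree n I"
      using finite_subset_subtree[OF I(1), of "F' \<inter> below I"] F' by auto
    have "sum ?h (F' \<inter> below I) \<le> sum ?h (subtree n I)"
      using n h0 by (intro sum_mono2) auto
    also have "\<dots> \<le> ?N * (\<Sum>K\<in>S \<inter> below I. \<mu> K * (g K)\<^sup>2)"
      unfolding half_sign_sum[OF S(1)]
    proof (rule subtree_bound)
      fix J assume J: "J \<in> below I"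
      then have Jd: "J \<in> dyadic" by (simp add: below_def)
      show "w J * (infsum \<mu> (below (right_half J)) + infsum \<mu> (below (left_half J))) \<le> C1\<^sup>2"
        using coeff_test1_below(2)[OF t1 Jd] unfolding w_def \<mu>_def by (cases "d J = 0") auto
      show "(\<Sum>L\<in>subtree n J. w L * (infsum \<mu> (below (right_half L)) - infsum \<mu> (below (left_half L)))\<^sup>2)
         \<le> C2\<^sup>2 * infsum \<mu> (below J)" for n
        using coeff_test2_below[OF t2 Jd] sub[OF J] subtree_subset[OF Jd] unfolding w_def \<mu>_def by auto
    qed (use pos S I sm C2 in auto)
    finally show ?thesis .
  qed
  have "sum ?h F = sum ?h F'"
    unfolding F'_def using F(1) by (intro sum.mono_neutral_right) (auto simp: w_def)
  also have "\<dots> \<le> sum ?h (\<Union>I\<in>M. F' \<inter> below I)"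
    using cover F' M h0 by (intro sum_mono2) auto
  also have "\<dots> = (\<Sum>I\<in>M. sum ?h (F' \<inter> below I))"
    using M F' disj by (intro sum.UNION_disjoint) blast+
  also have "\<dots> \<le> (\<Sum>I\<in>M. ?N * (\<Sum>K\<in>S \<inter> below I. \<mu> K * (g K)\<^sup>2))"
    by (intro sum_mono local_bound)
  also have "\<dots> = ?N * (\<Sum>K\<in>(\<Union>I\<in>M. S \<inter> below I). \<mu> K * (g K)\<^sup>2)"
    unfolding sum_distrib_left[symmetric] using M S disj by (subst sum.UNION_disjoint) blast+
  also have "\<dots> \<le> ?N * (\<Sum>K\<in>S. \<mu> K * (g K)\<^sup>2)"
    using S pos by (intro mult_left_mono sum_mono2) auto
  finally show ?thesis .
qed

text \<open>Substituting \<open>cnj (b K) * g K\<close> turns the factor \<open>b K\<close> of the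
  kernel into the weight \<open>|b K|^2\<close>. The weights are then real, so real and imaginary
  parts separate, and the complex transposed matrix is reduced to \<open>tree_bound\<close>.\<close>

lemma kern_transpose_sum:
  "(cmod (\<Sum>K\<in>S. kern b d K J * (cnj (b K) * g K)))\<^sup>2 =
    (cmod (d J))\<^sup>2 / len J * ((\<Sum>K\<in>S. half_sign J K * (cmod (b K))\<^sup>2 * Re (g K))\<^sup>2
      + (\<Sum>K\<in>S. half_sign J K * (cmod (b K))\<^sup>2 * Im (g K))\<^sup>2)"
proof -
  let ?z = "\<Sum>K\<in>S. of_real (half_sign J K * (cmod (b K))\<^sup>2) * g K"
  have "(\<Sum>K\<in>S. kern b d K J * (cnj (b K) * g K)) = d J / of_real (sqrt (len J)) * ?z"
    unfolding sum_distrib_left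
  proof (rule sum.cong[OF refl])
    fix K
    have "b K * cnj (b K) = of_real ((cmod (b K))\<^sup>2)"
      using complex_norm_square[of "b K"] by simp
    then show "kern b d K J * (cnj (b K) * g K) =
        d J / of_real (sqrt (len J)) * (of_real (half_sign J K * (cmod (b K))\<^sup>2) * g K)"
      by (simp add: kern_def mult_ac)
  qed
  then have "(cmod (\<Sum>K\<in>S. kern b d K J * (cnj (b K) * g K)))\<^sup>2 = (cmod (d J))\<^sup>2 / len J * (cmod ?z)\<^sup>2"
    by (simp add: norm_mult norm_divide power_mult_distrib power_divide)
  also have "(cmod ?z)\<^sup>2 = (Re ?z)\<^sup>2 + (Im ?z)\<^sup>2" by (rule cmod_power2)
  finally show ?thesis by simp
qed

lemma finite_bound_of_coeff_tests:
  assumes t: "coeff_test1 b d C1" "coeff_test2 b d C2" "0 < C2"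
  shows "finite_bound b d (3 * (C1 + C2))"
  unfolding finite_bound_def
proof (intro allI impI, elim conjE)
  fix F S :: "real set set" and c :: "real set \<Rightarrow> complex"
  assume F: "finite F" "F \<subseteq> dyadic" and S: "finite S" "S \<subseteq> dyadic"
  let ?N = "8 * C2\<^sup>2 + 2 * C1\<^sup>2"
  have C1: "0 \<le> C1" using t(1) by (simp add: coeff_test1_def)
  \<comment> \<open>The source of the constant 3:
    \<open>8 * C2^2 + 2 * C1^2 \<le> 9 * (C1 + C2)^2\<close> for nonnegative constants.\<close>
  have N: "0 \<le> ?N" "?N \<le> (3 * (C1 + C2))\<^sup>2"
    using C1 t(3) by (auto simp: power2_eq_square algebra_simps)
  have dual: "(\<Sum>J\<in>F. (cmod (\<Sum>K\<in>S. kern b d K J * g K))\<^sup>2) \<le> ?N * (\<Sum>K\<in>S. (cmod (g K))\<^sup>2)" for g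
  proof -
    \<comment> \<open>Where \<open>b K = 0\<close> the division gives 0; there the whole row of the
      kernel vanishes, so nothing is lost.\<close>
    define g' where "g' K = g K / cnj (b K)" for K
    have eq: "kern b d K J * g K = kern b d K J * (cnj (b K) * g' K)" for K J
      by (simp add: g'_def kern_def)
    have "(\<Sum>J\<in>F. (cmod (\<Sum>K\<in>S. kern b d K J * g K))\<^sup>2) =
      (\<Sum>J\<in>F. (cmod (d J))\<^sup>2 / len J * (\<Sum>K\<in>S. half_sign J K * (cmod (b K))\<^sup>2 * Re (g' K))\<^sup>2) +
      (\<Sum>J\<in>F. (cmod (d J))\<^sup>2 / len J * (\<Sum>K\<in>S. half_sign J K * (cmod (b K))\<^sup>2 * Im (g' K))\<^sup>2)"
      unfolding eq kern_transpose_sum by (simp add: distrib_left sum.distrib)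
    also have "\<dots> \<le> ?N * (\<Sum>K\<in>S. (cmod (b K))\<^sup>2 * (Re (g' K))\<^sup>2) + ?N * (\<Sum>K\<in>S. (cmod (b K))\<^sup>2 * (Im (g' K))\<^sup>2)"
      by (intro add_mono tree_bound t F S)
    also have "\<dots> = ?N * (\<Sum>K\<in>S. (cmod (b K))\<^sup>2 * (cmod (g' K))\<^sup>2)"
      by (simp add: cmod_power2 distrib_left sum.distrib)
    also have "\<dots> \<le> ?N * (\<Sum>K\<in>S. (cmod (g K))\<^sup>2)"
    proof (intro mult_left_mono sum_mono N)
      fix K show "(cmod (b K))\<^sup>2 * (cmod (g' K))\<^sup>2 \<le> (cmod (g K))\<^sup>2"
        by (cases "b K = 0") (auto simp: g'_def norm_divide power_divide)
    qed
    finally show ?thesis .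
  qed
  have "(\<Sum>K\<in>S. (cmod (\<Sum>J\<in>F. kern b d K J * c J))\<^sup>2) \<le> ?N * (\<Sum>J\<in>F. (cmod (c J))\<^sup>2)"
    using transpose_bound[where M = "\<lambda>J K. kern b d K J", OF dual N(1)] .
  also have "\<dots> \<le> (3 * (C1 + C2))\<^sup>2 * (\<Sum>J\<in>F. (cmod (c J))\<^sup>2)"
    by (intro mult_right_mono N sum_nonneg) simp
  finally show "(\<Sum>K\<in>S. (cmod (\<Sum>J\<in>F. kern b d K J * c J))\<^sup>2) \<le> (3 * (C1 + C2))\<^sup>2 * (\<Sum>J\<in>F. (cmod (c J))\<^sup>2)" .
qed

section \<open>Necessity of the tests for finite sections\<close>

lemma half_sign_square:
  assumes "I \<in> dyadic" "L \<in> below (left_half I) \<union> below (right_half I)"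
  shows "(half_sign I L)\<^sup>2 = 1"
proof -
  have "L \<in> below (left_half I) \<longleftrightarrow> L \<notin> below (right_half I)"
    using assms(2) below_decomp(4)[OF assms(1)] by blast
  then show ?thesis by (simp add: half_sign_def indicator_def)
qed

lemma coeff_test1_of_finite_bound:
  assumes "finite_bound b d C" "0 \<le> C"
  shows "coeff_test1 b d C"
  unfolding coeff_test1_def
proof (intro conjI ballI impI)
  fix I assume I: "I \<in> dyadic" "d I \<noteq> 0"
  let ?\<mu> = "\<lambda>L. (cmod (b L))\<^sup>2" and ?B = "{L \<in> dyadic. L \<subset> I}"
  let ?w = "(cmod (d I))\<^sup>2 / len I"
  have w: "0 < ?w" using I by simp
  have fb: "sum ?\<mu> S \<le> C\<^sup>2 / ?w" if S: "finite S" "S \<subseteq> ?B" for S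
  proof -
    have "(\<Sum>K\<in>S. (cmod (\<Sum>J\<in>{I}. kern b d K J * 1))\<^sup>2) \<le> C\<^sup>2 * (\<Sum>J\<in>{I}. (cmod 1)\<^sup>2)"
      using assms(1)[unfolded finite_bound_def, rule_format, of "{I}" S "\<lambda>_. 1"] S I by auto
    moreover have "(cmod (kern b d K I))\<^sup>2 = ?w * ?\<mu> K" if "K \<in> S" for K
      using half_sign_square[OF I(1), of K] S that I(1) strictly_below_decomp[OF I(1)]
      by (auto simp: kern_def norm_mult norm_divide power_mult_distrib power_divide)
    ultimately have "?w * sum ?\<mu> S \<le> C\<^sup>2"
      by (simp add: sum_distrib_left)
    then show ?thesis unfolding pos_le_divide_eq[OF w] by (simp only: mult.commute)
  qed
  then show sm: "?\<mu> summable_on ?B"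
    by (intro summable_on_of_bounded_sums) auto
  have "infsum ?\<mu> ?B \<le> C\<^sup>2 / ?w"
    by (intro infsum_le_finite_sums sm fb)
  then have "?w * infsum ?\<mu> ?B \<le> C\<^sup>2"
    unfolding pos_le_divide_eq[OF w] by (simp only: mult.commute)
  moreover have "0 \<le> infsum ?\<mu> ?B" by (intro infsum_nonneg) simp
  ultimately have "(cmod (d I) * sqrt (1 / len I * infsum ?\<mu> ?B))\<^sup>2 \<le> C\<^sup>2"
    by (simp add: power_mult_distrib)
  then show "cmod (d I) * sqrt (1 / len I * infsum ?\<mu> ?B) \<le> C"
    using assms(2) by (rule power2_le_imp_le)
qed (use assms in auto)

lemma half_sign_sum_tendsto:
  fixes \<mu> :: "real set \<Rightarrow> real"
  assumes "I \<in> dyadic" "\<mu> summable_on below I" "J \<in> below I"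
  shows "((\<lambda>K. half_sign J K * \<mu> K) has_sum
      (infsum \<mu> (below (right_half J)) - infsum \<mu> (below (left_half J)))) (below I)"
proof -
  have J: "right_half J \<subseteq> I" "left_half J \<subseteq> I" "J \<in> dyadic"
    using assms(3) halves_subset[of J] by (auto simp: below_def)
  have r: "((\<lambda>K. indicator (below A) K * \<mu> K) has_sum infsum \<mu> (below A)) (below I)" if "A \<subseteq> I" for A
  proof -
    have "(\<mu> has_sum infsum \<mu> (below A)) (below A)"
      using summable_on_below[OF assms(2) that] by (rule has_sum_infsum)
    then show ?thesis
      by (rule has_sum_cong_neutral[THEN iffD1, rotated -1])
        (use that in \<open>auto simp: below_def indicator_def\<close>)
  qed
  show ?thesis
    using tendsto_diff[OF r[OF J(1), unfolded has_sum_def] r[OF J(2), unfolded has_sum_def]]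
    unfolding has_sum_def half_sign_def left_diff_distrib sum_subtractf .
qed

lemma coeff_test2_of_finite_bound:
  assumes "finite_bound b d C" "0 \<le> C"
  shows "coeff_test2 b d C"
  unfolding coeff_test2_def below_def[symmetric]
proof (intro conjI ballI impI)
  fix I assume I: "I \<in> dyadic" and sm: "(\<lambda>L. (cmod (b L))\<^sup>2) summable_on below I"
  let ?\<mu> = "\<lambda>L. (cmod (b L))\<^sup>2" and ?w = "\<lambda>J. (cmod (d J))\<^sup>2 / len J"
  let ?a = "\<lambda>J. ?w J * (child_diff b J)\<^sup>2"
  have m0: "0 \<le> infsum ?\<mu> (below I)" by (intro infsum_nonneg) simp
  \<comment> \<open>Two limits are taken: with \<open>F\<close> fixed, finite sets \<open>S\<close>
    exhaust \<open>below I\<close> and their signed sums tend to \<open>child_diff\<close>;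
    afterwards \<open>F\<close> grows. For each \<open>S\<close> the transposed section is tested on
    \<open>cnj (b K)\<close>.\<close>
  have fb: "sum ?a F \<le> C\<^sup>2 * infsum ?\<mu> (below I)" if F: "finite F" "F \<subseteq> below I" for F
  proof (rule tendsto_upperbound)
    show "((\<lambda>S. \<Sum>J\<in>F. ?w J * (\<Sum>K\<in>S. half_sign J K * ?\<mu> K)\<^sup>2) \<longlongrightarrow> sum ?a F) (finite_subsets_at_top (below I))"
      unfolding child_diff_def below_def[symmetric]
      using half_sign_sum_tendsto[OF I sm] F
      by (intro tendsto_sum tendsto_mult tendsto_const tendsto_power) (auto simp: has_sum_def)
    have "(\<Sum>J\<in>F. ?w J * (\<Sum>K\<in>S. half_sign J K * ?\<mu> K)\<^sup>2) \<le> C\<^sup>2 * infsum ?\<mu> (below I)"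
      if S: "finite S" "S \<subseteq> below I" for S
    proof -
      have FS: "F \<subseteq> dyadic" "S \<subseteq> dyadic" using F S by (auto simp: below_def)
      have "(\<Sum>J\<in>F. ?w J * (\<Sum>K\<in>S. half_sign J K * ?\<mu> K)\<^sup>2) = (\<Sum>J\<in>F. (cmod (\<Sum>K\<in>S. kern b d K J * (cnj (b K) * 1)))\<^sup>2)"
        unfolding kern_transpose_sum by simp
      also have "\<dots> \<le> C\<^sup>2 * (\<Sum>K\<in>S. (cmod (cnj (b K) * 1))\<^sup>2)"
      proof (rule transpose_bound)
        show "(\<Sum>K\<in>S. (cmod (\<Sum>J\<in>F. kern b d K J * c J))\<^sup>2) \<le> C\<^sup>2 * (\<Sum>J\<in>F. (cmod (c J))\<^sup>2)" for c
          using assms(1) F(1) S(1) FS unfolding finite_bound_def by blast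
      qed simp
      also have "\<dots> \<le> C\<^sup>2 * infsum ?\<mu> (below I)"
        using sm S by (intro mult_left_mono) (auto intro!: finite_sum_le_infsum)
      finally show ?thesis .
    qed
    then show "\<forall>\<^sub>F S in finite_subsets_at_top (below I).
        (\<Sum>J\<in>F. ?w J * (\<Sum>K\<in>S. half_sign J K * ?\<mu> K)\<^sup>2) \<le> C\<^sup>2 * infsum ?\<mu> (below I)"
      by (intro eventually_finite_subsets_at_top_weakI) auto
  qed simp
  then show sma: "?a summable_on below I"
    by (intro summable_on_of_bounded_sums) auto
  have "infsum ?a (below I) \<le> C\<^sup>2 * infsum ?\<mu> (below I)"
    by (intro infsum_le_finite_sums sma fb)
  then have "sqrt (infsum ?a (below I)) \<le> sqrt (C\<^sup>2 * infsum ?\<mu> (below I))" by (rule real_sqrt_le_mono)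
  also have "\<dots> = C * sqrt (infsum ?\<mu> (below I))" using assms(2) by (simp add: real_sqrt_mult)
  finally show "sqrt (infsum ?a (below I)) \<le> C * sqrt (infsum ?\<mu> (below I))" .
qed (use assms in auto)

section \<open>Convergence in local mean\<close>

abbreviation local_norm :: "real \<Rightarrow> real \<Rightarrow> (real \<Rightarrow> complex) \<Rightarrow> real" where
  "local_norm a b f \<equiv> LINT x:{a..b}|lborel. cmod (f x)"

lemma L1loc_measurable [measurable_dest]: "f \<in> L1loc \<Longrightarrow> f \<in> borel_measurable lborel"
  by (simp add: L1loc_def)

lemma L1loc_integrable: "f \<in> L1loc \<Longrightarrow> set_integrable lborel {a..b} f"
  by (simp add: L1loc_def)

lemma L1loc_integrable_cmod: "f \<in> L1loc \<Longrightarrow> set_integrable lborel {a..b} (\<lambda>x. cmod (f x))"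
  by (intro set_integrable_norm L1loc_integrable)

lemma L1loc_zero: "(\<lambda>x. 0) \<in> L1loc"
  by (simp add: L1loc_def set_integrable_def)

lemma L1loc_add: "f \<in> L1loc \<Longrightarrow> g \<in> L1loc \<Longrightarrow> (\<lambda>x. f x + g x) \<in> L1loc"
  by (auto simp: L1loc_def intro: set_integral_add)

lemma L1loc_diff: "f \<in> L1loc \<Longrightarrow> g \<in> L1loc \<Longrightarrow> (\<lambda>x. f x - g x) \<in> L1loc"
  by (auto simp: L1loc_def intro: set_integral_diff)

lemma L1loc_mult: "f \<in> L1loc \<Longrightarrow> (\<lambda>x. z * f x) \<in> L1loc"
  by (auto simp: L1loc_def)

lemma L1loc_sum: "(\<And>i. i \<in> F \<Longrightarrow> u i \<in> L1loc) \<Longrightarrow> (\<lambda>x. \<Sum>i\<in>F. u i x) \<in> L1loc"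
  by (induction F rule: infinite_finite_induct) (auto simp: L1loc_zero intro: L1loc_add)

lemma local_norm_nonneg: "0 \<le> local_norm a b f"
  unfolding set_lebesgue_integral_def by (intro integral_nonneg_AE) auto

lemma local_norm_add:
  assumes "f \<in> L1loc" "g \<in> L1loc"
  shows "local_norm a b (\<lambda>x. f x + g x) \<le> local_norm a b f + local_norm a b g"
proof -
  have "local_norm a b (\<lambda>x. f x + g x) \<le> (LINT x:{a..b}|lborel. cmod (f x) + cmod (g x))"
    using assms by (intro set_integral_mono L1loc_integrable_cmod L1loc_add set_integral_add norm_triangle_ineq)
  also have "\<dots> = local_norm a b f + local_norm a b g"
    using assms by (intro set_integral_add L1loc_integrable_cmod)
  finally show ?thesis .
qed

lemma local_norm_mult: "local_norm a b (\<lambda>x. z * f x) = cmod z * local_norm a b f"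
  by (simp add: norm_mult)

lemma local_norm_diff:
  assumes "f \<in> L1loc" "g \<in> L1loc"
  shows "local_norm a b (\<lambda>x. f x - g x) \<le> local_norm a b f + local_norm a b g"
  using local_norm_add[OF assms(1) L1loc_mult[OF assms(2), of "-1"], of a b] by simp

lemma local_norm_sum:
  assumes "finite F" "\<And>i. i \<in> F \<Longrightarrow> u i \<in> L1loc"
  shows "local_norm a b (\<lambda>x. \<Sum>i\<in>F. u i x) \<le> (\<Sum>i\<in>F. local_norm a b (u i))"
  using assms
proof (induction F)
  case (insert i F)
  have "local_norm a b (\<lambda>x. u i x + (\<Sum>i\<in>F. u i x)) \<le> local_norm a b (u i) + local_norm a b (\<lambda>x. \<Sum>i\<in>F. u i x)"
    using insert.prems by (intro local_norm_add L1loc_sum) auto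
  also have "local_norm a b (\<lambda>x. \<Sum>i\<in>F. u i x) \<le> (\<Sum>i\<in>F. local_norm a b (u i))"
    using insert by auto
  finally show ?case using insert.hyps by simp
qed (simp add: set_lebesgue_integral_def)

lemma local_norm_mono_interval:
  assumes "f \<in> L1loc" "a' \<le> a" "b \<le> b'"
  shows "local_norm a b f \<le> local_norm a' b' f"
  using L1loc_integrable_cmod[OF assms(1), of a b] L1loc_integrable_cmod[OF assms(1), of a' b'] assms(2,3)
  unfolding set_lebesgue_integral_def set_integrable_def
  by (intro integral_mono) (auto simp: indicator_def)

section \<open>Pairing with bounded functions of bounded support\<close>

definition test_fun :: "(real \<Rightarrow> complex) \<Rightarrow> bool" where
  "test_fun \<phi> \<longleftrightarrow> \<phi> \<in> borel_measurable lborel \<and> (\<exists>B. \<forall>x. cmod (\<phi> x) \<le> B) \<and> (\<exists>a b. \<forall>x. x \<notin> {a..b} \<longrightarrow> \<phi> x = 0)"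

lemma test_fun_bound:
  assumes "test_fun \<phi>"
  shows "\<exists>a b B. 0 \<le> B \<and> (\<forall>x. cmod (\<phi> x) \<le> B * indicator {a..b} x)"
proof -
  obtain B a b where B: "\<And>x. cmod (\<phi> x) \<le> B" and ab: "\<And>x. x \<notin> {a..b} \<Longrightarrow> \<phi> x = 0"
    using assms by (auto simp: test_fun_def)
  have "0 \<le> B" using B[of 0] norm_ge_zero order_trans by blast
  moreover have "cmod (\<phi> x) \<le> B * indicator {a..b} x" for x
    using B[of x] ab[of x] by (cases "x \<in> {a..b}") auto
  ultimately show ?thesis by blast
qed

lemma test_fun_measurable [measurable_dest]: "test_fun \<phi> \<Longrightarrow> \<phi> \<in> borel_measurable lborel"
  by (simp add: test_fun_def)

lemma pairing_integrable:
  assumes "f \<in> L1loc" "test_fun \<phi>"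
  shows "integrable lborel (\<lambda>x. f x * cnj (\<phi> x))"
proof -
  obtain a b B where B: "0 \<le> B" "\<And>x. cmod (\<phi> x) \<le> B * indicator {a..b} x"
    using test_fun_bound[OF assms(2)] by auto
  have [measurable]: "f \<in> borel_measurable lborel" "\<phi> \<in> borel_measurable lborel"
    using assms by (auto dest: L1loc_measurable test_fun_measurable)
  show ?thesis
  proof (rule Bochner_Integration.integrable_bound)
    show "integrable lborel (\<lambda>x. B * (indicator {a..b} x *\<^sub>R cmod (f x)))"
      using L1loc_integrable_cmod[OF assms(1), of a b] by (simp add: set_integrable_def)
    show "AE x in lborel. norm (f x * cnj (\<phi> x)) \<le> norm (B * (indicator {a..b} x *\<^sub>R cmod (f x)))"
    proof (rule AE_I2)
      fix x
      have "cmod (f x) * cmod (\<phi> x) \<le> cmod (f x) * (B * indicator {a..b} x)"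
        by (intro mult_left_mono B) simp
      then show "norm (f x * cnj (\<phi> x)) \<le> norm (B * (indicator {a..b} x *\<^sub>R cmod (f x)))"
        using B(1) by (simp add: norm_mult abs_mult mult_ac)
    qed
    have "(\<lambda>x. cnj (\<phi> x)) \<in> borel_measurable lborel"
      by (rule borel_measurable_continuous_on[OF _ test_fun_measurable[OF assms(2)]]) (intro continuous_intros)
    then show "(\<lambda>x. f x * cnj (\<phi> x)) \<in> borel_measurable lborel" by simp
  qed
qed

lemma pairing_bound:
  assumes "f \<in> L1loc" "test_fun \<phi>" "0 \<le> B" "\<And>x. cmod (\<phi> x) \<le> B * indicator {a..b} x"
  shows "cmod (pairing f \<phi>) \<le> B * local_norm a b f"
proof -
  have "cmod (pairing f \<phi>) \<le> (LINT x|lborel. cmod (f x * cnj (\<phi> x)))"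
    unfolding pairing_def by (rule integral_norm_bound)
  also have "\<dots> \<le> (LINT x|lborel. B * (indicator {a..b} x *\<^sub>R cmod (f x)))"
  proof (intro integral_mono)
    show "integrable lborel (\<lambda>x. cmod (f x * cnj (\<phi> x)))"
      using pairing_integrable[OF assms(1,2)] by (rule integrable_norm)
    show "integrable lborel (\<lambda>x. B * (indicator {a..b} x *\<^sub>R cmod (f x)))"
      using L1loc_integrable_cmod[OF assms(1), of a b] by (simp add: set_integrable_def)
    fix x
    have "cmod (f x) * cmod (\<phi> x) \<le> cmod (f x) * (B * indicator {a..b} x)"
      by (intro mult_left_mono assms) simp
    then show "cmod (f x * cnj (\<phi> x)) \<le> B * (indicator {a..b} x *\<^sub>R cmod (f x))"
      by (simp add: norm_mult mult_ac)
  qed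
  also have "\<dots> = B * local_norm a b f"
    by (simp add: set_lebesgue_integral_def)
  finally show ?thesis .
qed

lemma pairing_add:
  assumes "f \<in> L1loc" "g \<in> L1loc" "test_fun \<phi>"
  shows "pairing (\<lambda>x. f x + z * g x) \<phi> = pairing f \<phi> + z * pairing g \<phi>"
proof -
  have "pairing (\<lambda>x. f x + z * g x) \<phi> = (LINT x|lborel. f x * cnj (\<phi> x) + z * (g x * cnj (\<phi> x)))"
    unfolding pairing_def by (simp add: algebra_simps)
  also have "\<dots> = pairing f \<phi> + z * pairing g \<phi>"
    unfolding pairing_def using assms pairing_integrable
    by (subst Bochner_Integration.integral_add) auto
  finally show ?thesis .
qed

lemma pairing_zero [simp]: "pairing (\<lambda>x. 0) \<phi> = 0"
  by (simp add: pairing_def)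

lemma pairing_mult: "pairing (\<lambda>x. z * g x) \<phi> = z * pairing g \<phi>"
  unfolding pairing_def by (simp add: mult.assoc)

lemma pairing_diff:
  assumes "f \<in> L1loc" "g \<in> L1loc" "test_fun \<phi>"
  shows "pairing (\<lambda>x. f x - g x) \<phi> = pairing f \<phi> - pairing g \<phi>"
  using pairing_add[OF assms, of "-1"] by simp

lemma pairing_sum:
  assumes "\<And>i. i \<in> F \<Longrightarrow> u i \<in> L1loc" "test_fun \<phi>"
  shows "pairing (\<lambda>x. \<Sum>i\<in>F. u i x) \<phi> = (\<Sum>i\<in>F. pairing (u i) \<phi>)"
  unfolding pairing_def sum_distrib_right using assms pairing_integrable
  by (intro Bochner_Integration.integral_sum) auto

lemma pairing_cnj: "pairing f g = cnj (pairing g f)"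
  unfolding pairing_def by (simp add: mult.commute flip: Bochner_Integration.integral_cnj)

text \<open>Pairing with \<open>\<phi>\<close> is bounded by a multiple of a local mean, hence may
  be applied term by term. It takes the place of continuity of the inner product, since the sums
  need not lie in \<open>L2\<close>.\<close>

lemma series_sum_pairing:
  assumes "series_sum u A g" "test_fun \<phi>"
  shows "((\<lambda>i. pairing (u i) \<phi>) has_sum pairing g \<phi>) A"
proof -
  have u: "\<And>i. i \<in> A \<Longrightarrow> u i \<in> L1loc" and g: "g \<in> L1loc"
    and lim: "\<And>a b. ((\<lambda>F. local_norm a b (\<lambda>x. (\<Sum>i\<in>F. u i x) - g x)) \<longlongrightarrow> 0) (finite_subsets_at_top A)"
    using assms(1) by (auto simp: series_sum_def)
  obtain a b B where B: "0 \<le> B" "\<And>x. cmod (\<phi> x) \<le> B * indicator {a..b} x"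
    using test_fun_bound[OF assms(2)] by auto
  have "((\<lambda>F. (\<Sum>i\<in>F. pairing (u i) \<phi>) - pairing g \<phi>) \<longlongrightarrow> 0) (finite_subsets_at_top A)"
  proof (rule Lim_null_comparison)
    show "((\<lambda>F. B * local_norm a b (\<lambda>x. (\<Sum>i\<in>F. u i x) - g x)) \<longlongrightarrow> 0) (finite_subsets_at_top A)"
      using lim by (intro tendsto_mult_right_zero)
    show "\<forall>\<^sub>F F in finite_subsets_at_top A. norm ((\<Sum>i\<in>F. pairing (u i) \<phi>) - pairing g \<phi>)
        \<le> B * local_norm a b (\<lambda>x. (\<Sum>i\<in>F. u i x) - g x)"
    proof (rule eventually_finite_subsets_at_top_weakI)
      fix F assume F: "finite F" "F \<subseteq> A"
      then have uF: "(\<lambda>x. \<Sum>i\<in>F. u i x) \<in> L1loc" using u by (intro L1loc_sum) auto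
      have "(\<Sum>i\<in>F. pairing (u i) \<phi>) - pairing g \<phi> = pairing (\<lambda>x. (\<Sum>i\<in>F. u i x) - g x) \<phi>"
        using pairing_diff[OF uF g assms(2)] pairing_sum[OF _ assms(2), of F u] u F by force
      then show "norm ((\<Sum>i\<in>F. pairing (u i) \<phi>) - pairing g \<phi>) \<le> B * local_norm a b (\<lambda>x. (\<Sum>i\<in>F. u i x) - g x)"
        using pairing_bound[OF L1loc_diff[OF uF g] assms(2) B] by simp
    qed
  qed
  then show ?thesis unfolding has_sum_def by (subst (asm) LIM_zero_iff)
qed

lemma series_sum_unique:
  assumes "series_sum u A g" "series_sum u A g'"
  shows "AE x in lborel. g x = g' x"
proof -
  have u: "\<And>i. i \<in> A \<Longrightarrow> u i \<in> L1loc" and g: "g \<in> L1loc" "g' \<in> L1loc"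
    and lim: "\<And>a b. ((\<lambda>F. local_norm a b (\<lambda>x. (\<Sum>i\<in>F. u i x) - g x)) \<longlongrightarrow> 0) (finite_subsets_at_top A)"
      "\<And>a b. ((\<lambda>F. local_norm a b (\<lambda>x. (\<Sum>i\<in>F. u i x) - g' x)) \<longlongrightarrow> 0) (finite_subsets_at_top A)"
    using assms by (auto simp: series_sum_def)
  have "AE x in lborel. x \<in> {- real n..real n} \<longrightarrow> g x = g' x" for n :: nat
  proof -
    let ?a = "- real n" and ?b = "real n"
    have "local_norm ?a ?b (\<lambda>x. g x - g' x) \<le> 0 + 0"
    proof (rule tendsto_lowerbound[OF tendsto_add[OF lim(2) lim(1)]])
      show "\<forall>\<^sub>F F in finite_subsets_at_top A. local_norm ?a ?b (\<lambda>x. g x - g' x) \<le>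
         local_norm ?a ?b (\<lambda>x. (\<Sum>i\<in>F. u i x) - g' x) + local_norm ?a ?b (\<lambda>x. (\<Sum>i\<in>F. u i x) - g x)"
      proof (rule eventually_finite_subsets_at_top_weakI)
        fix F assume F: "finite F" "F \<subseteq> A"
        then have uF: "(\<lambda>x. \<Sum>i\<in>F. u i x) \<in> L1loc" using u by (intro L1loc_sum) auto
        show "local_norm ?a ?b (\<lambda>x. g x - g' x) \<le>
         local_norm ?a ?b (\<lambda>x. (\<Sum>i\<in>F. u i x) - g' x) + local_norm ?a ?b (\<lambda>x. (\<Sum>i\<in>F. u i x) - g x)"
          using local_norm_diff[OF L1loc_diff[OF uF g(2)] L1loc_diff[OF uF g(1)], of ?a ?b] by simp
      qed
    qed simp
    then have "local_norm ?a ?b (\<lambda>x. g x - g' x) = 0"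
      using local_norm_nonneg[of ?a ?b "\<lambda>x. g x - g' x"] by simp
    then have "AE x in lborel. indicator {?a..?b} x *\<^sub>R cmod (g x - g' x) = 0"
      using L1loc_integrable_cmod[OF L1loc_diff[OF g], of ?a ?b]
      unfolding set_lebesgue_integral_def set_integrable_def
      by (subst (asm) integral_nonneg_eq_0_iff_AE) auto
    then show ?thesis by eventually_elim (auto simp: indicator_def)
  qed
  then have "AE x in lborel. \<forall>n::nat. x \<in> {- real n..real n} \<longrightarrow> g x = g' x"
    unfolding AE_all_countable by blast
  then show ?thesis
  proof eventually_elim
    case (elim x)
    obtain n where "\<bar>x\<bar> \<le> real n" using real_arch_simple by blast
    then show ?case using elim by (auto simp: abs_le_iff)
  qed
qed

lemma series_sum_add:
  assumes "series_sum u A g" "series_sum v A h"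
  shows "series_sum (\<lambda>i x. u i x + z * v i x) A (\<lambda>x. g x + z * h x)"
  unfolding series_sum_def
proof (intro conjI ballI allI)
  have u: "\<And>i. i \<in> A \<Longrightarrow> u i \<in> L1loc" "\<And>i. i \<in> A \<Longrightarrow> v i \<in> L1loc" and g: "g \<in> L1loc" "h \<in> L1loc"
    and lim: "\<And>a b. ((\<lambda>F. local_norm a b (\<lambda>x. (\<Sum>i\<in>F. u i x) - g x)) \<longlongrightarrow> 0) (finite_subsets_at_top A)"
      "\<And>a b. ((\<lambda>F. local_norm a b (\<lambda>x. (\<Sum>i\<in>F. v i x) - h x)) \<longlongrightarrow> 0) (finite_subsets_at_top A)"
    using assms by (auto simp: series_sum_def)
  show "(\<lambda>x. u i x + z * v i x) \<in> L1loc" if "i \<in> A" for i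
    using u that by (intro L1loc_add L1loc_mult)
  show "(\<lambda>x. g x + z * h x) \<in> L1loc" using g by (intro L1loc_add L1loc_mult)
  fix a b
  show "((\<lambda>F. local_norm a b (\<lambda>x. (\<Sum>i\<in>F. u i x + z * v i x) - (g x + z * h x))) \<longlongrightarrow> 0) (finite_subsets_at_top A)"
  proof (rule Lim_null_comparison)
    show "((\<lambda>F. local_norm a b (\<lambda>x. (\<Sum>i\<in>F. u i x) - g x) + cmod z * local_norm a b (\<lambda>x. (\<Sum>i\<in>F. v i x) - h x)) \<longlongrightarrow> 0) (finite_subsets_at_top A)"
      using tendsto_add[OF lim(1) tendsto_mult_right_zero[OF lim(2)], of a b "cmod z" a b] by simp
    show "\<forall>\<^sub>F F in finite_subsets_at_top A. norm (local_norm a b (\<lambda>x. (\<Sum>i\<in>F. u i x + z * v i x) - (g x + z * h x)))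
        \<le> local_norm a b (\<lambda>x. (\<Sum>i\<in>F. u i x) - g x) + cmod z * local_norm a b (\<lambda>x. (\<Sum>i\<in>F. v i x) - h x)"
    proof (rule eventually_finite_subsets_at_top_weakI)
      fix F assume F: "finite F" "F \<subseteq> A"
      have "local_norm a b (\<lambda>x. ((\<Sum>i\<in>F. u i x) - g x) + z * ((\<Sum>i\<in>F. v i x) - h x))
        \<le> local_norm a b (\<lambda>x. (\<Sum>i\<in>F. u i x) - g x) + local_norm a b (\<lambda>x. z * ((\<Sum>i\<in>F. v i x) - h x))"
        using u g F by (intro local_norm_add L1loc_mult L1loc_diff L1loc_sum) auto
      moreover have "((\<Sum>i\<in>F. u i x) - g x) + z * ((\<Sum>i\<in>F. v i x) - h x) = (\<Sum>i\<in>F. u i x + z * v i x) - (g x + z * h x)" for x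
        by (simp add: sum.distrib sum_distrib_left algebra_simps)
      ultimately show "norm (local_norm a b (\<lambda>x. (\<Sum>i\<in>F. u i x + z * v i x) - (g x + z * h x)))
        \<le> local_norm a b (\<lambda>x. (\<Sum>i\<in>F. u i x) - g x) + cmod z * local_norm a b (\<lambda>x. (\<Sum>i\<in>F. v i x) - h x)"
        by (simp add: local_norm_mult local_norm_nonneg)
    qed
  qed
qed

section \<open>Completeness for convergence in local mean\<close>

lemma Fatou_bound:
  fixes f :: "nat \<Rightarrow> 'a \<Rightarrow> real"
  assumes "\<And>n. integrable M (f n)" "\<And>n x. 0 \<le> f n x" "\<And>x. 0 \<le> g x" "g \<in> borel_measurable M"
    and "AE x in M. (\<lambda>n. f n x) \<longlonglongrightarrow> g x" "\<forall>\<^sub>F n in sequentially. (LINT x|M. f n x) \<le> c" "0 \<le> c"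
  shows "integrable M g" and "(LINT x|M. g x) \<le> c"
proof -
  have [measurable]: "f n \<in> borel_measurable M" for n using assms(1) by (rule borel_measurable_integrable)
  have "(\<integral>\<^sup>+x. ennreal (g x) \<partial>M) = (\<integral>\<^sup>+x. liminf (\<lambda>n. ennreal (f n x)) \<partial>M)"
    using assms(5)
    by (intro nn_integral_cong_AE, eventually_elim) 
      (metis lim_imp_Liminf sequentially_bot tendsto_ennrealI)
  also have "\<dots> \<le> liminf (\<lambda>n. \<integral>\<^sup>+x. ennreal (f n x) \<partial>M)"
    by (rule nn_integral_liminf) simp
  also have "\<dots> \<le> limsup (\<lambda>n. \<integral>\<^sup>+x. ennreal (f n x) \<partial>M)"
    by (rule Liminf_le_Limsup) simp
  also have "\<dots> \<le> ennreal c"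
  proof (rule Limsup_bounded)
    show "\<forall>\<^sub>F n in sequentially. (\<integral>\<^sup>+x. ennreal (f n x) \<partial>M) \<le> ennreal c"
      using assms(6)
    proof eventually_elim
      case (elim n)
      then show ?case using assms(1,2,7) by (subst nn_integral_eq_integral) (auto intro: ennreal_leI)
    qed
  qed
  finally have le: "(\<integral>\<^sup>+x. ennreal (g x) \<partial>M) \<le> ennreal c" .
  then have "(\<integral>\<^sup>+x. ennreal (g x) \<partial>M) < \<infinity>" by (simp add: le_less_trans)
  then show int: "integrable M g"
    using assms(3,4) by (intro integrableI_nonneg) auto
  show "(LINT x|M. g x) \<le> c"
    using le assms(3,7) by (subst (asm) nn_integral_eq_integral[OF int]) auto
qed

text \<open>The Cauchy criterion for the net of finite sums: two finite sums over sets containing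
  \<open>F0\<close> differ by two sums over sets disjoint from \<open>F0\<close>.\<close>

definition L1loc_Cauchy :: "('i \<Rightarrow> real \<Rightarrow> complex) \<Rightarrow> 'i set \<Rightarrow> bool" where
  "L1loc_Cauchy u A \<longleftrightarrow> (\<forall>i\<in>A. u i \<in> L1loc) \<and>
    (\<forall>a b e. 0 < e \<longrightarrow> (\<exists>F0. finite F0 \<and> F0 \<subseteq> A \<and>
      (\<forall>F. finite F \<and> F \<subseteq> A \<and> F \<inter> F0 = {} \<longrightarrow> local_norm a b (\<lambda>x. \<Sum>i\<in>F. u i x) \<le> e)))"

text \<open>Increments bounded by a geometric sequence have a finite total integral, so almost
  everywhere the telescoping series converges absolutely. The index \<open>k\<close> is there
  because a fixed interval is controlled only from some stage on.\<close>

lemma AE_convergent_of_local_norms: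
  fixes s :: "nat \<Rightarrow> real \<Rightarrow> complex"
  assumes s: "\<And>n. s n \<in> L1loc"
    and bound: "\<And>n. n \<ge> k \<Longrightarrow> local_norm a b (\<lambda>x. s (Suc n) x - s n x) \<le> (1/2) ^ n"
  shows "AE x in lborel. x \<in> {a..b} \<longrightarrow> convergent (\<lambda>n. s n x)"
proof -
  have [measurable]: "s n \<in> borel_measurable lborel" for n using s by (rule L1loc_measurable)
  define D where "D n x = ennreal (indicator {a..b} x * cmod (s (Suc (n + k)) x - s (n + k) x))" for n x
  have [measurable]: "D n \<in> borel_measurable lborel" for n
    unfolding D_def by measurable
  have D: "(\<integral>\<^sup>+x. D n x \<partial>lborel) \<le> ennreal ((1/2) ^ n)" for n
  proof -
    have "(\<integral>\<^sup>+x. D n x \<partial>lborel) = ennreal (local_norm a b (\<lambda>x. s (Suc (n + k)) x - s (n + k) x))"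
      using L1loc_integrable_cmod[OF L1loc_diff[OF s s], of a b "Suc (n + k)" "n + k"]
      unfolding D_def set_lebesgue_integral_def set_integrable_def
      by (subst nn_integral_eq_integral) auto
    also have "\<dots> \<le> ennreal ((1/2) ^ (n + k))" by (intro ennreal_leI bound) simp
    also have "\<dots> \<le> ennreal ((1/2) ^ n)" by (intro ennreal_leI power_decreasing) auto
    finally show ?thesis .
  qed
  have "(\<integral>\<^sup>+x. (\<Sum>n. D n x) \<partial>lborel) = (\<Sum>n. \<integral>\<^sup>+x. D n x \<partial>lborel)"
    by (rule nn_integral_suminf) simp
  also have "\<dots> \<le> (\<Sum>n. ennreal ((1/2) ^ n))"
    by (intro suminf_le D) auto
  also have "\<dots> = ennreal (\<Sum>n. (1/2) ^ n)"
    by (rule suminf_ennreal2) (auto intro: summable_geometric)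
  finally have "(\<integral>\<^sup>+x. (\<Sum>n. D n x) \<partial>lborel) \<noteq> \<infinity>"
    using ennreal_less_top less_le_not_le top.extremum_unique by fastforce
  then have "AE x in lborel. (\<Sum>n. D n x) \<noteq> \<infinity>"
    by (intro nn_integral_PInf_AE) auto
  then show ?thesis
  proof eventually_elim
    case (elim x)
    show ?case
    proof
      assume x: "x \<in> {a..b}"
      have "summable (\<lambda>n. cmod (s (Suc (n + k)) x - s (n + k) x))"
        using elim x by (intro summable_suminf_not_top) (auto simp: D_def)
      then have "summable (\<lambda>n. s (Suc (n + k)) x - s (n + k) x)" by (rule summable_norm_cancel)
      then have "convergent (\<lambda>n. \<Sum>j<n. s (Suc (j + k)) x - s (j + k) x)"
        by (simp add: summable_iff_convergent)
      moreover have "(\<Sum>j<n. s (Suc (j + k)) x - s (j + k) x) = s (n + k) x - s k x" for n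
        by (induction n) auto
      ultimately have "convergent (\<lambda>n. (s (n + k) x - s k x) + s k x)"
        by (intro convergent_add) (auto simp: convergent_const)
      then show "convergent (\<lambda>n. s n x)"
        by (simp add: convergent_ignore_initial_segment[where f = "\<lambda>n. s n x"])
    qed
  qed
qed

text \<open>The tolerance \<open>(1/2) ^ n\<close> is imposed on the interval from \<open>-n\<close>
  to \<open>n\<close>, so one sequence of finite sets serves all bounded intervals. That sequence is
  returned with its almost everywhere limit because \<open>Riesz_Fischer_haar\<close> applies Fatou
  to the squares along it.\<close>

lemma L1loc_Cauchy_sum:
  assumes "L1loc_Cauchy u A"
  obtains g F where "series_sum u A g" "\<And>n. finite (F n)" "\<And>n. F n \<subseteq> A"
    "AE x in lborel. (\<lambda>n::nat. \<Sum>i\<in>F n. u i x) \<longlonglongrightarrow> g x"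
proof -
  have u: "\<And>i. i \<in> A \<Longrightarrow> u i \<in> L1loc" using assms by (auto simp: L1loc_Cauchy_def)
  have "\<forall>n. \<exists>F0. finite F0 \<and> F0 \<subseteq> A \<and> (\<forall>F. finite F \<and> F \<subseteq> A \<and> F \<inter> F0 = {} \<longrightarrow>
      local_norm (- real n) (real n) (\<lambda>x. \<Sum>i\<in>F. u i x) \<le> (1/2) ^ n)"
    using assms by (auto simp: L1loc_Cauchy_def)
  then obtain F0 where F0: "\<And>n. finite (F0 n)" "\<And>n. F0 n \<subseteq> A"
    "\<And>n F. finite F \<Longrightarrow> F \<subseteq> A \<Longrightarrow> F \<inter> F0 n = {} \<Longrightarrow>
      local_norm (- real n) (real n) (\<lambda>x. \<Sum>i\<in>F. u i x) \<le> (1/2) ^ n"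
    by metis
  \<comment> \<open>Unions make the sets increasing, and a set disjoint from \<open>F n\<close> is
    also disjoint from \<open>F0 n\<close>.\<close>
  define F where "F n = (\<Union>m\<le>n. F0 m)" for n
  have F: "finite (F n)" "F n \<subseteq> A" "F0 n \<subseteq> F n" for n
    using F0 by (auto simp: F_def)
  have F_mono: "F m \<subseteq> F n" if "m \<le> n" for m n using that by (fastforce simp: F_def)
  define s where "s n x = (\<Sum>i\<in>F n. u i x)" for n x
  define g where "g x = lim (\<lambda>n. s n x)" for x
  have sumL: "(\<lambda>x. \<Sum>i\<in>H. u i x) \<in> L1loc" if "H \<subseteq> A" for H
    using u that by (intro L1loc_sum) auto
  have s: "s n \<in> L1loc" for n
    using sumL[OF F(2)[of n]] by (simp add: s_def[abs_def])
  then have s_meas [measurable]: "s n \<in> borel_measurable lborel" for n by (rule L1loc_measurable)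
  have g_meas [measurable]: "g \<in> borel_measurable lborel"
    unfolding g_def[abs_def] by measurable
  have tail: "local_norm a b (\<lambda>x. \<Sum>i\<in>H. u i x) \<le> (1/2) ^ n"
    if "finite H" "H \<subseteq> A" "H \<inter> F n = {}" "- real n \<le> a" "b \<le> real n" for a b H n
  proof -
    have "local_norm a b (\<lambda>x. \<Sum>i\<in>H. u i x) \<le> local_norm (- real n) (real n) (\<lambda>x. \<Sum>i\<in>H. u i x)"
      using that by (intro local_norm_mono_interval sumL) auto
    also have "\<dots> \<le> (1/2) ^ n" using that F(3)[of n] by (intro F0(3)) auto
    finally show ?thesis .
  qed
  have "AE x in lborel. x \<in> {- real k..real k} \<longrightarrow> convergent (\<lambda>n. s n x)" for k
  proof (rule AE_convergent_of_local_norms[OF s])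
    fix n assume "k \<le> n"
    have "s (Suc n) x - s n x = (\<Sum>i\<in>F (Suc n) - F n. u i x)" for x
      unfolding s_def using F F_mono[of n "Suc n"] by (subst sum_diff) auto
    then show "local_norm (- real k) (real k) (\<lambda>x. s (Suc n) x - s n x) \<le> (1/2) ^ n"
      using tail[of "F (Suc n) - F n" n "- real k" "real k"] F[of "Suc n"] \<open>k \<le> n\<close> by auto
  qed
  then have "AE x in lborel. \<forall>k::nat. x \<in> {- real k..real k} \<longrightarrow> convergent (\<lambda>n. s n x)"
    unfolding AE_all_countable by blast
  then have lim: "AE x in lborel. (\<lambda>n. s n x) \<longlonglongrightarrow> g x"
  proof eventually_elim
    case (elim x)
    obtain n where "\<bar>x\<bar> \<le> real n" using real_arch_simple by blast
    then have "convergent (\<lambda>n. s n x)" using elim by (auto simp: abs_le_iff)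
    then show ?case by (simp add: g_def convergent_LIMSEQ_iff)
  qed
  have approx: "set_integrable lborel {a..b} (\<lambda>x. cmod ((\<Sum>i\<in>H. u i x) - g x))"
      "local_norm a b (\<lambda>x. (\<Sum>i\<in>H. u i x) - g x) \<le> 2 * (1/2) ^ n"
    if H: "finite H" "H \<subseteq> A" "F n \<subseteq> H" and ab: "- real n \<le> a" "b \<le> real n" for a b H n
  proof -
    have [measurable]: "(\<lambda>x. \<Sum>i\<in>H. u i x) \<in> borel_measurable lborel"
      by (intro L1loc_measurable sumL H)
    let ?f = "\<lambda>m x. indicator {a..b} x *\<^sub>R cmod ((\<Sum>i\<in>H. u i x) - s m x)"
    let ?g = "\<lambda>x. indicator {a..b} x *\<^sub>R cmod ((\<Sum>i\<in>H. u i x) - g x)"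
    have 1: "integrable lborel (?f m)" for m
      using L1loc_integrable_cmod[OF L1loc_diff[OF sumL[OF H(2)] s]] unfolding set_integrable_def .
    have 2: "AE x in lborel. (\<lambda>m. ?f m x) \<longlonglongrightarrow> ?g x"
      using lim by eventually_elim (intro tendsto_intros)
    \<comment> \<open>Both \<open>H\<close> and \<open>F m\<close> contain \<open>F n\<close>, so
      their two set differences avoid it, which accounts for the factor 2. As \<open>m\<close> tends
      to infinity, Fatou replaces \<open>s m\<close> by \<open>g\<close>.\<close>
    have 3: "(LINT x|lborel. ?f m x) \<le> 2 * (1/2) ^ n" if "n \<le> m" for m
    proof -
      have "(\<Sum>i\<in>H. u i x) - s m x = (\<Sum>i\<in>H - F m. u i x) - (\<Sum>i\<in>F m - H. u i x)" for x
      proof -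
        have "(\<Sum>i\<in>H. u i x) = (\<Sum>i\<in>H \<inter> F m. u i x) + (\<Sum>i\<in>H - F m. u i x)"
          using H(1) by (rule sum.Int_Diff)
        moreover have "s m x = (\<Sum>i\<in>F m \<inter> H. u i x) + (\<Sum>i\<in>F m - H. u i x)"
          unfolding s_def using F(1) by (rule sum.Int_Diff)
        ultimately show ?thesis by (simp add: Int_commute)
      qed
      then have "(LINT x|lborel. ?f m x) = local_norm a b (\<lambda>x. (\<Sum>i\<in>H - F m. u i x) - (\<Sum>i\<in>F m - H. u i x))"
        by (simp add: set_lebesgue_integral_def)
      also have "\<dots> \<le> local_norm a b (\<lambda>x. \<Sum>i\<in>H - F m. u i x) + local_norm a b (\<lambda>x. \<Sum>i\<in>F m - H. u i x)"
        using H F(2)[of m] by (intro local_norm_diff sumL) auto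
      also have "\<dots> \<le> (1/2) ^ n + (1/2) ^ n"
        using H F(1,2)[of m] F_mono[OF that] ab by (intro add_mono tail) auto
      finally show ?thesis by simp
    qed
    have 4: "\<forall>\<^sub>F m in sequentially. (LINT x|lborel. ?f m x) \<le> 2 * (1/2) ^ n"
      using 3 eventually_sequentially by blast
    show "set_integrable lborel {a..b} (\<lambda>x. cmod ((\<Sum>i\<in>H. u i x) - g x))"
      unfolding set_integrable_def by (rule Fatou_bound(1)[OF 1 _ _ _ 2 4]) auto
    show "local_norm a b (\<lambda>x. (\<Sum>i\<in>H. u i x) - g x) \<le> 2 * (1/2) ^ n"
      unfolding set_lebesgue_integral_def by (rule Fatou_bound(2)[OF 1 _ _ _ 2 4]) auto
  qed
  have gL: "g \<in> L1loc"
    unfolding L1loc_def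
  proof (intro CollectI conjI allI)
    fix a b
    obtain n where n: "max (- a) b \<le> real n" using real_arch_simple by blast
    have "set_integrable lborel {a..b} (\<lambda>x. cmod (s n x - g x))"
      unfolding s_def using n F by (intro approx(1)[of _ n]) auto
    then have "integrable lborel (\<lambda>x. norm (indicator {a..b} x *\<^sub>R (s n x - g x)))"
      by (simp add: set_integrable_def)
    then have "set_integrable lborel {a..b} (\<lambda>x. s n x - g x)"
      unfolding set_integrable_def by (rule integrable_norm_cancel) simp
    then have "set_integrable lborel {a..b} (\<lambda>x. s n x - (s n x - g x))"
      by (rule set_integral_diff(1)[OF L1loc_integrable[OF s]])
    then show "set_integrable lborel {a..b} g" by simp
  qed simp
  have "series_sum u A g"
    unfolding series_sum_def
  proof (intro conjI ballI allI u gL)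
    fix a b
    show "((\<lambda>F. local_norm a b (\<lambda>x. (\<Sum>i\<in>F. u i x) - g x)) \<longlongrightarrow> 0) (finite_subsets_at_top A)"
    proof (rule tendstoI)
      fix e :: real assume "0 < e"
      obtain n0 where n0: "max (- a) b \<le> real n0" using real_arch_simple by blast
      obtain n1 where n1: "(1/2) ^ n1 < e / 2" using real_arch_pow_inv[of "e / 2" "1 / 2"] \<open>0 < e\<close> by auto
      define n where "n = max n0 n1"
      have "real n0 \<le> real n" by (simp add: n_def)
      have "(1/2 :: real) ^ n \<le> (1/2) ^ n1" by (intro power_decreasing) (auto simp: n_def)
      with n1 have e: "2 * (1/2) ^ n < e" by linarith
      show "\<forall>\<^sub>F F in finite_subsets_at_top A. dist (local_norm a b (\<lambda>x. (\<Sum>i\<in>F. u i x) - g x)) 0 < e"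
        unfolding eventually_finite_subsets_at_top
      proof (intro exI conjI allI impI)
        fix H assume "finite H \<and> F n \<subseteq> H \<and> H \<subseteq> A"
        then have "local_norm a b (\<lambda>x. (\<Sum>i\<in>H. u i x) - g x) \<le> 2 * (1/2) ^ n"
          using n0 \<open>real n0 \<le> real n\<close> by (intro approx(2)) auto
        then show "dist (local_norm a b (\<lambda>x. (\<Sum>i\<in>H. u i x) - g x)) 0 < e"
          using e local_norm_nonneg[of a b "\<lambda>x. (\<Sum>i\<in>H. u i x) - g x"] by (simp add: dist_real_def)
      qed (use F in auto)
    qed
  qed
  then show thesis
    using F lim by (intro that[of g F]) (auto simp: s_def)
qed

lemma L1loc_Cauchy_Un:
  assumes "L1loc_Cauchy u A" "L1loc_Cauchy u B"
  shows "L1loc_Cauchy u (A \<union> B)"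
  unfolding L1loc_Cauchy_def
proof (intro conjI ballI allI impI)
  have u: "\<And>i. i \<in> A \<union> B \<Longrightarrow> u i \<in> L1loc" using assms by (auto simp: L1loc_Cauchy_def)
  then show "i \<in> A \<union> B \<Longrightarrow> u i \<in> L1loc" for i .
  fix a b e :: real assume "0 < e"
  then have "0 < e / 2" by simp
  obtain F1 where F1: "finite F1" "F1 \<subseteq> A" "\<And>F. finite F \<Longrightarrow> F \<subseteq> A \<Longrightarrow> F \<inter> F1 = {} \<Longrightarrow> local_norm a b (\<lambda>x. \<Sum>i\<in>F. u i x) \<le> e / 2"
    using assms(1) \<open>0 < e / 2\<close> unfolding L1loc_Cauchy_def by meson
  obtain F2 where F2: "finite F2" "F2 \<subseteq> B" "\<And>F. finite F \<Longrightarrow> F \<subseteq> B \<Longrightarrow> F \<inter> F2 = {} \<Longrightarrow> local_norm a b (\<lambda>x. \<Sum>i\<in>F. u i x) \<le> e / 2"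
    using assms(2) \<open>0 < e / 2\<close> unfolding L1loc_Cauchy_def by meson
  show "\<exists>F0. finite F0 \<and> F0 \<subseteq> A \<union> B \<and> (\<forall>F. finite F \<and> F \<subseteq> A \<union> B \<and> F \<inter> F0 = {} \<longrightarrow> local_norm a b (\<lambda>x. \<Sum>i\<in>F. u i x) \<le> e)"
  proof (intro exI[of _ "F1 \<union> F2"] conjI allI impI)
    fix F assume F: "finite F \<and> F \<subseteq> A \<union> B \<and> F \<inter> (F1 \<union> F2) = {}"
    have "(\<Sum>i\<in>F. u i x) = (\<Sum>i\<in>F \<inter> A. u i x) + (\<Sum>i\<in>F - A. u i x)" for x
      using F by (intro sum.Int_Diff) auto
    then have "local_norm a b (\<lambda>x. \<Sum>i\<in>F. u i x) \<le> local_norm a b (\<lambda>x. \<Sum>i\<in>F \<inter> A. u i x) + local_norm a b (\<lambda>x. \<Sum>i\<in>F - A. u i x)"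
      using local_norm_add[of "\<lambda>x. \<Sum>i\<in>F \<inter> A. u i x" "\<lambda>x. \<Sum>i\<in>F - A. u i x" a b] F u by (auto intro!: L1loc_sum)
    also have "\<dots> \<le> e / 2 + e / 2"
      using F by (intro add_mono F1 F2) auto
    finally show "local_norm a b (\<lambda>x. \<Sum>i\<in>F. u i x) \<le> e" by simp
  qed (use F1 F2 in auto)
qed

lemma small_tail_sums:
  fixes f :: "'i \<Rightarrow> real"
  assumes "f summable_on A" "\<And>i. i \<in> A \<Longrightarrow> 0 \<le> f i" "0 < e"
  obtains F0 where "finite F0" "F0 \<subseteq> A" "\<And>F. finite F \<Longrightarrow> F \<subseteq> A \<Longrightarrow> F \<inter> F0 = {} \<Longrightarrow> sum f F \<le> e"
proof -
  have "(f has_sum infsum f A) A" using assms(1) by (rule has_sum_infsum)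
  then have "\<forall>\<^sub>F F in finite_subsets_at_top A. dist (sum f F) (infsum f A) < e"
    using assms(3) unfolding has_sum_def by (rule tendstoD)
  then obtain F0 where F0: "finite F0" "F0 \<subseteq> A" "dist (sum f F0) (infsum f A) < e"
    unfolding eventually_finite_subsets_at_top by blast
  have "sum f F \<le> e" if "finite F" "F \<subseteq> A" "F \<inter> F0 = {}" for F
  proof -
    have "sum f (F \<union> F0) \<le> infsum f A"
      using assms that F0 by (intro finite_sum_le_infsum) auto
    moreover have "sum f (F \<union> F0) = sum f F + sum f F0"
      using that F0 by (intro sum.union_disjoint) auto
    ultimately show ?thesis using F0(3) by (simp add: dist_real_def)
  qed
  with F0 show thesis by (intro that)
qed

lemma L1loc_Cauchy_of_summable:
  assumes "\<And>i. i \<in> A \<Longrightarrow> u i \<in> L1loc" "\<And>a b. (\<lambda>i. local_norm a b (u i)) summable_on A"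
  shows "L1loc_Cauchy u A"
  unfolding L1loc_Cauchy_def
proof (intro conjI ballI allI impI assms(1))
  fix a b e :: real assume "0 < e"
  then obtain F0 where F0: "finite F0" "F0 \<subseteq> A"
      "\<And>F. finite F \<Longrightarrow> F \<subseteq> A \<Longrightarrow> F \<inter> F0 = {} \<Longrightarrow> (\<Sum>i\<in>F. local_norm a b (u i)) \<le> e"
    using small_tail_sums[OF assms(2)[of a b] local_norm_nonneg] by metis
  have "local_norm a b (\<lambda>x. \<Sum>i\<in>F. u i x) \<le> e" if "finite F" "F \<subseteq> A" "F \<inter> F0 = {}" for F
    using local_norm_sum[of F u a b] F0(3)[OF that] that assms(1) by (meson order_trans subsetD)
  then show "\<exists>F0. finite F0 \<and> F0 \<subseteq> A \<and> (\<forall>F. finite F \<and> F \<subseteq> A \<and> F \<inter> F0 = {} \<longrightarrow> local_norm a b (\<lambda>x. \<Sum>i\<in>F. u i x) \<le> e)"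
    using F0(1,2) by (intro exI[of _ F0]) auto
qed

section \<open>The Haar system\<close>

lemma dyadic_Ico:
  assumes "I \<in> dyadic"
  obtains a b where "a < b" "I = {a..<b}"
proof -
  obtain m k where "I = dint m k" using assms by (rule dyadicE)
  then show thesis
    using dint_bounds_less[of m k] by (intro that) (auto simp: dint_def)
qed

lemma dyadic_sets [measurable]: "I \<in> dyadic \<Longrightarrow> I \<in> sets lborel"
  by (erule dyadic_Ico) simp

lemma dyadic_emeasure_finite: "I \<in> dyadic \<Longrightarrow> emeasure lborel I < \<infinity>"
  by (erule dyadic_Ico) simp

lemma len_neq_0 [simp]: "I \<in> dyadic \<Longrightarrow> len I \<noteq> 0"
  using len_pos[of I] by (metis less_irrefl)

lemma integrable_indicator_Icc: "integrable lborel (indicator {a..b::real} :: real \<Rightarrow> real)"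
  by (rule integrable_real_indicator) (auto simp: emeasure_lborel_Icc_eq)

lemma integrable_indicator_Int:
  assumes "A \<in> dyadic" "B \<in> dyadic"
  shows "integrable lborel (\<lambda>x. indicator A x * indicator B x :: real)"
    "(LINT x|lborel. indicator A x * indicator B x) = len (A \<inter> B)"
proof -
  have "(\<lambda>x. indicator A x * indicator B x :: real) = indicator (A \<inter> B)"
    by (auto simp: indicator_def)
  moreover have "emeasure lborel (A \<inter> B) < \<infinity>"
    using emeasure_mono[of "A \<inter> B" A lborel] dyadic_emeasure_finite[OF assms(1)] dyadic_sets[OF assms(1)]
    by (auto intro: le_less_trans)
  ultimately show "integrable lborel (\<lambda>x. indicator A x * indicator B x :: real)"
    "(LINT x|lborel. indicator A x * indicator B x) = len (A \<inter> B)"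
    using dyadic_sets[OF assms(1)] dyadic_sets[OF assms(2)] by (simp_all add: len_def)
qed

lemma test_fun_haar:
  assumes "I \<in> dyadic"
  shows "test_fun (haar \<alpha> I)"
proof -
  obtain a b where I: "I = {a..<b}" using dyadic_Ico[OF assms] by metis
  have "left_half I \<in> sets borel" "right_half I \<in> sets borel" "I \<in> sets borel"
    using dyadic_sets halves_dyadic[OF assms] assms by auto
  then have "haar \<alpha> I \<in> borel_measurable lborel"
    unfolding haar_def[abs_def] by (cases "\<alpha> = 0") simp_all
  moreover have "cmod (haar \<alpha> I x) \<le> 1 / sqrt (len I) + 1 / len I" for x
  proof -
    have "\<bar>indicator (right_half I) x - indicator (left_half I) x\<bar> \<le> (1::real)"
      by (auto simp: indicator_def)
    then have "\<bar>indicator (right_half I) x - indicator (left_half I) x\<bar> / sqrt (len I) \<le> 1 / sqrt (len I)"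
      by (intro divide_right_mono) auto
    moreover have "\<bar>indicator I x\<bar> / len I \<le> 1 / len I"
      by (intro divide_right_mono) (auto simp: indicator_def)
    moreover have "0 \<le> 1 / sqrt (len I)" "0 \<le> 1 / len I" by auto
    ultimately show ?thesis
      by (auto simp: haar_def norm_divide simp flip: of_real_diff intro: add_increasing add_increasing2)
  qed
  moreover have "haar \<alpha> I x = 0" if "x \<notin> {a..b}" for x
    using that halves_subset[of I] unfolding haar_def I by (auto simp: indicator_def)
  ultimately show ?thesis unfolding test_fun_def by blast
qed

lemma L1loc_test_fun:
  assumes "test_fun \<phi>"
  shows "\<phi> \<in> L1loc"
proof -
  obtain a' b' B where B: "0 \<le> B" "\<And>x. cmod (\<phi> x) \<le> B * indicator {a'..b'} x"
    using test_fun_bound[OF assms] by auto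
  have "set_integrable lborel {a..b} \<phi>" for a b
    unfolding set_integrable_def
  proof (rule Bochner_Integration.integrable_bound)
    show "integrable lborel (\<lambda>x. B * indicator {a'..b'} x :: real)"
      by (intro Bochner_Integration.integrable_mult_right integrable_indicator_Icc)
    show "(\<lambda>x. indicator {a..b} x *\<^sub>R \<phi> x) \<in> borel_measurable lborel"
      using test_fun_measurable[OF assms] by simp
    show "AE x in lborel. norm (indicator {a..b} x *\<^sub>R \<phi> x) \<le> norm (B * indicator {a'..b'} x)"
    proof (rule AE_I2)
      fix x
      have "norm (indicator {a..b} x *\<^sub>R \<phi> x) \<le> cmod (\<phi> x)" by (simp add: indicator_def)
      also have "\<dots> \<le> B * indicator {a'..b'} x" by (rule B)
      also have "\<dots> \<le> norm (B * indicator {a'..b'} x)" by (simp only: real_norm_def abs_ge_self)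
      finally show "norm (indicator {a..b} x *\<^sub>R \<phi> x) \<le> norm (B * indicator {a'..b'} x)" .
    qed
  qed
  then show ?thesis using assms by (simp add: L1loc_def test_fun_def)
qed

lemma L1loc_haar: "I \<in> dyadic \<Longrightarrow> haar \<alpha> I \<in> L1loc"
  by (intro L1loc_test_fun test_fun_haar)

text \<open>The left side is the integral of \<open>sqrt (len J) * haar 0 J\<close> over
  \<open>K\<close>. It vanishes for \<open>J \<subseteq> K\<close> because the halves have equal
  length; the other positions put \<open>K\<close> inside one half or off \<open>J\<close>. Both
  Haar pairings below are reduced to it.\<close>

lemma len_half_diff:
  assumes "J \<in> dyadic" "K \<in> dyadic"
  shows "len (right_half J \<inter> K) - len (left_half J \<inter> K) = half_sign J K * len K"
proof -
  note h = halves_subset[of J] halves_Int[of J] halves_dyadic[OF assms(1)]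
  consider "K \<subseteq> right_half J" | "K \<subseteq> left_half J" | "J \<subseteq> K" | "J \<inter> K = {}"
    using dyadic_nested_or_disjoint[OF assms] dyadic_psubset_half[OF assms] by blast
  then show ?thesis
  proof cases
    case 1
    then have "right_half J \<inter> K = K" "left_half J \<inter> K = {}" "\<not> K \<subseteq> left_half J"
      using h dyadic_nonempty[OF assms(2)] by auto
    then show ?thesis using 1 assms by (simp add: half_sign_def below_def len_def)
  next
    case 2
    then have "left_half J \<inter> K = K" "right_half J \<inter> K = {}" "\<not> K \<subseteq> right_half J"
      using h dyadic_nonempty[OF assms(2)] by auto
    then show ?thesis using 2 assms by (simp add: half_sign_def below_def len_def)
  next
    case 3
    then have "right_half J \<inter> K = right_half J" "left_half J \<inter> K = left_half J"
        "\<not> K \<subseteq> right_half J" "\<not> K \<subseteq> left_half J"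
      using h halves_psubset[OF assms(1)] by auto
    then show ?thesis using assms by (simp add: half_sign_def below_def len_halves)
  next
    case 4
    then have "right_half J \<inter> K = {}" "left_half J \<inter> K = {}" "\<not> K \<subseteq> right_half J" "\<not> K \<subseteq> left_half J"
      using h dyadic_nonempty[OF assms(2)] by auto
    then show ?thesis by (simp add: half_sign_def below_def len_def)
  qed
qed

lemma pairing_haar_haar1:
  assumes "J \<in> dyadic" "K \<in> dyadic"
  shows "pairing (haar 0 J) (haar 1 K) = of_real (half_sign J K / sqrt (len J))"
proof -
  have "haar 0 J x * cnj (haar 1 K x) = complex_of_real ((indicator (right_half J) x * indicator K x
      - indicator (left_half J) x * indicator K x) / (sqrt (len J) * len K))" for x
    by (simp add: haar_def field_simps)
  then have "pairing (haar 0 J) (haar 1 K) = complex_of_real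
      ((len (right_half J \<inter> K) - len (left_half J \<inter> K)) / (sqrt (len J) * len K))"
    unfolding pairing_def using assms
    by (simp only: integral_complex_of_real) (simp add: integrable_indicator_Int)
  also have "\<dots> = of_real (half_sign J K / sqrt (len J))"
    using assms by (simp add: len_half_diff)
  finally show ?thesis .
qed

lemma pairing_haar1_haar:
  assumes "J \<in> dyadic" "K \<in> dyadic"
  shows "pairing (haar 1 K) (haar 0 J) = of_real (half_sign J K / sqrt (len J))"
  using pairing_haar_haar1[OF assms] by (subst pairing_cnj) simp

text \<open>The combinatorial core of orthonormality. If \<open>I\<close> and \<open>J\<close>
  differ, each half of \<open>I\<close> contains both halves of \<open>J\<close> or neither, so the
  signs agree; if they coincide, the signs are 1 and -1.\<close>

lemma half_sign_halves:
  assumes "I \<in> dyadic" "J \<in> dyadic"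
  shows "half_sign I (right_half J) - half_sign I (left_half J) = (if I = J then 2 else 0)"
proof (cases "I = J")
  case True
  have "\<not> right_half J \<subseteq> left_half J" "\<not> left_half J \<subseteq> right_half J"
    using halves_Int[of J] dyadic_nonempty[OF halves_dyadic(1)[OF assms(2)]]
      dyadic_nonempty[OF halves_dyadic(2)[OF assms(2)]] by auto
  then show ?thesis using True assms by (simp add: half_sign_def below_def)
next
  case False
  note nJ = dyadic_nonempty[OF halves_dyadic(1)[OF assms(2)]] dyadic_nonempty[OF halves_dyadic(2)[OF assms(2)]]
  have *: "right_half J \<subseteq> H \<longleftrightarrow> left_half J \<subseteq> H" if "H = right_half I \<or> H = left_half I" for H
  proof -
    have HI: "H \<subseteq> I" "H \<noteq> I" "H \<in> dyadic" using that halves_psubset[OF assms(1)] halves_dyadic[OF assms(1)] by auto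
    consider "J \<subset> I" | "I \<subset> J" | "I \<inter> J = {}"
      using dyadic_nested_or_disjoint[OF assms] False by blast
    then show ?thesis
    proof cases
      case 1
      then have "J \<subseteq> left_half I \<or> J \<subseteq> right_half I" using assms by (intro dyadic_psubset_half)
      then show ?thesis
        using that halves_subset[of J] halves_Int[of I] nJ by blast
    next
      case 2
      then have "I \<subseteq> left_half J \<or> I \<subseteq> right_half J" using assms by (intro dyadic_psubset_half)
      then have "\<not> right_half J \<subseteq> H \<and> \<not> left_half J \<subseteq> H"
        using HI halves_Int[of J] nJ by blast
      then show ?thesis by simp
    next
      case 3
      then have "\<not> right_half J \<subseteq> H \<and> \<not> left_half J \<subseteq> H"
        using HI halves_subset[of J] nJ by blast
      then show ?thesis by simp
    qed
  qed
  show ?thesis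
    using *[of "right_half I"] *[of "left_half I"] False assms
    by (simp add: half_sign_def below_def indicator_def)
qed

lemma pairing_haar_haar:
  assumes "I \<in> dyadic" "J \<in> dyadic"
  shows "pairing (haar 0 I) (haar 0 J) = (if I = J then 1 else 0)"
proof -
  let ?r = right_half and ?l = left_half
  note hI = halves_dyadic[OF assms(1)] and hJ = halves_dyadic[OF assms(2)]
  have "haar 0 I x * cnj (haar 0 J x) = complex_of_real
     (((indicator (?r I) x * indicator (?r J) x - indicator (?l I) x * indicator (?r J) x)
      - (indicator (?r I) x * indicator (?l J) x - indicator (?l I) x * indicator (?l J) x)) / (sqrt (len I) * sqrt (len J)))" for x
    by (simp add: haar_def field_simps)
  then have "pairing (haar 0 I) (haar 0 J) = complex_of_real
      (((len (?r I \<inter> ?r J) - len (?l I \<inter> ?r J)) - (len (?r I \<inter> ?l J) - len (?l I \<inter> ?l J))) / (sqrt (len I) * sqrt (len J)))"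
    unfolding pairing_def using hI hJ
    by (simp only: integral_complex_of_real) (simp add: integrable_indicator_Int)
  also have "(len (?r I \<inter> ?r J) - len (?l I \<inter> ?r J)) - (len (?r I \<inter> ?l J) - len (?l I \<inter> ?l J))
      = (half_sign I (?r J) - half_sign I (?l J)) * (len J / 2)"
    using assms hJ by (simp add: len_half_diff len_halves algebra_simps)
  also have "\<dots> = (if I = J then len J else 0)"
    unfolding half_sign_halves[OF assms] by simp
  finally show ?thesis using assms(2) by (auto simp flip: of_real_mult)
qed

lemma pairing_sum_haar:
  assumes "finite F" "F \<subseteq> dyadic" "J \<in> dyadic"
  shows "pairing (\<lambda>x. \<Sum>I\<in>F. c I * haar 0 I x) (haar 0 J) = (if J \<in> F then c J else 0)"
proof -
  have "pairing (\<lambda>x. \<Sum>I\<in>F. c I * haar 0 I x) (haar 0 J) = (\<Sum>I\<in>F. pairing (\<lambda>x. c I * haar 0 I x) (haar 0 J))"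
    using assms by (intro pairing_sum L1loc_mult L1loc_haar test_fun_haar) auto
  also have "\<dots> = (\<Sum>I\<in>F. if I = J then c I else 0)"
    using assms by (intro sum.cong refl) (simp add: pairing_mult pairing_haar_haar subset_iff)
  finally show ?thesis using assms(1) by simp
qed

section \<open>Haar expansions in \<open>L2\<close>\<close>

lemma L2_integrable: "f \<in> L2 \<Longrightarrow> integrable lborel (\<lambda>x. (cmod (f x))\<^sup>2)"
  by (simp add: L2_def)

lemma L2_measurable [measurable_dest]: "f \<in> L2 \<Longrightarrow> f \<in> borel_measurable lborel"
  by (simp add: L2_def)

lemma L2norm_nonneg: "0 \<le> L2norm f"
  by (simp add: L2norm_def)

lemma L2norm_square: "(L2norm f)\<^sup>2 = (LINT x|lborel. (cmod (f x))\<^sup>2)"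
  by (simp add: L2norm_def)

lemma L2norm_cong_AE:
  assumes "AE x in lborel. f x = g x" "f \<in> borel_measurable lborel" "g \<in> borel_measurable lborel"
  shows "L2norm f = L2norm g"
proof -
  have "(LINT x|lborel. (cmod (f x))\<^sup>2) = (LINT x|lborel. (cmod (g x))\<^sup>2)"
    using assms by (intro integral_cong_AE) auto
  then show ?thesis by (simp add: L2norm_def)
qed

lemma L2_L1loc:
  assumes "f \<in> L2"
  shows "f \<in> L1loc"
proof -
  have [measurable]: "f \<in> borel_measurable lborel" using assms by (rule L2_measurable)
  have "set_integrable lborel {a..b} f" for a b
    unfolding set_integrable_def
  proof (rule Bochner_Integration.integrable_bound)
    show "integrable lborel (\<lambda>x. indicator {a..b} x + (cmod (f x))\<^sup>2 :: real)"
      by (intro Bochner_Integration.integrable_add integrable_indicator_Icc L2_integrable assms)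
    show "AE x in lborel. norm (indicator {a..b} x *\<^sub>R f x) \<le> norm (indicator {a..b} x + (cmod (f x))\<^sup>2)"
    proof (rule AE_I2)
      fix x
      have "cmod (f x) \<le> 1 + (cmod (f x))\<^sup>2"
      proof (cases "cmod (f x) \<le> 1")
        case False
        then have "cmod (f x) * 1 \<le> cmod (f x) * cmod (f x)" by (intro mult_left_mono) auto
        then show ?thesis by (simp add: power2_eq_square)
      qed (simp add: add_increasing2)
      then show "norm (indicator {a..b} x *\<^sub>R f x) \<le> norm (indicator {a..b} x + (cmod (f x))\<^sup>2)"
        by (auto simp: indicator_def)
    qed
  qed simp
  then show ?thesis using assms by (simp add: L1loc_def L2_def)
qed

lemma L2_add:
  assumes "f \<in> L2" "g \<in> L2"
  shows "(\<lambda>x. f x + z * g x) \<in> L2"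
proof -
  have [measurable]: "f \<in> borel_measurable lborel" "g \<in> borel_measurable lborel"
    using assms by (auto dest: L2_measurable)
  have "integrable lborel (\<lambda>x. (cmod (f x + z * g x))\<^sup>2)"
  proof (rule Bochner_Integration.integrable_bound)
    show "integrable lborel (\<lambda>x. 2 * (cmod (f x))\<^sup>2 + 2 * ((cmod z)\<^sup>2 * (cmod (g x))\<^sup>2))"
      using L2_integrable[OF assms(1)] L2_integrable[OF assms(2)] by simp
    show "AE x in lborel. norm ((cmod (f x + z * g x))\<^sup>2) \<le> norm (2 * (cmod (f x))\<^sup>2 + 2 * ((cmod z)\<^sup>2 * (cmod (g x))\<^sup>2))"
    proof (rule AE_I2)
      fix x
      have "(cmod (f x + z * g x))\<^sup>2 \<le> (cmod (f x) + cmod z * cmod (g x))\<^sup>2"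
        using norm_triangle_ineq[of "f x" "z * g x"] by (intro power_mono) (auto simp: norm_mult)
      also have "\<dots> \<le> 2 * (cmod (f x))\<^sup>2 + 2 * ((cmod z)\<^sup>2 * (cmod (g x))\<^sup>2)"
        using zero_le_power2[of "cmod (f x) - cmod z * cmod (g x)"]
        by (simp add: power2_eq_square algebra_simps)
      finally show "norm ((cmod (f x + z * g x))\<^sup>2) \<le> norm (2 * (cmod (f x))\<^sup>2 + 2 * ((cmod z)\<^sup>2 * (cmod (g x))\<^sup>2))"
        by simp
    qed
  qed simp
  then show ?thesis by (simp add: L2_def)
qed

lemma L2_test_fun:
  assumes "test_fun \<phi>"
  shows "\<phi> \<in> L2"
proof -
  have [measurable]: "\<phi> \<in> borel_measurable lborel" using assms by (rule test_fun_measurable)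
  have "integrable lborel (\<lambda>x. norm (\<phi> x * cnj (\<phi> x)))"
    using pairing_integrable[OF L1loc_test_fun[OF assms] assms] by (rule integrable_norm)
  then have "integrable lborel (\<lambda>x. (cmod (\<phi> x))\<^sup>2)"
    by (simp add: norm_mult power2_eq_square)
  then show ?thesis by (simp add: L2_def)
qed

lemma test_fun_add:
  assumes "test_fun f" "test_fun g"
  shows "test_fun (\<lambda>x. f x + z * g x)"
proof -
  obtain a b B where B: "0 \<le> B" "\<And>x. cmod (f x) \<le> B * indicator {a..b} x"
    using test_fun_bound[OF assms(1)] by auto
  obtain a' b' B' where B': "0 \<le> B'" "\<And>x. cmod (g x) \<le> B' * indicator {a'..b'} x"
    using test_fun_bound[OF assms(2)] by auto
  have "cmod (f x + z * g x) \<le> B + cmod z * B'" for x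
  proof -
    have "cmod (f x) \<le> B" "cmod (g x) \<le> B'"
      using order_trans[OF B(2)[of x] mult_left_le[OF indicator_le_1 B(1)]]
        order_trans[OF B'(2)[of x] mult_left_le[OF indicator_le_1 B'(1)]] by auto
    then have "cmod (f x) + cmod z * cmod (g x) \<le> B + cmod z * B'"
      by (intro add_mono mult_left_mono) auto
    then show ?thesis using norm_triangle_ineq[of "f x" "z * g x"] by (simp add: norm_mult)
  qed
  moreover have "f x + z * g x = 0" if "x \<notin> {min a a'..max b b'}" for x
  proof -
    have "x \<notin> {a..b}" "x \<notin> {a'..b'}" using that by auto
    then show ?thesis using B(2)[of x] B'(2)[of x] by simp
  qed
  moreover have "(\<lambda>x. f x + z * g x) \<in> borel_measurable lborel"
    using assms[THEN test_fun_measurable] by (intro borel_measurable_add borel_measurable_times) auto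
  ultimately show ?thesis unfolding test_fun_def by blast
qed

lemma test_fun_zero: "test_fun (\<lambda>x. 0)"
  by (auto simp: test_fun_def)

lemma test_fun_sum_haar:
  assumes "F \<subseteq> dyadic"
  shows "test_fun (\<lambda>x. \<Sum>I\<in>F. c I * haar 0 I x)"
proof (cases "finite F")
  case True
  then show ?thesis
    using assms
  proof (induction F)
    case (insert I F)
    then show ?case
      using test_fun_add[of "\<lambda>x. \<Sum>I\<in>F. c I * haar 0 I x" "haar 0 I" "c I"] test_fun_haar[of I 0]
      by (simp add: add.commute)
  qed (simp add: test_fun_zero)
qed (simp add: test_fun_zero)

lemma L2norm_sum_haar:
  assumes "finite F" "F \<subseteq> dyadic"
  shows "(L2norm (\<lambda>x. \<Sum>I\<in>F. c I * haar 0 I x))\<^sup>2 = (\<Sum>I\<in>F. (cmod (c I))\<^sup>2)"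
proof -
  let ?s = "\<lambda>x. \<Sum>I\<in>F. c I * haar 0 I x"
  have s: "test_fun ?s" using assms(2) by (rule test_fun_sum_haar)
  have "complex_of_real ((L2norm ?s)\<^sup>2) = pairing ?s ?s"
    unfolding L2norm_square pairing_def by (simp only: complex_norm_square flip: integral_complex_of_real)
  also have "\<dots> = (\<Sum>I\<in>F. pairing (\<lambda>x. c I * haar 0 I x) ?s)"
    using assms s by (intro pairing_sum L1loc_mult L1loc_haar) auto
  also have "\<dots> = (\<Sum>I\<in>F. c I * cnj (pairing ?s (haar 0 I)))"
    by (simp add: pairing_mult flip: pairing_cnj)
  also have "\<dots> = (\<Sum>I\<in>F. c I * cnj (c I))"
    using assms pairing_sum_haar[OF assms] by (intro sum.cong) auto
  also have "\<dots> = complex_of_real (\<Sum>I\<in>F. (cmod (c I))\<^sup>2)"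
    by (simp only: of_real_sum complex_norm_square)
  finally show ?thesis by (simp only: of_real_eq_iff)
qed

lemma cmod_diff_square: "(cmod (x - y))\<^sup>2 = (cmod x)\<^sup>2 - 2 * Re (x * cnj y) + (cmod y)\<^sup>2"
  unfolding cmod_power2 by (simp add: power2_eq_square algebra_simps)

lemma Bessel_haar:
  assumes g: "g \<in> L2" and F: "finite F" "F \<subseteq> dyadic"
  shows "(\<Sum>I\<in>F. (cmod (pairing g (haar 0 I)))\<^sup>2) \<le> (L2norm g)\<^sup>2"
proof -
  define c where "c I = pairing g (haar 0 I)" for I
  let ?s = "\<lambda>x. \<Sum>I\<in>F. c I * haar 0 I x"
  have s: "test_fun ?s" using F(2) by (rule test_fun_sum_haar)
  have int: "integrable lborel (\<lambda>x. g x * cnj (?s x))"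
    by (rule pairing_integrable[OF L2_L1loc[OF g] s])
  have s2: "integrable lborel (\<lambda>x. (cmod (?s x))\<^sup>2)"
    by (rule L2_integrable[OF L2_test_fun[OF s]])
  have re: "(LINT x|lborel. Re (g x * cnj (?s x))) = (\<Sum>I\<in>F. (cmod (c I))\<^sup>2)"
  proof -
    have "g x * cnj (?s x) = (\<Sum>I\<in>F. cnj (c I) * (g x * cnj (haar 0 I x)))" for x
      by (simp add: sum_distrib_left mult_ac)
    then have "pairing g ?s = (\<Sum>I\<in>F. cnj (c I) * pairing g (haar 0 I))"
      unfolding pairing_def using F pairing_integrable[OF L2_L1loc[OF g] test_fun_haar]
      by (simp only:) (subst Bochner_Integration.integral_sum, auto)
    also have "\<dots> = of_real (\<Sum>I\<in>F. (cmod (c I))\<^sup>2)"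
      by (simp only: of_real_sum complex_norm_square c_def mult.commute)
    finally have "pairing g ?s = of_real (\<Sum>I\<in>F. (cmod (c I))\<^sup>2)" .
    moreover have "(LINT x|lborel. Re (g x * cnj (?s x))) = Re (pairing g ?s)"
      unfolding pairing_def using int by (rule integral_Re)
    ultimately show ?thesis by simp
  qed
  have lin: "(LINT x|lborel. p x - 2 * q x + r x) = (LINT x|lborel. p x) - 2 * (LINT x|lborel. q x) + (LINT x|lborel. r x)"
    if "integrable lborel p" "integrable lborel q" "integrable lborel r" for p q r :: "real \<Rightarrow> real"
    using that by simp
  have "0 \<le> (LINT x|lborel. (cmod (g x - ?s x))\<^sup>2)" by simp
  also have "\<dots> = (LINT x|lborel. (cmod (g x))\<^sup>2 - 2 * Re (g x * cnj (?s x)) + (cmod (?s x))\<^sup>2)"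
    by (intro Bochner_Integration.integral_cong refl cmod_diff_square)
  also have "\<dots> = (L2norm g)\<^sup>2 - 2 * (\<Sum>I\<in>F. (cmod (c I))\<^sup>2) + (L2norm ?s)\<^sup>2"
    unfolding L2norm_square re[symmetric] by (rule lin[OF L2_integrable[OF g] integrable_Re[OF int] s2])
  also have "\<dots> = (L2norm g)\<^sup>2 - (\<Sum>I\<in>F. (cmod (c I))\<^sup>2)"
    unfolding L2norm_sum_haar[OF F] by simp
  finally show ?thesis by (simp add: c_def)
qed

text \<open>Cauchy-Schwarz on a bounded interval in additive form, from
  \<open>2 * t \<le> e + t^2 / e\<close>; the free parameter \<open>e\<close> is chosen where the
  bound is applied.\<close>

lemma local_norm_le_L2:
  assumes "f \<in> L2" "0 < e" "a \<le> b"
  shows "2 * local_norm a b f \<le> e * (b - a) + (L2norm f)\<^sup>2 / e"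
proof -
  have "2 * local_norm a b f = (LINT x|lborel. 2 * (indicator {a..b} x *\<^sub>R cmod (f x)))"
    by (simp add: set_lebesgue_integral_def)
  also have "\<dots> \<le> (LINT x|lborel. e * indicator {a..b} x + (cmod (f x))\<^sup>2 / e)"
  proof (rule integral_mono)
    show "integrable lborel (\<lambda>x. 2 * (indicator {a..b} x *\<^sub>R cmod (f x)))"
      using L1loc_integrable_cmod[OF L2_L1loc[OF assms(1)], of a b] by (simp add: set_integrable_def)
    show "integrable lborel (\<lambda>x. e * indicator {a..b} x + (cmod (f x))\<^sup>2 / e)"
      by (intro Bochner_Integration.integrable_add Bochner_Integration.integrable_mult_right
          Bochner_Integration.integrable_divide integrable_indicator_Icc L2_integrable assms(1))
    fix x
    have "2 * cmod (f x) \<le> e + (cmod (f x))\<^sup>2 / e"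
      using assms(2) zero_le_power2[of "cmod (f x) - e"] by (simp add: field_simps power2_eq_square)
    then show "2 * (indicator {a..b} x *\<^sub>R cmod (f x)) \<le> e * indicator {a..b} x + (cmod (f x))\<^sup>2 / e"
      using assms(2) by (auto simp: indicator_def)
  qed
  also have "\<dots> = e * (b - a) + (L2norm f)\<^sup>2 / e"
    unfolding L2norm_square using L2_integrable[OF assms(1)] assms(3) integrable_indicator_Icc[of a b]
    by simp
  finally show ?thesis .
qed

lemma L1loc_Cauchy_haar:
  assumes "A \<subseteq> dyadic" "(\<lambda>I. (cmod (t I))\<^sup>2) summable_on A"
  shows "L1loc_Cauchy (\<lambda>I x. t I * haar 0 I x) A"
  unfolding L1loc_Cauchy_def
proof (intro conjI ballI allI impI)
  show "(\<lambda>x. t I * haar 0 I x) \<in> L1loc" if "I \<in> A" for I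
    using assms(1) that by (intro L1loc_mult L1loc_haar) auto
  fix a b e :: real assume e: "0 < e"
  \<comment> \<open>Chosen so that, once the tail sums are at most \<open>D * e\<close>, both terms
    of \<open>local_norm_le_L2\<close> with parameter \<open>D\<close> are at most \<open>e\<close>;
    the summand 1 keeps the denominator positive when \<open>a = b\<close>.\<close>
  define D where "D = e / (\<bar>b - a\<bar> + 1)"
  have D: "0 < D" "D * \<bar>b - a\<bar> \<le> e" using e by (auto simp: D_def field_simps)
  obtain F0 where F0: "finite F0" "F0 \<subseteq> A"
      "\<And>F. finite F \<Longrightarrow> F \<subseteq> A \<Longrightarrow> F \<inter> F0 = {} \<Longrightarrow> (\<Sum>I\<in>F. (cmod (t I))\<^sup>2) \<le> D * e"
    by (rule small_tail_sums[OF assms(2), of "D * e"]) (use e D(1) in \<open>simp_all\<close>)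
  show "\<exists>F0. finite F0 \<and> F0 \<subseteq> A \<and> (\<forall>F. finite F \<and> F \<subseteq> A \<and> F \<inter> F0 = {} \<longrightarrow>
      local_norm a b (\<lambda>x. \<Sum>I\<in>F. t I * haar 0 I x) \<le> e)"
  proof (intro exI[of _ F0] conjI allI impI F0(1,2))
    fix F assume F: "finite F \<and> F \<subseteq> A \<and> F \<inter> F0 = {}"
    let ?s = "\<lambda>x. \<Sum>I\<in>F. t I * haar 0 I x"
    have Fd: "F \<subseteq> dyadic" using F assms(1) by auto
    show "local_norm a b ?s \<le> e"
    proof (cases "a \<le> b")
      case True
      have "2 * local_norm a b ?s \<le> D * (b - a) + (L2norm ?s)\<^sup>2 / D"
        using True D(1) Fd by (intro local_norm_le_L2 L2_test_fun test_fun_sum_haar)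
      also have "\<dots> \<le> e + e"
      proof (rule add_mono)
        show "D * (b - a) \<le> e" using D(2) True by simp
        have "(L2norm ?s)\<^sup>2 \<le> D * e"
          using F0(3)[of F] F Fd by (subst L2norm_sum_haar) auto
        then show "(L2norm ?s)\<^sup>2 / D \<le> e" using D(1) by (simp add: pos_divide_le_eq mult.commute)
      qed
      finally show ?thesis by simp
    next
      case False
      then show ?thesis using e by (simp add: set_lebesgue_integral_def)
    qed
  qed
qed

text \<open>Termwise pairing and orthonormality give the coefficients although \<open>g\<close> is
  only a limit in local mean. This is how the image under a paraproduct is identified without
  knowing that it lies in \<open>L2\<close>.\<close>

lemma haar_series_coeff:
  assumes "series_sum (\<lambda>I x. t I * haar 0 I x) A g" "A \<subseteq> dyadic" "J \<in> dyadic"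
  shows "pairing g (haar 0 J) = (if J \<in> A then t J else 0)"
proof -
  have "((\<lambda>I. pairing (\<lambda>x. t I * haar 0 I x) (haar 0 J)) has_sum pairing g (haar 0 J)) A"
    by (rule series_sum_pairing[OF assms(1) test_fun_haar[OF assms(3)]])
  moreover have "((\<lambda>I. pairing (\<lambda>x. t I * haar 0 I x) (haar 0 J)) has_sum (if J \<in> A then t J else 0)) A"
  proof (rule has_sum_cong_neutral[THEN iffD1])
    show "((\<lambda>I. t I) has_sum (if J \<in> A then t J else 0)) (A \<inter> {J})"
      using has_sum_finite[of "A \<inter> {J}" t] by (cases "J \<in> A") auto
  qed (use assms in \<open>auto simp: pairing_mult pairing_haar_haar split: if_splits\<close>)
  ultimately show ?thesis by (rule has_sum_unique)
qed

text \<open>The sum exists in local mean by \<open>L1loc_Cauchy_haar\<close>. Fatou along its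
  approximating sequence bounds the norm from above by the square sum, and Bessel gives the reverse
  inequality.\<close>

lemma Riesz_Fischer_haar:
  assumes "A \<subseteq> dyadic" "(\<lambda>I. (cmod (t I))\<^sup>2) summable_on A"
  obtains g where "g \<in> L2" "series_sum (\<lambda>I x. t I * haar 0 I x) A g"
    "L2norm g = sqrt (\<Sum>\<^sub>\<infinity>I\<in>A. (cmod (t I))\<^sup>2)"
proof -
  let ?m = "\<Sum>\<^sub>\<infinity>I\<in>A. (cmod (t I))\<^sup>2"
  have m0: "0 \<le> ?m" by (intro infsum_nonneg) simp
  obtain g F where g: "series_sum (\<lambda>I x. t I * haar 0 I x) A g" and F: "\<And>n. finite (F n)" "\<And>n. F n \<subseteq> A"
    and lim: "AE x in lborel. (\<lambda>n::nat. \<Sum>I\<in>F n. t I * haar 0 I x) \<longlonglongrightarrow> g x"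
    using L1loc_Cauchy_sum[OF L1loc_Cauchy_haar[OF assms]] by blast
  have Fd: "F n \<subseteq> dyadic" for n using F(2)[of n] assms(1) by auto
  have gL: "g \<in> L1loc" using g by (simp add: series_sum_def)
  then have [measurable]: "g \<in> borel_measurable lborel" by (rule L1loc_measurable)
  let ?s = "\<lambda>n x. (cmod (\<Sum>I\<in>F n. t I * haar 0 I x))\<^sup>2"
  have 1: "integrable lborel (?s n)" for n
    by (rule L2_integrable[OF L2_test_fun[OF test_fun_sum_haar[OF Fd]]])
  have 2: "AE x in lborel. (\<lambda>n. ?s n x) \<longlonglongrightarrow> (cmod (g x))\<^sup>2"
    using lim by eventually_elim (intro tendsto_intros)
  have 3: "\<forall>\<^sub>F n in sequentially. (LINT x|lborel. ?s n x) \<le> ?m"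
    unfolding L2norm_square[symmetric] L2norm_sum_haar[OF F(1) Fd]
    using F assms(2) by (intro always_eventually allI finite_sum_le_infsum) auto
  have "integrable lborel (\<lambda>x. (cmod (g x))\<^sup>2)" "(LINT x|lborel. (cmod (g x))\<^sup>2) \<le> ?m"
    by (rule Fatou_bound[OF 1 _ _ _ 2 3 m0]; simp)+
  then have gL2: "g \<in> L2" and le: "(L2norm g)\<^sup>2 \<le> ?m"
    by (auto simp: L2_def L2norm_square)
  have "?m \<le> (L2norm g)\<^sup>2"
  proof (rule infsum_le_finite_sums[OF assms(2)])
    fix H assume H: "finite H" "H \<subseteq> A"
    have "(\<Sum>I\<in>H. (cmod (t I))\<^sup>2) = (\<Sum>I\<in>H. (cmod (pairing g (haar 0 I)))\<^sup>2)"
    proof (rule sum.cong[OF refl])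
      fix I assume "I \<in> H"
      then have "I \<in> A" "I \<in> dyadic" using H(2) assms(1) by auto
      then show "(cmod (t I))\<^sup>2 = (cmod (pairing g (haar 0 I)))\<^sup>2"
        by (simp add: haar_series_coeff[OF g assms(1)])
    qed
    also have "\<dots> \<le> (L2norm g)\<^sup>2"
      using H assms(1) by (intro Bessel_haar gL2) auto
    finally show "(\<Sum>I\<in>H. (cmod (t I))\<^sup>2) \<le> (L2norm g)\<^sup>2" .
  qed
  with le have "(L2norm g)\<^sup>2 = ?m" by simp
  then have "L2norm g = sqrt ?m"
    using L2norm_nonneg[of g] by (metis real_sqrt_abs abs_of_nonneg)
  with gL2 g show thesis by (rule that)
qed

text \<open>The converse of \<open>Riesz_Fischer_haar\<close>: Bessel gives summability, and the
  norm is read off from the sum constructed there, which agrees with \<open>g\<close> almost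
  everywhere.\<close>

lemma haar_series_Parseval:
  assumes "series_sum (\<lambda>I x. t I * haar 0 I x) A g" "A \<subseteq> dyadic" "g \<in> L2"
  shows "(\<lambda>I. (cmod (t I))\<^sup>2) summable_on A" "L2norm g = sqrt (\<Sum>\<^sub>\<infinity>I\<in>A. (cmod (t I))\<^sup>2)"
proof -
  have "(\<Sum>I\<in>H. (cmod (t I))\<^sup>2) \<le> (L2norm g)\<^sup>2" if H: "finite H" "H \<subseteq> A" for H
  proof -
    have "(\<Sum>I\<in>H. (cmod (t I))\<^sup>2) = (\<Sum>I\<in>H. (cmod (pairing g (haar 0 I)))\<^sup>2)"
    proof (rule sum.cong[OF refl])
      fix I assume "I \<in> H"
      then have "I \<in> A" "I \<in> dyadic" using H(2) assms(2) by auto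
      then show "(cmod (t I))\<^sup>2 = (cmod (pairing g (haar 0 I)))\<^sup>2"
        by (simp add: haar_series_coeff[OF assms(1,2)])
    qed
    also have "\<dots> \<le> (L2norm g)\<^sup>2"
      using H assms(2) by (intro Bessel_haar assms(3)) auto
    finally show ?thesis .
  qed
  then show sm: "(\<lambda>I. (cmod (t I))\<^sup>2) summable_on A"
    by (intro summable_on_of_bounded_sums) auto
  obtain g' where g': "g' \<in> L2" "series_sum (\<lambda>I x. t I * haar 0 I x) A g'"
    "L2norm g' = sqrt (\<Sum>\<^sub>\<infinity>I\<in>A. (cmod (t I))\<^sup>2)"
    using Riesz_Fischer_haar[OF assms(2) sm] by blast
  have "L2norm g = L2norm g'"
    using series_sum_unique[OF assms(1) g'(2)] assms(3) g'(1)
    by (intro L2norm_cong_AE) (auto dest: L2_measurable)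
  with g'(3) show "L2norm g = sqrt (\<Sum>\<^sub>\<infinity>I\<in>A. (cmod (t I))\<^sup>2)" by simp
qed

section \<open>Paraproducts and the testing conditions\<close>

lemma paraproduct00_coeff:
  assumes "paraproduct d 0 0 f h" "J \<in> dyadic"
  shows "pairing h (haar 0 J) = d J * pairing f (haar 0 J)"
  using haar_series_coeff[of "\<lambda>I. d I * pairing f (haar 0 I)" dyadic h J] assms
  by (simp add: paraproduct_def)

lemma kern_apply:
  assumes "J \<in> dyadic" "K \<in> dyadic"
  shows "kern b d K J = b K * (d J * pairing (haar 0 J) (haar 1 K))"
  using assms by (simp add: kern_def pairing_haar_haar1)

lemma kern_eq_0: "K \<notin> dyadic \<Longrightarrow> kern b d K J = 0"
  by (simp add: kern_def half_sign_def below_def)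

lemma haar_spanE:
  assumes "f \<in> haar_span"
  obtains F c where "finite F" "F \<subseteq> dyadic" "f = (\<lambda>x. \<Sum>I\<in>F. c I * haar 0 I x)"
  using assms unfolding haar_span_def by blast

text \<open>Pairing the inner series with \<open>haar 1 K\<close> and the outer one with
  \<open>haar 0 K\<close> forces the coefficients, whichever representatives \<open>h\<close> and
  \<open>g\<close> the relations select.\<close>

lemma para_comp_coeff:
  assumes F: "finite F" "F \<subseteq> dyadic" and comp: "para_comp b d (\<lambda>x. \<Sum>J\<in>F. c J * haar 0 J x) g"
    and K: "K \<in> dyadic"
  shows "pairing g (haar 0 K) = (\<Sum>J\<in>F. kern b d K J * c J)"
proof -
  let ?f = "\<lambda>x. \<Sum>J\<in>F. c J * haar 0 J x"
  obtain h where h: "paraproduct d 0 0 ?f h" "paraproduct b 0 1 h g"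
    using comp unfolding para_comp_def by blast
  have "((\<lambda>J. pairing (\<lambda>x. d J * pairing ?f (haar 0 J) * haar 0 J x) (haar 1 K)) has_sum pairing h (haar 1 K)) dyadic"
    using h(1) K unfolding paraproduct_def by (intro series_sum_pairing test_fun_haar) auto
  moreover have "((\<lambda>J. pairing (\<lambda>x. d J * pairing ?f (haar 0 J) * haar 0 J x) (haar 1 K)) has_sum
      (\<Sum>J\<in>F. d J * c J * pairing (haar 0 J) (haar 1 K))) dyadic"
    using F pairing_sum_haar[OF F, of _ c]
    by (intro has_sum_finite_neutralI[OF F]) (auto simp: pairing_mult subset_iff intro!: sum.cong)
  ultimately have h1: "pairing h (haar 1 K) = (\<Sum>J\<in>F. d J * c J * pairing (haar 0 J) (haar 1 K))"
    by (rule has_sum_unique)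
  have "pairing g (haar 0 K) = b K * pairing h (haar 1 K)"
    using haar_series_coeff[of "\<lambda>I. b I * pairing h (haar 1 I)" dyadic g K] h(2) K
    by (simp add: paraproduct_def)
  also have "\<dots> = (\<Sum>J\<in>F. kern b d K J * c J)"
    unfolding h1 sum_distrib_left
    using F K by (intro sum.cong refl) (simp add: kern_apply subset_iff mult_ac)
  finally show ?thesis .
qed

lemma finite_bound_of_L2_bounded_by:
  assumes "L2_bounded_by (para_comp b d) C"
  shows "finite_bound b d C"
  unfolding finite_bound_def
proof (intro allI impI, elim conjE)
  fix F S :: "real set set" and c :: "real set \<Rightarrow> complex"
  assume F: "finite F" "F \<subseteq> dyadic" and S: "finite S" "S \<subseteq> dyadic"
  obtain T where C: "0 \<le> C" and T: "\<And>f. f \<in> L2 \<Longrightarrow> T f \<in> L2" "\<And>f. f \<in> L2 \<Longrightarrow> L2norm (T f) \<le> C * L2norm f"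
      "\<And>f. f \<in> haar_span \<Longrightarrow> para_comp b d f (T f)"
    using assms unfolding L2_bounded_by_def by blast
  let ?f = "\<lambda>x. \<Sum>J\<in>F. c J * haar 0 J x"
  have fL: "?f \<in> L2" using F(2) by (intro L2_test_fun test_fun_sum_haar)
  have "?f \<in> haar_span" unfolding haar_span_def using F by blast
  then have comp: "para_comp b d ?f (T ?f)" by (rule T(3))
  have "(\<Sum>K\<in>S. (cmod (\<Sum>J\<in>F. kern b d K J * c J))\<^sup>2) = (\<Sum>K\<in>S. (cmod (pairing (T ?f) (haar 0 K)))\<^sup>2)"
  proof (rule sum.cong[OF refl])
    fix K assume "K \<in> S"
    then have "K \<in> dyadic" using S by auto
    from para_comp_coeff[OF F comp this]
    show "(cmod (\<Sum>J\<in>F. kern b d K J * c J))\<^sup>2 = (cmod (pairing (T ?f) (haar 0 K)))\<^sup>2" by simp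
  qed
  also have "\<dots> \<le> (L2norm (T ?f))\<^sup>2"
    using S T(1)[OF fL] by (intro Bessel_haar)
  also have "\<dots> \<le> (C * L2norm ?f)\<^sup>2"
    using T(2)[OF fL] by (intro power_mono L2norm_nonneg)
  also have "\<dots> = C\<^sup>2 * (\<Sum>J\<in>F. (cmod (c J))\<^sup>2)"
    unfolding power_mult_distrib L2norm_sum_haar[OF F] ..
  finally show "(\<Sum>K\<in>S. (cmod (\<Sum>J\<in>F. kern b d K J * c J))\<^sup>2) \<le> C\<^sup>2 * (\<Sum>J\<in>F. (cmod (c J))\<^sup>2)" .
qed

section \<open>Extension of the bounded matrix to an operator on \<open>L2\<close>\<close>

lemma kern_row_summable:
  assumes "finite_bound b d C" "K \<in> dyadic"
  shows "(\<lambda>J. (cmod (kern b d K J))\<^sup>2) summable_on dyadic"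
proof (rule summable_on_of_bounded_sums)
  fix F :: "real set set" assume F: "finite F" "F \<subseteq> dyadic"
  define X where "X = (\<Sum>J\<in>F. (cmod (kern b d K J))\<^sup>2)"
  have X0: "0 \<le> X" unfolding X_def by (intro sum_nonneg) simp
  \<comment> \<open>The section with the single row \<open>K\<close> is tested on the conjugate of
    that row, which gives \<open>X^2 \<le> C^2 * X\<close>.\<close>
  have bound: "(cmod (\<Sum>J\<in>F. kern b d K J * cnj (kern b d K J)))\<^sup>2 \<le> C\<^sup>2 * X"
    using assms(1)[unfolded finite_bound_def, rule_format, of F "{K}" "\<lambda>J. cnj (kern b d K J)"] F assms(2)
    by (simp add: X_def)
  have "(\<Sum>J\<in>F. kern b d K J * cnj (kern b d K J)) = complex_of_real X"
    unfolding X_def by (simp only: of_real_sum complex_norm_square)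
  with bound have "X * X \<le> C\<^sup>2 * X" by (simp add: power2_eq_square)
  then show "(\<Sum>J\<in>F. (cmod (kern b d K J))\<^sup>2) \<le> C\<^sup>2"
    unfolding X_def[symmetric] using X0 by (cases "X = 0") (auto simp: mult_le_cancel_right)
qed simp

lemma haar_coeffs_summable:
  assumes "f \<in> L2"
  shows "(\<lambda>J. (cmod (pairing f (haar 0 J)))\<^sup>2) summable_on dyadic"
  using Bessel_haar[OF assms] by (intro summable_on_of_bounded_sums) auto

lemma kern_sum_summable:
  assumes "finite_bound b d C" "f \<in> L2"
  shows "(\<lambda>J. kern b d K J * pairing f (haar 0 J)) summable_on dyadic"
proof (cases "K \<in> dyadic")
  case True
  show ?thesis
  proof (rule abs_summable_summable, rule summable_on_comparison_test)
    show "(\<lambda>J. (cmod (kern b d K J))\<^sup>2 + (cmod (pairing f (haar 0 J)))\<^sup>2) summable_on dyadic"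
      by (intro summable_on_add kern_row_summable[OF assms(1) True] haar_coeffs_summable assms(2))
    fix J
    show "norm (kern b d K J * pairing f (haar 0 J)) \<le> (cmod (kern b d K J))\<^sup>2 + (cmod (pairing f (haar 0 J)))\<^sup>2"
      unfolding norm_mult
      using sum_squares_bound[of "cmod (kern b d K J)" "cmod (pairing f (haar 0 J))"]
        mult_nonneg_nonneg[OF norm_ge_zero norm_ge_zero, of "kern b d K J" "pairing f (haar 0 J)"]
      by linarith
  qed simp
qed (simp add: kern_eq_0)

text \<open>The matrix applied to the Haar coefficients of \<open>f\<close>. The extension is built
  from these numbers because the inner series need not converge for every \<open>f\<close> in
  \<open>L2\<close>.\<close>

definition comp_coeff :: "(real set \<Rightarrow> complex) \<Rightarrow> (real set \<Rightarrow> complex) \<Rightarrow> (real \<Rightarrow> complex) \<Rightarrow> real set \<Rightarrow> complex" where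
  "comp_coeff b d f K = (\<Sum>\<^sub>\<infinity>J\<in>dyadic. kern b d K J * pairing f (haar 0 J))"

lemma comp_coeff_bound:
  assumes fb: "finite_bound b d C" and f: "f \<in> L2" and S: "finite S" "S \<subseteq> dyadic"
  shows "(\<Sum>K\<in>S. (cmod (comp_coeff b d f K))\<^sup>2) \<le> C\<^sup>2 * (L2norm f)\<^sup>2"
proof (rule tendsto_upperbound)
  have "((\<lambda>J. kern b d K J * pairing f (haar 0 J)) has_sum comp_coeff b d f K) dyadic" for K
    unfolding comp_coeff_def by (rule has_sum_infsum[OF kern_sum_summable[OF fb f]])
  then show "((\<lambda>F. \<Sum>K\<in>S. (cmod (\<Sum>J\<in>F. kern b d K J * pairing f (haar 0 J)))\<^sup>2) \<longlongrightarrow>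
      (\<Sum>K\<in>S. (cmod (comp_coeff b d f K))\<^sup>2)) (finite_subsets_at_top dyadic)"
    unfolding has_sum_def by (intro tendsto_intros)
  show "\<forall>\<^sub>F F in finite_subsets_at_top dyadic.
      (\<Sum>K\<in>S. (cmod (\<Sum>J\<in>F. kern b d K J * pairing f (haar 0 J)))\<^sup>2) \<le> C\<^sup>2 * (L2norm f)\<^sup>2"
  proof (rule eventually_finite_subsets_at_top_weakI)
    fix F :: "real set set" assume F: "finite F" "F \<subseteq> dyadic"
    have "(\<Sum>K\<in>S. (cmod (\<Sum>J\<in>F. kern b d K J * pairing f (haar 0 J)))\<^sup>2)
        \<le> C\<^sup>2 * (\<Sum>J\<in>F. (cmod (pairing f (haar 0 J)))\<^sup>2)"
      using fb[unfolded finite_bound_def, rule_format, of F S "\<lambda>J. pairing f (haar 0 J)"] F S by simp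
    also have "\<dots> \<le> C\<^sup>2 * (L2norm f)\<^sup>2"
      using F by (intro mult_left_mono Bessel_haar f) auto
    finally show "(\<Sum>K\<in>S. (cmod (\<Sum>J\<in>F. kern b d K J * pairing f (haar 0 J)))\<^sup>2) \<le> C\<^sup>2 * (L2norm f)\<^sup>2" .
  qed
qed simp

lemma comp_coeff_linear:
  assumes fb: "finite_bound b d C" and f: "f \<in> L2" "g \<in> L2"
  shows "comp_coeff b d (\<lambda>x. f x + z * g x) K = comp_coeff b d f K + z * comp_coeff b d g K"
proof -
  note s = has_sum_infsum[OF kern_sum_summable[OF fb f(1), of K]] has_sum_infsum[OF kern_sum_summable[OF fb f(2), of K]]
  have "((\<lambda>J. kern b d K J * pairing f (haar 0 J) + z * (kern b d K J * pairing g (haar 0 J)))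
      has_sum (comp_coeff b d f K + z * comp_coeff b d g K)) dyadic"
    unfolding comp_coeff_def by (intro has_sum_add has_sum_cmult_right s)
  moreover have "comp_coeff b d (\<lambda>x. f x + z * g x) K =
      (\<Sum>\<^sub>\<infinity>J\<in>dyadic. kern b d K J * pairing f (haar 0 J) + z * (kern b d K J * pairing g (haar 0 J)))"
    unfolding comp_coeff_def using f
    by (intro infsum_cong) (simp add: pairing_add L2_L1loc test_fun_haar algebra_simps)
  ultimately show ?thesis by (simp add: infsumI)
qed

lemma series_sum_cong:
  assumes "\<And>i. i \<in> A \<Longrightarrow> u i = v i" "series_sum u A g"
  shows "series_sum v A g"
  unfolding series_sum_def
proof (intro conjI allI ballI)
  show "v i \<in> L1loc" if "i \<in> A" for i
    using assms that by (auto simp: series_sum_def)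
  show "g \<in> L1loc" using assms(2) by (simp add: series_sum_def)
  fix a b
  have "((\<lambda>F. local_norm a b (\<lambda>x. (\<Sum>i\<in>F. u i x) - g x)) \<longlongrightarrow> 0) (finite_subsets_at_top A)"
    using assms(2) by (simp add: series_sum_def)
  then show "((\<lambda>F. local_norm a b (\<lambda>x. (\<Sum>i\<in>F. v i x) - g x)) \<longlongrightarrow> 0) (finite_subsets_at_top A)"
  proof (rule Lim_transform_eventually)
    show "\<forall>\<^sub>F F in finite_subsets_at_top A.
      local_norm a b (\<lambda>x. (\<Sum>i\<in>F. u i x) - g x) = local_norm a b (\<lambda>x. (\<Sum>i\<in>F. v i x) - g x)"
    proof (rule eventually_finite_subsets_at_top_weakI)
      fix F assume "finite F" "F \<subseteq> A"
      then have "(\<Sum>i\<in>F. u i x) = (\<Sum>i\<in>F. v i x)" for x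
        using assms(1) by (intro sum.cong) auto
      then show "local_norm a b (\<lambda>x. (\<Sum>i\<in>F. u i x) - g x) = local_norm a b (\<lambda>x. (\<Sum>i\<in>F. v i x) - g x)" by simp
    qed
  qed
qed

lemma series_sum_finite:
  assumes "\<And>i. i \<in> A \<Longrightarrow> u i \<in> L1loc" "finite F" "F \<subseteq> A" "\<And>i x. i \<in> A - F \<Longrightarrow> u i x = 0"
  shows "series_sum u A (\<lambda>x. \<Sum>i\<in>F. u i x)"
  unfolding series_sum_def
proof (intro conjI allI ballI)
  show "u i \<in> L1loc" if "i \<in> A" for i using assms(1) that .
  show "(\<lambda>x. \<Sum>i\<in>F. u i x) \<in> L1loc" using assms by (intro L1loc_sum) auto
  fix a b
  show "((\<lambda>H. local_norm a b (\<lambda>x. (\<Sum>i\<in>H. u i x) - (\<Sum>i\<in>F. u i x))) \<longlongrightarrow> 0) (finite_subsets_at_top A)"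
  proof (rule tendsto_eventually)
    show "\<forall>\<^sub>F H in finite_subsets_at_top A. local_norm a b (\<lambda>x. (\<Sum>i\<in>H. u i x) - (\<Sum>i\<in>F. u i x)) = 0"
      unfolding eventually_finite_subsets_at_top
    proof (intro exI[of _ F] conjI allI impI assms(2,3))
      fix H assume H: "finite H \<and> F \<subseteq> H \<and> H \<subseteq> A"
      have "(\<Sum>i\<in>H. u i x) = (\<Sum>i\<in>F. u i x)" for x
        using H assms(4) by (intro sum.mono_neutral_right) auto
      then show "local_norm a b (\<lambda>x. (\<Sum>i\<in>H. u i x) - (\<Sum>i\<in>F. u i x)) = 0"
        by (simp add: set_lebesgue_integral_def)
    qed
  qed
qed

text \<open>The inner image of a finite Haar sum is again a finite Haar sum, so the intermediate
  function is explicit and convergence is at issue for the outer series alone.\<close>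

lemma para_comp_haar_sum:
  assumes F: "finite F" "F \<subseteq> dyadic"
    and g: "series_sum (\<lambda>K x. (\<Sum>J\<in>F. kern b d K J * c J) * haar 0 K x) dyadic g"
  shows "para_comp b d (\<lambda>x. \<Sum>J\<in>F. c J * haar 0 J x) g"
proof -
  let ?f = "\<lambda>x. \<Sum>J\<in>F. c J * haar 0 J x"
  let ?h = "\<lambda>x. \<Sum>J\<in>F. d J * pairing ?f (haar 0 J) * haar 0 J x"
  have pf: "pairing ?f (haar 0 J) = (if J \<in> F then c J else 0)" if "J \<in> dyadic" for J
    by (rule pairing_sum_haar[OF F that])
  have "series_sum (\<lambda>J x. d J * pairing ?f (haar 0 J) * haar 0 J x) dyadic ?h"
    using F by (intro series_sum_finite L1loc_mult L1loc_haar) (auto simp: pf)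
  then have h: "paraproduct d 0 0 ?f ?h"
    unfolding paraproduct_def using F by (intro conjI L1loc_test_fun test_fun_sum_haar)
  have "series_sum (\<lambda>K x. b K * pairing ?h (haar 1 K) * haar 0 K x) dyadic g"
  proof (rule series_sum_cong[OF _ g])
    fix K :: "real set" assume K: "K \<in> dyadic"
    have "pairing ?h (haar 1 K) = (\<Sum>J\<in>F. pairing (\<lambda>x. d J * pairing ?f (haar 0 J) * haar 0 J x) (haar 1 K))"
      using F K by (intro pairing_sum L1loc_mult L1loc_haar test_fun_haar) auto
    then have "b K * pairing ?h (haar 1 K) = (\<Sum>J\<in>F. kern b d K J * c J)"
      using F K by (auto simp: pairing_mult sum_distrib_left pf kern_apply subset_iff intro!: sum.cong)
    then show "(\<lambda>x. (\<Sum>J\<in>F. kern b d K J * c J) * haar 0 K x) = (\<lambda>x. b K * pairing ?h (haar 1 K) * haar 0 K x)"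
      by simp
  qed
  then have "paraproduct b 0 1 ?h g"
    unfolding paraproduct_def using h by (auto simp: paraproduct_def series_sum_def)
  with h show ?thesis unfolding para_comp_def by blast
qed

lemma comp_coeff_haar_sum:
  assumes F: "finite F" "F \<subseteq> dyadic"
  shows "comp_coeff b d (\<lambda>x. \<Sum>J\<in>F. c J * haar 0 J x) K = (\<Sum>J\<in>F. kern b d K J * c J)"
  unfolding comp_coeff_def
  using F by (intro infsumI has_sum_finite_neutralI[OF F])
    (auto simp: pairing_sum_haar[OF F] subset_iff intro!: sum.cong)

lemma L2_bounded_by_of_finite_bound:
  assumes fb: "finite_bound b d C" and C: "0 \<le> C"
  shows "L2_bounded_by (para_comp b d) C"
proof -
  have "\<exists>g. g \<in> L2 \<and> series_sum (\<lambda>K x. comp_coeff b d f K * haar 0 K x) dyadic g \<and> L2norm g \<le> C * L2norm f"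
    if f: "f \<in> L2" for f
  proof -
    have sm: "(\<lambda>K. (cmod (comp_coeff b d f K))\<^sup>2) summable_on dyadic"
      by (rule summable_on_of_bounded_sums[OF _ comp_coeff_bound[OF fb f]]) simp
    obtain g where g: "g \<in> L2" "series_sum (\<lambda>K x. comp_coeff b d f K * haar 0 K x) dyadic g"
      "L2norm g = sqrt (\<Sum>\<^sub>\<infinity>K\<in>dyadic. (cmod (comp_coeff b d f K))\<^sup>2)"
      using Riesz_Fischer_haar[OF subset_refl sm] by blast
    have "(\<Sum>\<^sub>\<infinity>K\<in>dyadic. (cmod (comp_coeff b d f K))\<^sup>2) \<le> (C * L2norm f)\<^sup>2"
      unfolding power_mult_distrib by (rule infsum_le_finite_sums[OF sm comp_coeff_bound[OF fb f]])
    then have "L2norm g \<le> C * L2norm f"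
      unfolding g(3) using C L2norm_nonneg[of f] by (intro real_le_lsqrt mult_nonneg_nonneg)
    with g show ?thesis by blast
  qed
  then obtain T where T: "\<And>f. f \<in> L2 \<Longrightarrow> T f \<in> L2"
      "\<And>f. f \<in> L2 \<Longrightarrow> series_sum (\<lambda>K x. comp_coeff b d f K * haar 0 K x) dyadic (T f)"
      "\<And>f. f \<in> L2 \<Longrightarrow> L2norm (T f) \<le> C * L2norm f"
    by metis
  \<comment> \<open>\<open>T f\<close> is chosen separately for each \<open>f\<close>, so linearity
    is claimed only almost everywhere; it holds because both sides are sums of one Haar
    series.\<close>
  have "AE x in lborel. T (\<lambda>y. f y + z * g y) x = T f x + z * T g x" if f: "f \<in> L2" "g \<in> L2" for f g z
  proof -
    have "series_sum (\<lambda>K x. comp_coeff b d (\<lambda>y. f y + z * g y) K * haar 0 K x) dyadic (T (\<lambda>y. f y + z * g y))"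
      using f by (intro T L2_add)
    moreover have "series_sum (\<lambda>K x. comp_coeff b d (\<lambda>y. f y + z * g y) K * haar 0 K x) dyadic (\<lambda>x. T f x + z * T g x)"
      using series_sum_add[OF T(2)[OF f(1)] T(2)[OF f(2)], of z]
      by (simp add: comp_coeff_linear[OF fb f] algebra_simps)
    ultimately show ?thesis by (rule series_sum_unique)
  qed
  moreover have "para_comp b d f (T f)" if span: "f \<in> haar_span" for f
  proof -
    obtain F c where F: "finite F" "F \<subseteq> dyadic" and f: "f = (\<lambda>x. \<Sum>I\<in>F. c I * haar 0 I x)"
      using span by (rule haar_spanE)
    have "f \<in> L2" unfolding f using F by (intro L2_test_fun test_fun_sum_haar)
    from T(2)[OF this] show ?thesis
      unfolding f comp_coeff_haar_sum[OF F] by (intro para_comp_haar_sum F)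
  qed
  ultimately show ?thesis
    unfolding L2_bounded_by_def using C T(1,3) by (intro conjI exI[of _ T]) auto
qed

section \<open>The first test in terms of coefficients\<close>

lemma para_haar_series:
  assumes I: "I \<in> dyadic" and g: "g \<in> L2"
  shows "paraproduct b 0 1 (haar 0 I) g \<longleftrightarrow>
    series_sum (\<lambda>K x. b K * of_real (half_sign I K / sqrt (len I)) * haar 0 K x) dyadic g"
proof -
  let ?u = "\<lambda>K x. b K * pairing (haar 0 I) (haar 1 K) * haar 0 K x"
  let ?v = "\<lambda>K x. b K * of_real (half_sign I K / sqrt (len I)) * haar 0 K x"
  have "?u K = ?v K" if "K \<in> dyadic" for K
    by (simp add: pairing_haar_haar1[OF I that])
  then have "series_sum ?u dyadic g \<longleftrightarrow> series_sum ?v dyadic g"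
    using series_sum_cong[of dyadic ?u ?v g] series_sum_cong[of dyadic ?v ?u g] by auto
  then show ?thesis by (simp add: paraproduct_def L1loc_haar I)
qed

text \<open>The factor \<open>half_sign I K\<close> has modulus 1 strictly below \<open>I\<close>
  and is 0 elsewhere; hence the restriction to \<open>L \<subset> I\<close> and the factor
  \<open>1 / len I\<close>.\<close>

lemma para_haar_coeffs:
  fixes b :: "real set \<Rightarrow> complex"
  assumes I: "I \<in> dyadic"
  defines "t \<equiv> \<lambda>K. b K * complex_of_real (half_sign I K / sqrt (len I))"
  shows "(\<lambda>K. (cmod (t K))\<^sup>2) summable_on dyadic \<longleftrightarrow> (\<lambda>L. (cmod (b L))\<^sup>2) summable_on {L \<in> dyadic. L \<subset> I}"
    and "(\<Sum>\<^sub>\<infinity>K\<in>dyadic. (cmod (t K))\<^sup>2) = 1 / len I * (\<Sum>\<^sub>\<infinity>L\<in>{L \<in> dyadic. L \<subset> I}. (cmod (b L))\<^sup>2)"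
proof -
  let ?B = "{L \<in> dyadic. L \<subset> I}"
  have out: "(cmod (t K))\<^sup>2 = 0" if "K \<in> dyadic - ?B" for K
  proof -
    have "K \<notin> below (left_half I)" "K \<notin> below (right_half I)"
      using that strictly_below_decomp[OF I] by auto
    then show ?thesis by (simp add: t_def half_sign_def)
  qed
  have inn: "(cmod (t K))\<^sup>2 = 1 / len I * (cmod (b K))\<^sup>2" if "K \<in> dyadic \<inter> ?B" for K
    using half_sign_square[OF I, of K] that I strictly_below_decomp[OF I]
    by (simp add: t_def norm_mult norm_divide power_mult_distrib power_divide)
  have "(\<lambda>K. (cmod (t K))\<^sup>2) summable_on dyadic \<longleftrightarrow> (\<lambda>L. 1 / len I * (cmod (b L))\<^sup>2) summable_on ?B"
    using out inn by (intro summable_on_cong_neutral) auto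
  also have "\<dots> \<longleftrightarrow> (\<lambda>L. (cmod (b L))\<^sup>2) summable_on ?B"
    using I by (intro summable_on_cmult_right') simp
  finally show "(\<lambda>K. (cmod (t K))\<^sup>2) summable_on dyadic \<longleftrightarrow> (\<lambda>L. (cmod (b L))\<^sup>2) summable_on ?B" .
  have "(\<Sum>\<^sub>\<infinity>K\<in>dyadic. (cmod (t K))\<^sup>2) = (\<Sum>\<^sub>\<infinity>L\<in>?B. 1 / len I * (cmod (b L))\<^sup>2)"
    using out inn by (intro infsum_cong_neutral) auto
  also have "\<dots> = 1 / len I * (\<Sum>\<^sub>\<infinity>L\<in>?B. (cmod (b L))\<^sup>2)"
    by (rule infsum_cmult_right')
  finally show "(\<Sum>\<^sub>\<infinity>K\<in>dyadic. (cmod (t K))\<^sup>2) = 1 / len I * (\<Sum>\<^sub>\<infinity>L\<in>?B. (cmod (b L))\<^sup>2)" .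
qed

lemma test1_iff_coeff_test1: "test1 b d C \<longleftrightarrow> coeff_test1 b d C"
proof -
  have "(\<exists>g\<in>L2. paraproduct b 0 1 (haar 0 I) g \<and> cmod (d I) * L2norm g \<le> C) \<longleftrightarrow>
     (\<lambda>L. (cmod (b L))\<^sup>2) summable_on {L \<in> dyadic. L \<subset> I} \<and>
     cmod (d I) * sqrt (1 / len I * (\<Sum>\<^sub>\<infinity>L\<in>{L \<in> dyadic. L \<subset> I}. (cmod (b L))\<^sup>2)) \<le> C" (is "?l \<longleftrightarrow> ?r")
    if I: "I \<in> dyadic" for I
  proof
    assume ?l
    then obtain g where g: "g \<in> L2" "paraproduct b 0 1 (haar 0 I) g" "cmod (d I) * L2norm g \<le> C" by blast
    from para_haar_series[OF I g(1)] g(2)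
    have "series_sum (\<lambda>K x. b K * of_real (half_sign I K / sqrt (len I)) * haar 0 K x) dyadic g" by blast
    from haar_series_Parseval[OF this subset_refl g(1)] show ?r
      using g(3) unfolding para_haar_coeffs[OF I] by simp
  next
    assume r: ?r
    then obtain g where g: "g \<in> L2" "series_sum (\<lambda>K x. b K * of_real (half_sign I K / sqrt (len I)) * haar 0 K x) dyadic g"
      "L2norm g = sqrt (\<Sum>\<^sub>\<infinity>K\<in>dyadic. (cmod (b K * complex_of_real (half_sign I K / sqrt (len I))))\<^sup>2)"
      using Riesz_Fischer_haar[OF subset_refl, of "\<lambda>K. b K * of_real (half_sign I K / sqrt (len I))"]
      unfolding para_haar_coeffs(1)[OF I] by blast
    then show ?l
      using r para_haar_series[OF I g(1)] unfolding para_haar_coeffs(2)[OF I] by (intro bexI[of _ g]) auto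
  qed
  then show ?thesis unfolding test1_def coeff_test1_def by (intro conj_cong refl ball_cong imp_cong) simp
qed

section \<open>The second test in terms of coefficients\<close>

lemma Q_seq_below: "Q_seq I a g \<longleftrightarrow> series_sum (\<lambda>J x. a J * haar 0 J x) (below I) g"
  by (simp add: Q_seq_def below_def)

lemma Q_fun_below: "Q_fun I f g \<longleftrightarrow> f \<in> L1loc \<and> series_sum (\<lambda>J x. pairing f (haar 0 J) * haar 0 J x) (below I) g"
  by (simp add: Q_fun_def below_def)

lemma below_subset_dyadic: "below I \<subseteq> dyadic"
  by (auto simp: below_def)

text \<open>The products \<open>b K * cnj (b K)\<close> are the weights \<open>|b K|^2\<close>,
  which is why the second condition involves the conjugate sequence. \<open>J\<close> may be any
  dyadic interval because those not inside \<open>I\<close> matter in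
  \<open>exists_para00\<close>.\<close>

lemma pairing_para10:
  assumes p: "Q_seq I (\<lambda>J. cnj (b J)) p" and r: "paraproduct b 1 0 p r" and J: "J \<in> dyadic"
  shows "((\<lambda>K. complex_of_real (half_sign J K * (cmod (b K))\<^sup>2 / sqrt (len J))) has_sum pairing r (haar 0 J)) (below I)"
proof -
  have pk: "pairing p (haar 0 K) = (if K \<in> below I then cnj (b K) else 0)" if "K \<in> dyadic" for K
    using haar_series_coeff[OF p[unfolded Q_seq_below] below_subset_dyadic that] .
  have "((\<lambda>K. pairing (\<lambda>x. b K * pairing p (haar 0 K) * haar 1 K x) (haar 0 J)) has_sum pairing r (haar 0 J)) dyadic"
    using r unfolding paraproduct_def by (intro series_sum_pairing test_fun_haar J) auto
  then show ?thesis
  proof (rule has_sum_cong_neutral[THEN iffD1, rotated -1])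
    fix K assume "K \<in> dyadic \<inter> below I"
    then have "pairing (\<lambda>x. b K * pairing p (haar 0 K) * haar 1 K x) (haar 0 J) =
        (b K * cnj (b K)) * of_real (half_sign J K / sqrt (len J))"
      by (simp add: pairing_mult pk pairing_haar1_haar[OF J])
    also have "\<dots> = of_real ((cmod (b K))\<^sup>2 * (half_sign J K / sqrt (len J)))"
      by (simp only: complex_norm_square of_real_mult)
    finally show "pairing (\<lambda>x. b K * pairing p (haar 0 K) * haar 1 K x) (haar 0 J) =
        complex_of_real (half_sign J K * (cmod (b K))\<^sup>2 / sqrt (len J))"
      by (simp add: mult_ac)
  qed (use below_subset_dyadic in \<open>auto simp: pk pairing_mult\<close>)
qed

lemma pairing_para10_below:
  assumes p: "Q_seq I (\<lambda>J. cnj (b J)) p" and r: "paraproduct b 1 0 p r"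
    and I: "I \<in> dyadic" and sm: "(\<lambda>K. (cmod (b K))\<^sup>2) summable_on below I" and J: "J \<in> below I"
  shows "pairing r (haar 0 J) = of_real (child_diff b J / sqrt (len J))"
proof -
  have Jd: "J \<in> dyadic" using J by (simp add: below_def)
  have "((\<lambda>K. inverse (sqrt (len J)) * (half_sign J K * (cmod (b K))\<^sup>2)) has_sum
     inverse (sqrt (len J)) * child_diff b J) (below I)"
    unfolding child_diff_def below_def[symmetric]
    by (intro has_sum_cmult_right half_sign_sum_tendsto I sm J)
  from has_sum_of_real[OF this, where 'a = complex]
  have "((\<lambda>K. complex_of_real (half_sign J K * (cmod (b K))\<^sup>2 / sqrt (len J))) has_sum
     of_real (child_diff b J / sqrt (len J))) (below I)"
    by (simp add: field_simps)
  with pairing_para10[OF p r Jd] show ?thesis by (rule has_sum_unique)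
qed

lemma coeff_test2_of_test2:
  assumes "test2 b d C"
  shows "coeff_test2 b d C"
  unfolding coeff_test2_def below_def[symmetric]
proof (intro conjI ballI impI)
  show "0 \<le> C" using assms by (simp add: test2_def)
  fix I assume I: "I \<in> dyadic" and sm: "(\<lambda>L. (cmod (b L))\<^sup>2) summable_on below I"
  obtain q where q: "q \<in> L2" "Q_seq I b q" "L2norm q = sqrt (\<Sum>\<^sub>\<infinity>L\<in>below I. (cmod (b L))\<^sup>2)"
    using Riesz_Fischer_haar[OF below_subset_dyadic sm] unfolding Q_seq_below by blast
  then obtain p g r s where p: "Q_seq I (\<lambda>J. cnj (b J)) p" and r: "paraproduct b 1 0 p r"
    and s: "paraproduct d 0 0 r s" and g: "Q_fun I s g" "g \<in> L2" "L2norm g \<le> C * L2norm q"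
    using assms I unfolding test2_def by blast
  have eq: "(cmod (pairing s (haar 0 J)))\<^sup>2 = (cmod (d J))\<^sup>2 / len J * (child_diff b J)\<^sup>2" if J: "J \<in> below I" for J
  proof -
    have "pairing s (haar 0 J) = d J * of_real (child_diff b J / sqrt (len J))"
      using paraproduct00_coeff[OF s, of J] pairing_para10_below[OF p r I sm J] J by (simp add: below_def)
    then show ?thesis by (simp add: norm_mult norm_divide power_mult_distrib power_divide)
  qed
  note P = haar_series_Parseval[OF g(1)[unfolded Q_fun_below, THEN conjunct2] below_subset_dyadic g(2)]
  show "(\<lambda>J. (cmod (d J))\<^sup>2 / len J * (child_diff b J)\<^sup>2) summable_on below I"
    using P(1) eq by (simp cong: summable_on_cong)
  have "L2norm g = sqrt (\<Sum>\<^sub>\<infinity>J\<in>below I. (cmod (d J))\<^sup>2 / len J * (child_diff b J)\<^sup>2)"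
    using P(2) eq by (simp cong: infsum_cong)
  then show "sqrt (\<Sum>\<^sub>\<infinity>J\<in>below I. (cmod (d J))\<^sup>2 / len J * (child_diff b J)\<^sup>2)
      \<le> C * sqrt (\<Sum>\<^sub>\<infinity>L\<in>below I. (cmod (b L))\<^sup>2)"
    using g(3) q(3) by simp
qed

lemma integrable_indicator_dyadic:
  assumes "K \<in> dyadic"
  shows "integrable lborel (indicator K :: real \<Rightarrow> real)"
  by (intro integrable_real_indicator dyadic_sets dyadic_emeasure_finite assms)

text \<open>Normalization in \<open>L^1\<close>: the bound is independent of \<open>K\<close>, so
  summability of \<open>|b K|^2\<close> alone makes the series in \<open>exists_para10\<close>
  converge absolutely in local mean.\<close>

lemma local_norm_haar1:
  assumes "K \<in> dyadic"
  shows "local_norm a b (haar 1 K) \<le> 1"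
proof -
  have "local_norm a b (haar 1 K) \<le> (LINT x|lborel. indicator K x / len K)"
    unfolding set_lebesgue_integral_def
  proof (rule integral_mono)
    show "integrable lborel (\<lambda>x. indicator {a..b} x *\<^sub>R cmod (haar 1 K x))"
      using L1loc_integrable_cmod[OF L1loc_haar[OF assms]] by (simp add: set_integrable_def)
    show "integrable lborel (\<lambda>x. indicator K x / len K)"
      by (intro Bochner_Integration.integrable_divide integrable_indicator_dyadic assms)
    show "indicator {a..b} x *\<^sub>R cmod (haar 1 K x) \<le> indicator K x / len K" for x
      by (simp add: haar_def norm_divide indicator_def)
  qed
  also have "\<dots> = 1"
    using dyadic_sets[OF assms] len_neq_0[OF assms] by (simp add: len_def)
  finally show ?thesis .
qed

lemma local_norm_haar0:
  assumes "J \<in> dyadic"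
  shows "local_norm a b (haar 0 J) \<le> \<bar>b - a\<bar> / sqrt (len J)"
proof -
  have "local_norm a b (haar 0 J) \<le> (LINT x|lborel. indicator {a..b} x / sqrt (len J))"
    unfolding set_lebesgue_integral_def
  proof (rule integral_mono)
    show "integrable lborel (\<lambda>x. indicator {a..b} x *\<^sub>R cmod (haar 0 J x))"
      using L1loc_integrable_cmod[OF L1loc_haar[OF assms]] by (simp add: set_integrable_def)
    show "integrable lborel (\<lambda>x. indicator {a..b} x / sqrt (len J))"
      by (intro Bochner_Integration.integrable_divide integrable_indicator_Icc)
    fix x
    have "\<bar>indicator (right_half J) x - indicator (left_half J) x\<bar> \<le> (1::real)"
      by (auto simp: indicator_def)
    then have "cmod (haar 0 J x) \<le> 1 / sqrt (len J)"
      by (simp add: haar_def norm_divide divide_right_mono flip: of_real_diff)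
    then have "indicator {a..b} x * cmod (haar 0 J x) \<le> indicator {a..b} x * (1 / sqrt (len J))"
      by (intro mult_left_mono) auto
    then show "indicator {a..b} x *\<^sub>R cmod (haar 0 J x) \<le> indicator {a..b} x / sqrt (len J)" by simp
  qed
  also have "\<dots> = measure lborel {a..b} / sqrt (len J)" by simp
  also have "\<dots> \<le> \<bar>b - a\<bar> / sqrt (len J)"
    by (intro divide_right_mono) (cases "a \<le> b"; auto)+
  finally show ?thesis .
qed

text \<open>Lengths double from one ancestor to the next, so the sum is dominated by a geometric
  series of ratio \<open>1 / sqrt 2\<close>.\<close>

lemma summable_ancestors:
  assumes I: "I \<in> dyadic"
  shows "(\<lambda>J. 1 / sqrt (len J)) summable_on {J \<in> dyadic. I \<subseteq> J}"
proof -
  obtain A :: "nat \<Rightarrow> real set" where A: "{J \<in> dyadic. I \<subseteq> J} \<subseteq> range A" "\<And>n. len (A n) = 2 ^ n * len I"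
    using ancestors_enum[OF I] by blast
  have "inj A"
  proof (rule injI)
    fix m n assume "A m = A n"
    then have "(2::real) ^ m * len I = 2 ^ n * len I" using A(2) by metis
    then show "m = n" using I by simp
  qed
  have "(\<lambda>n. (1 / sqrt (len I)) * (1 / sqrt 2) ^ n) summable_on UNIV"
  proof (rule norm_summable_imp_summable_on)
    have "summable (\<lambda>n. (1 / sqrt 2 :: real) ^ n)" by (rule summable_geometric) simp
    then show "summable (\<lambda>n. norm ((1 / sqrt (len I)) * (1 / sqrt 2) ^ n))"
      by (simp add: norm_mult norm_power summable_mult)
  qed
  moreover have "(\<lambda>J. 1 / sqrt (len J)) \<circ> A = (\<lambda>n. (1 / sqrt (len I)) * (1 / sqrt 2) ^ n)"
    by (auto simp: A(2) real_sqrt_mult real_sqrt_power power_divide)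
  ultimately have "(\<lambda>J. 1 / sqrt (len J)) summable_on range A"
    by (simp add: summable_on_reindex[OF \<open>inj A\<close>])
  then show ?thesis using A(1) by (rule summable_on_subset_banach)
qed

lemma exists_para10:
  assumes p: "Q_seq I (\<lambda>J. cnj (b J)) p" and sm: "(\<lambda>K. (cmod (b K))\<^sup>2) summable_on below I"
  obtains r where "paraproduct b 1 0 p r"
proof -
  have pk: "pairing p (haar 0 K) = (if K \<in> below I then cnj (b K) else 0)" if "K \<in> dyadic" for K
    using haar_series_coeff[OF p[unfolded Q_seq_below] below_subset_dyadic that] .
  let ?u = "\<lambda>K x. b K * pairing p (haar 0 K) * haar 1 K x"
  have "L1loc_Cauchy ?u dyadic"
  proof (rule L1loc_Cauchy_of_summable)
    show "?u K \<in> L1loc" if "K \<in> dyadic" for K using that by (intro L1loc_mult L1loc_haar)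
    fix x y :: real
    show "(\<lambda>K. local_norm x y (?u K)) summable_on dyadic"
    proof (rule summable_on_comparison_test)
      have "(\<lambda>K. if K \<in> below I then (cmod (b K))\<^sup>2 else 0) summable_on dyadic \<longleftrightarrow> (\<lambda>K. (cmod (b K))\<^sup>2) summable_on below I"
        using below_subset_dyadic by (intro summable_on_cong_neutral) auto
      with sm show "(\<lambda>K. if K \<in> below I then (cmod (b K))\<^sup>2 else 0) summable_on dyadic" by simp
      fix K :: "real set" assume K: "K \<in> dyadic"
      have "local_norm x y (?u K) = cmod (b K * pairing p (haar 0 K)) * local_norm x y (haar 1 K)"
        by (rule local_norm_mult)
      also have "\<dots> \<le> cmod (b K * pairing p (haar 0 K)) * 1"
        using K by (intro mult_left_mono local_norm_haar1) auto
      also have "\<dots> = (if K \<in> below I then (cmod (b K))\<^sup>2 else 0)"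
        using K by (simp add: pk norm_mult power2_eq_square)
      finally show "local_norm x y (?u K) \<le> (if K \<in> below I then (cmod (b K))\<^sup>2 else 0)" .
    qed (rule local_norm_nonneg)
  qed
  then obtain r where "series_sum ?u dyadic r" by (rule L1loc_Cauchy_sum)
  moreover have "p \<in> L1loc" using p by (simp add: Q_seq_def series_sum_def)
  ultimately show thesis by (intro that) (simp add: paraproduct_def)
qed

lemma L1loc_Cauchy_zero:
  assumes "\<And>i x. i \<in> A \<Longrightarrow> u i x = 0"
  shows "L1loc_Cauchy u A"
proof (rule L1loc_Cauchy_of_summable)
  have u: "u i = (\<lambda>x. 0)" if "i \<in> A" for i using assms that by auto
  then show "u i \<in> L1loc" if "i \<in> A" for i using that L1loc_zero by simp
  show "(\<lambda>i. local_norm a b (u i)) summable_on A" for a b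
    by (rule summable_on_cong[THEN iffD2, of _ _ "\<lambda>_. 0"]) (simp_all add: assms set_lebesgue_integral_def)
qed

text \<open>
  This is where the second testing condition draws on the first: the terms from the ancestors of \<open>I\<close>
  need not be square summable, and only the bound for \<open>d\<^sub>J\<close> makes them converge in local mean.
\<close>

lemma exists_para00:
  fixes b d :: "real set \<Rightarrow> complex"
  defines "\<mu> \<equiv> \<lambda>K. (cmod (b K))\<^sup>2"
  assumes p: "Q_seq I (\<lambda>J. cnj (b J)) p" and r: "paraproduct b 1 0 p r"
    and I: "I \<in> dyadic" and sm: "\<mu> summable_on below I" and t1: "coeff_test1 b d C1"
    and l2: "(\<lambda>J. (cmod (d J * pairing r (haar 0 J)))\<^sup>2) summable_on below I"
  obtains s where "paraproduct d 0 0 r s"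
proof -
  let ?u = "\<lambda>J x. d J * pairing r (haar 0 J) * haar 0 J x"
  let ?anc = "{J \<in> dyadic. I \<subset> J}"
  let ?m = "infsum \<mu> (below I)"
  have m0: "0 \<le> ?m" by (intro infsum_nonneg) (simp add: \<mu>_def)
  have C1: "0 \<le> C1" using t1 by (simp add: coeff_test1_def)
  have rJ: "cmod (pairing r (haar 0 J)) \<le> ?m / sqrt (len J)" if J: "J \<in> dyadic" for J
  proof (rule order_trans)
    let ?f = "\<lambda>K. complex_of_real (half_sign J K * (cmod (b K))\<^sup>2 / sqrt (len J))"
    have le: "norm (?f K) \<le> inverse (sqrt (len J)) * \<mu> K" for K
    proof -
      have "\<bar>half_sign J K\<bar> \<le> 1" by (auto simp: half_sign_def indicator_def)
      then have "\<bar>half_sign J K\<bar> * (\<mu> K * inverse (sqrt (len J))) \<le> 1 * (\<mu> K * inverse (sqrt (len J)))"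
        by (intro mult_right_mono) (auto simp: \<mu>_def)
      then show ?thesis by (simp add: \<mu>_def norm_mult norm_divide norm_power field_simps)
    qed
    have smc: "(\<lambda>K. inverse (sqrt (len J)) * \<mu> K) summable_on below I"
      using sm by (rule summable_on_cmult_right)
    have ab: "(\<lambda>K. norm (?f K)) summable_on below I"
      by (rule summable_on_comparison_test[OF smc le]) simp
    show "cmod (pairing r (haar 0 J)) \<le> (\<Sum>\<^sub>\<infinity>K\<in>below I. norm (?f K))"
      by (rule norm_has_sum_bound[OF has_sum_infsum[OF ab] pairing_para10[OF p r J]])
    have "(\<Sum>\<^sub>\<infinity>K\<in>below I. norm (?f K)) \<le> (\<Sum>\<^sub>\<infinity>K\<in>below I. inverse (sqrt (len J)) * \<mu> K)"
      by (rule infsum_mono[OF ab smc le])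
    also have "\<dots> = inverse (sqrt (len J)) * ?m" by (rule infsum_cmult_right')
    finally show "(\<Sum>\<^sub>\<infinity>K\<in>below I. norm (?f K)) \<le> ?m / sqrt (len J)" by (simp add: divide_inverse mult.commute)
  qed
  \<comment> \<open>The dyadic intervals inside \<open>I\<close>, strictly above it and disjoint
    from it are treated separately: square summability handles the first family, absolute
    convergence in local mean the second, and the third contributes nothing.\<close>
  have low: "L1loc_Cauchy ?u (below I)"
    by (rule L1loc_Cauchy_haar[OF below_subset_dyadic l2])
  have high: "L1loc_Cauchy ?u ?anc"
  proof (rule L1loc_Cauchy_of_summable)
    show "?u J \<in> L1loc" if "J \<in> ?anc" for J using that by (intro L1loc_mult L1loc_haar) auto
    fix x y :: real
    show "(\<lambda>J. local_norm x y (?u J)) summable_on ?anc"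
    proof (rule summable_on_comparison_test)
      have "(\<lambda>J. 1 / sqrt (len J)) summable_on ?anc"
        by (rule summable_on_subset_banach[OF summable_ancestors[OF I]]) auto
      then show "(\<lambda>J. (C1 * sqrt ?m * \<bar>y - x\<bar>) * (1 / sqrt (len J))) summable_on ?anc"
        by (rule summable_on_cmult_right)
      fix J assume "J \<in> ?anc"
      then have J: "J \<in> dyadic" "I \<subset> J" by auto
      \<comment> \<open>\<open>I\<close> lies in one half of \<open>J\<close>, so its mass is part
        of the mass that the first condition bounds at \<open>J\<close>.\<close>
      have dJ: "cmod (d J) * sqrt ?m / sqrt (len J) \<le> C1"
      proof (cases "d J = 0")
        case False
        note c = coeff_test1_below[OF t1 J(1) False, folded \<mu>_def]
        have sub: "\<mu> summable_on below (left_half J)" "\<mu> summable_on below (right_half J)"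
          using halves_subset by (blast intro: summable_on_below[OF c(1)])+
        have nn: "0 \<le> infsum \<mu> (below H)" for H by (intro infsum_nonneg) (simp add: \<mu>_def)
        have mono: "?m \<le> infsum \<mu> (below H)" if "I \<subseteq> H" "\<mu> summable_on below H" for H
          using that sm by (intro infsum_mono_neutral) (auto simp: below_def \<mu>_def)
        have "?m \<le> infsum \<mu> (below (right_half J)) + infsum \<mu> (below (left_half J))"
          using dyadic_psubset_half[OF J(1) I J(2)] mono[OF _ sub(1)] mono[OF _ sub(2)]
            nn[of "left_half J"] nn[of "right_half J"] by linarith
        then have "(cmod (d J))\<^sup>2 / len J * ?m \<le> (cmod (d J))\<^sup>2 / len J * (infsum \<mu> (below (right_half J)) + infsum \<mu> (below (left_half J)))"
          by (intro mult_left_mono) auto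
        also have "\<dots> \<le> C1\<^sup>2" by (rule c(2))
        finally have "(cmod (d J) * sqrt ?m / sqrt (len J))\<^sup>2 \<le> C1\<^sup>2"
          using m0 by (simp add: power_mult_distrib power_divide)
        then show ?thesis using C1 by (rule power2_le_imp_le)
      qed (use C1 in simp)
      have "local_norm x y (?u J) = cmod (d J) * cmod (pairing r (haar 0 J)) * local_norm x y (haar 0 J)"
        by (simp add: local_norm_mult norm_mult)
      also have "\<dots> \<le> cmod (d J) * (?m / sqrt (len J)) * (\<bar>y - x\<bar> / sqrt (len J))"
        using rJ[OF J(1)] local_norm_haar0[OF J(1), of x y] m0
        by (intro mult_mono mult_left_mono local_norm_nonneg) auto
      \<comment> \<open>One root of the mass and one factor \<open>1 / sqrt (len J)\<close> are
        absorbed with \<open>d J\<close> by the first condition; the remaining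
        \<open>1 / sqrt (len J)\<close> is summable over the ancestors.\<close>
      also have "\<dots> = (cmod (d J) * sqrt ?m / sqrt (len J)) * (sqrt ?m * \<bar>y - x\<bar> * (1 / sqrt (len J)))"
        using m0 by (simp add: field_simps)
      also have "\<dots> \<le> C1 * (sqrt ?m * \<bar>y - x\<bar> * (1 / sqrt (len J)))"
        using dJ m0 by (intro mult_right_mono) auto
      finally show "local_norm x y (?u J) \<le> (C1 * sqrt ?m * \<bar>y - x\<bar>) * (1 / sqrt (len J))"
        by (simp add: mult.assoc)
    qed (rule local_norm_nonneg)
  qed
  have rest: "L1loc_Cauchy ?u {J \<in> dyadic. J \<inter> I = {}}"
  proof (rule L1loc_Cauchy_zero)
    fix J x assume "J \<in> {J \<in> dyadic. J \<inter> I = {}}"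
    then have J: "J \<in> dyadic" "J \<inter> I = {}" by auto
    have "half_sign J K = 0" if "K \<in> below I" for K
    proof -
      have "K \<noteq> {}" "K \<subseteq> I" using that dyadic_nonempty[of K] by (auto simp: below_def)
      then have "\<not> K \<subseteq> left_half J" "\<not> K \<subseteq> right_half J"
        using J(2) halves_subset[of J] by blast+
      then show ?thesis by (simp add: half_sign_def below_def)
    qed
    then have "((\<lambda>K. complex_of_real (half_sign J K * (cmod (b K))\<^sup>2 / sqrt (len J))) has_sum 0) (below I)"
      by (intro has_sum_0) simp
    with pairing_para10[OF p r J(1)] have "pairing r (haar 0 J) = 0" by (rule has_sum_unique)
    then show "?u J x = 0" by simp
  qed
  have "dyadic = (below I \<union> ?anc) \<union> {J \<in> dyadic. J \<inter> I = {}}"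
    using dyadic_nested_or_disjoint[OF _ I] by (auto simp: below_def)
  then have "L1loc_Cauchy ?u dyadic"
    using L1loc_Cauchy_Un[OF L1loc_Cauchy_Un[OF low high] rest] by simp
  then obtain s where "series_sum ?u dyadic s" by (rule L1loc_Cauchy_sum)
  moreover have "r \<in> L1loc" using r by (simp add: paraproduct_def series_sum_def)
  ultimately show thesis by (intro that) (simp add: paraproduct_def)
qed

text \<open>\<open>C1\<close> serves the convergence of the intermediate series. The projection
  \<open>Q_fun I\<close> keeps just the coefficients inside \<open>I\<close>, so the norm estimate
  has the constant \<open>C2\<close> unchanged.\<close>

lemma test2_of_coeff_tests:
  assumes t1: "coeff_test1 b d C1" and t2: "coeff_test2 b d C2"
  shows "test2 b d C2"
  unfolding test2_def
proof (intro conjI ballI impI)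
  show "0 \<le> C2" using t2 by (simp add: coeff_test2_def)
  fix I q assume I: "I \<in> dyadic" and q: "q \<in> L2" "Q_seq I b q"
  note Pq = haar_series_Parseval[OF q(2)[unfolded Q_seq_below] below_subset_dyadic q(1)]
  have sm: "(\<lambda>L. (cmod (b L))\<^sup>2) summable_on below I" by (rule Pq(1))
  have t2I: "(\<lambda>J. (cmod (d J))\<^sup>2 / len J * (child_diff b J)\<^sup>2) summable_on below I"
    "sqrt (\<Sum>\<^sub>\<infinity>J\<in>below I. (cmod (d J))\<^sup>2 / len J * (child_diff b J)\<^sup>2) \<le> C2 * sqrt (\<Sum>\<^sub>\<infinity>L\<in>below I. (cmod (b L))\<^sup>2)"
    using t2 I sm unfolding coeff_test2_def below_def[symmetric] by auto
  have "(\<lambda>J. (cmod (cnj (b J)))\<^sup>2) summable_on below I" using sm by simp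
  from Riesz_Fischer_haar[OF below_subset_dyadic this]
  obtain p where p: "Q_seq I (\<lambda>J. cnj (b J)) p"
    unfolding Q_seq_below by blast
  obtain r where r: "paraproduct b 1 0 p r" using exists_para10[OF p sm] .
  have eq: "(cmod (d J * pairing r (haar 0 J)))\<^sup>2 = (cmod (d J))\<^sup>2 / len J * (child_diff b J)\<^sup>2" if "J \<in> below I" for J
    unfolding pairing_para10_below[OF p r I sm that]
    by (simp add: norm_mult norm_divide power_mult_distrib power_divide)
  have "(\<lambda>J. (cmod (d J * pairing r (haar 0 J)))\<^sup>2) summable_on below I"
    using t2I(1) eq by (simp cong: summable_on_cong)
  then obtain s where s: "paraproduct d 0 0 r s"
    using exists_para00[OF p r I sm t1] by blast
  have eqs: "(cmod (pairing s (haar 0 J)))\<^sup>2 = (cmod (d J))\<^sup>2 / len J * (child_diff b J)\<^sup>2" if "J \<in> below I" for J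
    using eq[OF that] paraproduct00_coeff[OF s, of J] that by (simp add: below_def)
  have "(\<lambda>J. (cmod (pairing s (haar 0 J)))\<^sup>2) summable_on below I"
    using t2I(1) eqs by (simp cong: summable_on_cong)
  from Riesz_Fischer_haar[OF below_subset_dyadic this]
  obtain g where g: "g \<in> L2" "series_sum (\<lambda>J x. pairing s (haar 0 J) * haar 0 J x) (below I) g"
    "L2norm g = sqrt (\<Sum>\<^sub>\<infinity>J\<in>below I. (cmod (pairing s (haar 0 J)))\<^sup>2)"
    by blast
  have "L2norm g \<le> C2 * L2norm q"
    unfolding g(3) Pq(2) using t2I(2) eqs by (simp cong: infsum_cong)
  moreover have "s \<in> L1loc" using s by (simp add: paraproduct_def series_sum_def)
  moreover have "Q_fun I s g" if "s \<in> L1loc"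
    using that g(2) by (simp add: Q_fun_below)
  ultimately have "(paraproduct b 1 0 OO paraproduct d 0 0 OO Q_fun I) p g" "L2norm g \<le> C2 * L2norm q"
    using r s by blast+
  then show "\<exists>p. \<exists>g\<in>L2. Q_seq I (\<lambda>J. cnj (b J)) p \<and>
      (paraproduct b 1 0 OO paraproduct d 0 0 OO Q_fun I) p g \<and> L2norm g \<le> C2 * L2norm q"
    using p g(1) by blast
qed

section \<open>Comparison of the best constants\<close>

lemma tests_iff_coeff_tests:
  "test1 b d C1 \<and> test2 b d C2 \<longleftrightarrow> coeff_test1 b d C1 \<and> coeff_test2 b d C2"
  using test1_iff_coeff_test1 coeff_test2_of_test2 test2_of_coeff_tests by blast

lemma L2_bounded_by_iff_finite_bound:
  "L2_bounded_by (para_comp b d) C \<longleftrightarrow> 0 \<le> C \<and> finite_bound b d C"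
  using finite_bound_of_L2_bounded_by L2_bounded_by_of_finite_bound
  by (auto simp: L2_bounded_by_def)

lemma tests_of_L2_bounded_by:
  assumes "L2_bounded_by (para_comp b d) C"
  shows "test1 b d C" "test2 b d C"
  using assms coeff_test1_of_finite_bound coeff_test2_of_finite_bound tests_iff_coeff_tests
  unfolding L2_bounded_by_iff_finite_bound by blast+

lemma test2_mono:
  assumes "test2 b d C" "C \<le> C'"
  shows "test2 b d C'"
proof -
  have "C * L2norm q \<le> C' * L2norm q" for q
    using assms(2) L2norm_nonneg by (rule mult_right_mono)
  then show ?thesis using assms unfolding test2_def by (meson order_trans)
qed

text \<open>The Bellman function divides by \<open>k = C2^2\<close>, so the second constant must be
  positive; \<open>e\<close> covers the case \<open>C2 = 0\<close> and is removed when best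
  constants are compared.\<close>

lemma L2_bounded_by_of_tests:
  assumes "test1 b d C1" "test2 b d C2" "0 < e"
  shows "L2_bounded_by (para_comp b d) (3 * (C1 + C2 + e))"
proof -
  have "test2 b d (C2 + e)" using assms(2,3) by (auto intro: test2_mono)
  then have t: "coeff_test1 b d C1" "coeff_test2 b d (C2 + e)"
    using assms(1) tests_iff_coeff_tests by blast+
  have nn: "0 \<le> C1" "0 \<le> C2" using assms by (auto simp: test1_def test2_def)
  have "finite_bound b d (3 * (C1 + (C2 + e)))"
    using t nn assms(3) by (intro finite_bound_of_coeff_tests) auto
  then show ?thesis
    using nn assms(3) by (simp add: L2_bounded_by_iff_finite_bound add.assoc)
qed

theorem theorem1p5:
  shows "\<exists>c C :: real. 0 < c \<and> c \<le> C \<and>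
    (\<forall>b d :: real set \<Rightarrow> complex.
       (L2_bounded (para_comp b d) \<longleftrightarrow> (\<exists>C1 C2. test1 b d C1 \<and> test2 b d C2)) \<and>
       (\<forall>C1 C2. test1 b d C1 \<and> test2 b d C2 \<longleftrightarrow> coeff_test1 b d C1 \<and> coeff_test2 b d C2) \<and>
       (L2_bounded (para_comp b d) \<longrightarrow>
          c * (Inf {C1. test1 b d C1} + Inf {C2. test2 b d C2}) \<le> L2_opnorm (para_comp b d) \<and>
          L2_opnorm (para_comp b d) \<le> C * (Inf {C1. test1 b d C1} + Inf {C2. test2 b d C2})))"
proof (rule exI[of _ "1/2"], rule exI[of _ 3], intro conjI allI impI)
  fix b d :: "real set \<Rightarrow> complex"
  let ?P = "para_comp b d" and ?S1 = "{C1. test1 b d C1}" and ?S2 = "{C2. test2 b d C2}"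
  show "L2_bounded ?P \<longleftrightarrow> (\<exists>C1 C2. test1 b d C1 \<and> test2 b d C2)"
    unfolding L2_bounded_def
    using tests_of_L2_bounded_by L2_bounded_by_of_tests[of b d _ _ 1] by (meson zero_less_one)
  show "test1 b d C1 \<and> test2 b d C2 \<longleftrightarrow> coeff_test1 b d C1 \<and> coeff_test2 b d C2" for C1 C2
    by (rule tests_iff_coeff_tests)
  assume "L2_bounded ?P"
  then obtain C0 where C0: "L2_bounded_by ?P C0" by (auto simp: L2_bounded_def)
  have bdd: "bdd_below ?S1" "bdd_below ?S2" "bdd_below {C. L2_bounded_by ?P C}"
    by (auto intro!: bdd_belowI[of _ 0] simp: test1_def test2_def L2_bounded_by_def)
  \<comment> \<open>A bound \<open>C\<close> of the operator is admissible in both tests, so each of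
    the two infima is at most \<open>C\<close>; hence the factor \<open>1/2\<close>.\<close>
  have "1/2 * (Inf ?S1 + Inf ?S2) \<le> C" if "L2_bounded_by ?P C" for C
    using cInf_lower[OF _ bdd(1), of C] cInf_lower[OF _ bdd(2), of C] tests_of_L2_bounded_by[OF that] by simp
  then show "1/2 * (Inf ?S1 + Inf ?S2) \<le> L2_opnorm ?P"
    unfolding L2_opnorm_def using C0 by (intro cInf_greatest) auto
  \<comment> \<open>The constants are optimized one after the other: for fixed \<open>C1\<close> the
    infimum over \<open>C2\<close> is taken, and then the one over \<open>C1\<close>. The auxiliary
    \<open>e\<close> disappears here.\<close>
  have upper: "L2_opnorm ?P / 3 - C1 \<le> C2" if "test1 b d C1" "test2 b d C2" for C1 C2
  proof (rule field_le_epsilon)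
    fix e :: real assume "0 < e"
    then have "L2_opnorm ?P \<le> 3 * (C1 + C2 + e)"
      unfolding L2_opnorm_def using L2_bounded_by_of_tests[OF that] by (intro cInf_lower bdd) auto
    then show "L2_opnorm ?P / 3 - C1 \<le> C2 + e" by simp
  qed
  have "L2_opnorm ?P / 3 - C1 \<le> Inf ?S2" if "test1 b d C1" for C1
    using upper[OF that] tests_of_L2_bounded_by[OF C0] by (intro cInf_greatest) auto
  then have "L2_opnorm ?P / 3 - Inf ?S2 \<le> C1" if "test1 b d C1" for C1
    using that by (simp add: algebra_simps)
  then have "L2_opnorm ?P / 3 - Inf ?S2 \<le> Inf ?S1"
    using tests_of_L2_bounded_by[OF C0] by (intro cInf_greatest) auto
  then show "L2_opnorm ?P \<le> 3 * (Inf ?S1 + Inf ?S2)" by simp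
qed simp_all

end
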